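(* Let $n\ge2$ and $N\ge1$. The $N$-th tensor power of the spinor representation $\Lambda E$ of $\mathfrak o(\tilde E)\cong\mathfrak o_{2n}(\mathbb C)$ decomposes into a direct sum of simple $\mathfrak o(\tilde E)$-modules as $$(\Lambda E)^{\otimes N}\cong\bigoplus_{(\mu_1,\dots,\mu_N)\in T^N}L_{\mu_1+\dots+\mu_N},$$ where $$T^N=\Big\{(\mu_1,\dots,\mu_N)\in P[\Lambda E]^N\ \Big|\ \mu_1=\omega_\pm,\ \sum_{i=1}^k\mu_i\in P_+\ \ \forall k\le N\Big\}.$$
   Context: $E$ is an $n$-dimensional complex vector space with basis $e_1,\dots,e_n$, $\tilde E=E\oplus E^*$ with symmetric form $(x+x^*,y+y^* )=\langle x,y^*\rangle+\langle x^*,y\rangle$. In the basis $(e_1,\dots,e_n,e_1^*,\dots,e_n^* )$ the Cartan subalgebra of $\mathfrak o(\tilde E)$ is spanned by $h_i=E_{ii}-E_{i+n,i+n}$; weights are $n$-tuples in the dual basis $h_i^*$, positive roots are $h_i^*\pm h_j^*$ for $i<j$, and $P_+$ is the set of dominant integral weights (entries all in $\mathbb Z$ or all in $\frac12+\mathbb Z$, $\lambda_1\ge\dots\ge\lambda_{n-1}\ge|\lambda_n|$). $L_\lambda$ is the irreducible representation of highest weight $\lambda$. The spinor representation is $\Lambda E$, where, with $M_{e_i}$ = left exterior multiplication by $e_i$ and $D_{e_i^*}$ = contraction with $e_i^*$, $E_{ij}-E_{j+n,i+n}$ acts by $\frac12(M_{e_i}D_{e_j^*}-D_{e_j^*}M_{e_i})$,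 $E_{i+n,j}-E_{j+n,i}$ by $D_{e_i^*}D_{e_j^*}$, and $E_{i,j+n}-E_{j,i+n}$ by $M_{e_i}M_{e_j}$. Its set of weights is $P[\Lambda E]=\{(\pm\frac12,\dots,\pm\frac12)\}$; $\Lambda E\cong L_{\omega_+}\oplus L_{\omega_-}$ with $\omega_\pm=(\frac12,\dots,\frac12,\pm\frac12)$. *)

theory Defs
  imports Complex_Main "Jordan_Normal_Form.Matrix" "HOL-Library.Function_Algebras"
begin

text \<open>
  All indices start at 0: the basis \<open>e_1, ..., e_n, e_1\<^sup>*, ..., e_n\<^sup>*\<close> is numbered
  \<open>0, ..., n - 1, n, ..., 2 n - 1\<close>, and a weight \<open>(\<nu>_1, ..., \<nu>_n)\<close> is a function
  \<open>\<nu> :: nat \<Rightarrow> real\<close> that vanishes outside \<open>{..<n}\<close>. Vector spaces are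
  subspaces of function spaces \<open>'i \<Rightarrow> complex\<close>.
\<close>

definition cscale :: "complex \<Rightarrow> ('i \<Rightarrow> complex) \<Rightarrow> 'i \<Rightarrow> complex" where
  "cscale c f = (\<lambda>i. c * f i)"

interpretation cfun: vector_space cscale
  by unfold_locales (auto simp: cscale_def fun_eq_iff algebra_simps)

definition linear_on :: "('i \<Rightarrow> complex) set \<Rightarrow> (('i \<Rightarrow> complex) \<Rightarrow> 'j \<Rightarrow> complex) \<Rightarrow> bool" where
  "linear_on V f \<longleftrightarrow>
     (\<forall>u\<in>V. \<forall>v\<in>V. f (u + v) = f u + f v) \<and> (\<forall>c. \<forall>v\<in>V. f (cscale c v) = cscale c (f v))"


section \<open>The orthogonal Lie algebra\<close>

definition sform :: "nat \<Rightarrow> complex vec \<Rightarrow> complex vec \<Rightarrow> complex" where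
  "sform n x y = (\<Sum>i<n. x $ i * y $ (i + n) + x $ (i + n) * y $ i)"

definition orth_alg :: "nat \<Rightarrow> complex mat set" where
  "orth_alg n = {X \<in> carrier_mat (2 * n) (2 * n).
     \<forall>x \<in> carrier_vec (2 * n). \<forall>y \<in> carrier_vec (2 * n).
       sform n (X *\<^sub>v x) y + sform n x (X *\<^sub>v y) = 0}"

definition lie_bracket :: "complex mat \<Rightarrow> complex mat \<Rightarrow> complex mat" where
  "lie_bracket X Y = X * Y - Y * X"

definition mat_unit :: "nat \<Rightarrow> nat \<Rightarrow> nat \<Rightarrow> complex mat" where
  "mat_unit n i j = mat (2 * n) (2 * n) (\<lambda>(a, b). if a = i \<and> b = j then 1 else 0)"

definition cartan_h :: "nat \<Rightarrow> nat \<Rightarrow> complex mat" where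
  "cartan_h n i = mat_unit n i i - mat_unit n (i + n) (i + n)"

definition unit_weight :: "nat \<Rightarrow> nat \<Rightarrow> real" where
  "unit_weight i = (\<lambda>k. if k = i then 1 else 0)"

definition positive_roots :: "nat \<Rightarrow> (nat \<Rightarrow> real) set" where
  "positive_roots n =
     {unit_weight i + unit_weight j | i j. i < j \<and> j < n} \<union>
     {unit_weight i - unit_weight j | i j. i < j \<and> j < n}"

definition root_space :: "nat \<Rightarrow> (nat \<Rightarrow> real) \<Rightarrow> complex mat set" where
  "root_space n \<alpha> = {X \<in> orth_alg n.
     \<forall>k<n. lie_bracket (cartan_h n k) X = complex_of_real (\<alpha> k) \<cdot>\<^sub>m X}"

definition dominant_weights :: "nat \<Rightarrow> (nat \<Rightarrow> real) set" where
  "dominant_weights n = {\<nu>.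
     (\<forall>i\<ge>n. \<nu> i = 0) \<and>
     ((\<forall>i<n. \<nu> i \<in> \<int>) \<or> (\<forall>i<n. \<nu> i - 1 / 2 \<in> \<int>)) \<and>
     (\<forall>i. i + 1 < n - 1 \<longrightarrow> \<nu> i \<ge> \<nu> (i + 1)) \<and>
     \<nu> (n - 2) \<ge> \<bar>\<nu> (n - 1)\<bar>}"


section \<open>Representations\<close>

record 'i rep =
  space :: "('i \<Rightarrow> complex) set"
  act :: "complex mat \<Rightarrow> ('i \<Rightarrow> complex) \<Rightarrow> 'i \<Rightarrow> complex"

definition is_rep :: "nat \<Rightarrow> 'i rep \<Rightarrow> bool" where
  "is_rep n R \<longleftrightarrow>
     cfun.subspace (space R) \<and>
     (\<forall>X \<in> orth_alg n. act R X ` space R \<subseteq> space R \<and> linear_on (space R) (act R X)) \<and>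
     (\<forall>X \<in> orth_alg n. \<forall>Y \<in> orth_alg n. \<forall>v \<in> space R.
        act R (X + Y) v = act R X v + act R Y v \<and>
        act R (lie_bracket X Y) v = act R X (act R Y v) - act R Y (act R X v)) \<and>
     (\<forall>c. \<forall>X \<in> orth_alg n. \<forall>v \<in> space R. act R (c \<cdot>\<^sub>m X) v = cscale c (act R X v))"

definition is_subrep :: "nat \<Rightarrow> 'i rep \<Rightarrow> ('i \<Rightarrow> complex) set \<Rightarrow> bool" where
  "is_subrep n R W \<longleftrightarrow>
     W \<subseteq> space R \<and> cfun.subspace W \<and> (\<forall>X \<in> orth_alg n. act R X ` W \<subseteq> W)"

definition irreducible_rep :: "nat \<Rightarrow> 'i rep \<Rightarrow> bool" where
  "irreducible_rep n R \<longleftrightarrow>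
     is_rep n R \<and> space R \<noteq> {0} \<and> (\<forall>W. is_subrep n R W \<longrightarrow> W = {0} \<or> W = space R)"

definition rep_iso :: "nat \<Rightarrow> 'i rep \<Rightarrow> 'j rep \<Rightarrow> bool" where
  "rep_iso n R S \<longleftrightarrow> (\<exists>\<phi>. linear_on (space R) \<phi> \<and> bij_betw \<phi> (space R) (space S) \<and>
     (\<forall>X \<in> orth_alg n. \<forall>v \<in> space R. \<phi> (act R X v) = act S X (\<phi> v)))"

definition weight_vector :: "nat \<Rightarrow> 'i rep \<Rightarrow> (nat \<Rightarrow> real) \<Rightarrow> ('i \<Rightarrow> complex) \<Rightarrow> bool" where
  "weight_vector n R \<nu> v \<longleftrightarrow> v \<in> space R \<and> v \<noteq> 0 \<and>
     (\<forall>i<n. act R (cartan_h n i) v = cscale (complex_of_real (\<nu> i)) v)"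

definition weights :: "nat \<Rightarrow> 'i rep \<Rightarrow> (nat \<Rightarrow> real) set" where
  "weights n R = {\<nu>. (\<forall>i\<ge>n. \<nu> i = 0) \<and> (\<exists>v. weight_vector n R \<nu> v)}"

definition highest_weight_vector ::
    "nat \<Rightarrow> 'i rep \<Rightarrow> (nat \<Rightarrow> real) \<Rightarrow> ('i \<Rightarrow> complex) \<Rightarrow> bool" where
  "highest_weight_vector n R \<nu> v \<longleftrightarrow> weight_vector n R \<nu> v \<and>
     (\<forall>\<alpha> \<in> positive_roots n. \<forall>X \<in> root_space n \<alpha>. act R X v = 0)"

definition irreducible_of_highest_weight :: "nat \<Rightarrow> (nat \<Rightarrow> real) \<Rightarrow> 'i rep \<Rightarrow> bool" where
  "irreducible_of_highest_weight n \<nu> R \<longleftrightarrow>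
     irreducible_rep n R \<and> (\<exists>v. highest_weight_vector n R \<nu> v)"

text \<open>
  \<open>L_\<nu>\<close> is only defined up to isomorphism. It has countable dimension, so some copy of it
  lives in \<open>nat \<Rightarrow> complex\<close>.
\<close>

definition L_rep :: "nat \<Rightarrow> (nat \<Rightarrow> real) \<Rightarrow> nat rep" where
  "L_rep n \<nu> = (SOME R. irreducible_of_highest_weight n \<nu> R)"

definition direct_sum :: "'t set \<Rightarrow> ('t \<Rightarrow> 'i rep) \<Rightarrow> ('t \<times> 'i) rep" where
  "direct_sum T R = \<lparr>
     space = {f. (\<forall>t\<in>T. (\<lambda>i. f (t, i)) \<in> space (R t)) \<and> (\<forall>t i. t \<notin> T \<longrightarrow> f (t, i) = 0) \<and>
                 finite {t. \<exists>i. f (t, i) \<noteq> 0}},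
     act = (\<lambda>X f (t, i). if t \<in> T then act (R t) X (\<lambda>j. f (t, j)) i else 0)\<rparr>"

text \<open>
  For \<open>V \<subseteq> ('i \<Rightarrow> complex)\<close>, the \<open>N\<close>-th tensor power of \<open>V\<close> is realised inside the functions
  on lists of length \<open>N\<close>. In the action, the \<open>k\<close>-th summand is \<open>X\<close> applied to the \<open>k\<close>-th
  tensor factor; see \<open>tensor_power_act_pure\<close> below.
\<close>

definition pure_tensor :: "('i \<Rightarrow> complex) list \<Rightarrow> 'i list \<Rightarrow> complex" where
  "pure_tensor vs = (\<lambda>is. if length is = length vs then \<Prod>k<length vs. (vs ! k) (is ! k) else 0)"

definition tensor_power :: "nat \<Rightarrow> 'i rep \<Rightarrow> 'i list rep" where
  "tensor_power N R = \<lparr>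
     space = cfun.span {pure_tensor vs | vs. length vs = N \<and> set vs \<subseteq> space R},
     act = (\<lambda>X F is. if length is = N
                     then \<Sum>k<N. act R X (\<lambda>i. F (is[k := i])) (is ! k) else 0)\<rparr>"

lemma tensor_power_act_pure:
  assumes R: "is_rep n R" and X: "X \<in> orth_alg n" and vs: "set vs \<subseteq> space R"
  shows "act (tensor_power (length vs) R) X (pure_tensor vs) =
           (\<Sum>k<length vs. pure_tensor (vs[k := act R X (vs ! k)]))"
proof
  fix "is" :: "'a list"
  have app: "(\<Sum>k<m. g k) x = (\<Sum>k<m. g k x)" for g :: "nat \<Rightarrow> 'a list \<Rightarrow> complex" and m x
    by (induction m) auto
  have slot: "act R X (\<lambda>i. pure_tensor vs (is[k := i])) (is ! k) =
      pure_tensor (vs[k := act R X (vs ! k)]) is"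
    if k: "k < length vs" and len: "length is = length vs" for k
  proof -
    define c where "c = (\<Prod>l\<in>{..<length vs} - {k}. (vs ! l) (is ! l))"
    have split: "(\<Prod>l<length vs. h l) = h k * (\<Prod>l\<in>{..<length vs} - {k}. h l)"
      for h :: "nat \<Rightarrow> complex"
      using k by (subst prod.remove[of _ k]) auto
    have "(\<lambda>i. pure_tensor vs (is[k := i])) = cscale c (vs ! k)"
      using k len by (auto simp: pure_tensor_def cscale_def split c_def fun_eq_iff intro!: prod.cong)
    moreover have "vs ! k \<in> space R"
      using vs k by auto
    ultimately have "act R X (\<lambda>i. pure_tensor vs (is[k := i])) = cscale c (act R X (vs ! k))"
      using R X by (auto simp: is_rep_def linear_on_def)
    moreover have "pure_tensor (vs[k := act R X (vs ! k)]) is = c * act R X (vs ! k) (is ! k)"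
      using k len by (auto simp: pure_tensor_def split c_def intro!: prod.cong)
    ultimately show ?thesis
      by (simp add: cscale_def)
  qed
  show "act (tensor_power (length vs) R) X (pure_tensor vs) is =
      (\<Sum>k<length vs. pure_tensor (vs[k := act R X (vs ! k)])) is"
  proof (cases "length is = length vs")
    case True
    then show ?thesis
      unfolding app by (auto simp: tensor_power_def slot intro!: sum.cong)
  next
    case False
    then show ?thesis
      unfolding app by (auto simp: tensor_power_def pure_tensor_def)
  qed
qed


section \<open>The spinor representation\<close>

text \<open>
  An element of the exterior algebra is given by its coordinates with respect to the basis
  \<open>e_I = e_{i_1} \<and> ... \<and> e_{i_k}\<close>, where \<open>I = {i_1 < ... < i_k} \<subseteq> {..<n}\<close>. Thus
  \<open>M_{e_i} e_I = \<plusminus> e_{I \<union> {i}}\<close> if \<open>i \<notin> I\<close> and \<open>D_{e_i\<^sup>*} e_I = \<plusminus> e_{I - {i}}\<close> if \<open>i \<in> I\<close>,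
  and both are 0 otherwise; the sign is \<open>ext_sign i I\<close>.
\<close>

definition ext_space :: "nat \<Rightarrow> (nat set \<Rightarrow> complex) set" where
  "ext_space n = {f. \<forall>I. \<not> I \<subseteq> {..<n} \<longrightarrow> f I = 0}"

definition ext_sign :: "nat \<Rightarrow> nat set \<Rightarrow> complex" where
  "ext_sign i I = (-1) ^ card {j \<in> I. j < i}"

definition ext_mult :: "nat \<Rightarrow> (nat set \<Rightarrow> complex) \<Rightarrow> nat set \<Rightarrow> complex" where
  "ext_mult i f = (\<lambda>I. if i \<in> I then ext_sign i I * f (I - {i}) else 0)"

definition ext_contract :: "nat \<Rightarrow> (nat set \<Rightarrow> complex) \<Rightarrow> nat set \<Rightarrow> complex" where
  "ext_contract i f = (\<lambda>I. if i \<notin> I then ext_sign i I * f (insert i I) else 0)"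

text \<open>
  Every \<open>X\<close> in \<open>orth_alg n\<close> is the sum of its entries \<open>X $$ (i, j)\<close> times
  \<open>E_{i,j} - E_{j+n,i+n}\<close> over all \<open>i, j\<close>, of \<open>X $$ (i, j + n)\<close> times
  \<open>E_{i,j+n} - E_{j,i+n}\<close> over \<open>i < j\<close>, and of \<open>X $$ (i + n, j)\<close> times
  \<open>E_{i+n,j} - E_{j+n,i}\<close> over \<open>i < j\<close>. The action is the linear extension of its values on
  these generators, see \<open>spinor_act_gl\<close>, \<open>spinor_act_mult\<close> and \<open>spinor_act_contract\<close> below.
\<close>

definition spinor_act :: "nat \<Rightarrow> complex mat \<Rightarrow> (nat set \<Rightarrow> complex) \<Rightarrow> nat set \<Rightarrow> complex" where
  "spinor_act n X f =
     (\<Sum>i<n. \<Sum>j<n. cscale (X $$ (i, j) / 2)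
        (ext_mult i (ext_contract j f) - ext_contract j (ext_mult i f))) +
     (\<Sum>j<n. \<Sum>i<j. cscale (X $$ (i, j + n)) (ext_mult i (ext_mult j f))) +
     (\<Sum>j<n. \<Sum>i<j. cscale (X $$ (i + n, j)) (ext_contract i (ext_contract j f)))"

definition spinor_rep :: "nat \<Rightarrow> nat set rep" where
  "spinor_rep n = \<lparr>space = ext_space n, act = spinor_act n\<rparr>"

lemma spinor_act_gl:
  assumes "i < n" "j < n"
  shows "spinor_act n (mat_unit n i j - mat_unit n (j + n) (i + n)) f =
     cscale (1 / 2) (ext_mult i (ext_contract j f) - ext_contract j (ext_mult i f))"
    (is "spinor_act n ?X f = _")
proof -
  define g where "g a b = ext_mult a (ext_contract b f) - ext_contract b (ext_mult a f)" for a b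
  have X: "?X $$ (a, b) = (if b = j then if a = i then 1 else 0 else 0)"
    "?X $$ (a, b + n) = 0" "?X $$ (a + n, b) = 0" if "a < n" "b < n" for a b
    using assms that by (auto simp: mat_unit_def)
  have "(\<Sum>a<n. \<Sum>b<n. cscale (?X $$ (a, b) / 2) (g a b)) =
      (\<Sum>a<n. \<Sum>b<n. if b = j then if a = i then cscale (1 / 2) (g a b) else 0 else 0)"
    by (intro sum.cong refl) (simp add: X)
  also have "\<dots> = cscale (1 / 2) (g i j)"
    using assms by simp
  finally show ?thesis
    unfolding spinor_act_def g_def[symmetric] by (simp add: X)
qed

lemma ext_sign_insert:
  "ext_sign i (insert j I) = (if j < i \<and> j \<notin> I then - ext_sign i I else ext_sign i I)"
proof -
  have "{k \<in> insert j I. k < i} =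
      (if j < i then insert j {k \<in> I. k < i} else {k \<in> I. k < i})"
    by auto
  moreover have "finite {k \<in> I. k < i}"
    by auto
  ultimately show ?thesis
    by (auto simp: ext_sign_def insert_absorb)
qed

lemma ext_sign_remove:
  "ext_sign i (I - {j}) = (if j < i \<and> j \<in> I then - ext_sign i I else ext_sign i I)"
  using ext_sign_insert[of i j "I - {j}"] by (cases "j \<in> I") (auto simp: insert_absorb)

lemma ext_mult_anticomm: "ext_mult i (ext_mult j f) = - ext_mult j (ext_mult i f)"
  by (rule ext, cases i j rule: linorder_cases)
     (auto simp: ext_mult_def ext_sign_remove Diff_insert2[symmetric] insert_commute)

lemma ext_contract_anticomm:
  "ext_contract i (ext_contract j f) = - ext_contract j (ext_contract i f)"
  by (rule ext, cases i j rule: linorder_cases)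
     (auto simp: ext_contract_def ext_sign_insert insert_commute)

lemma sum_triangle_delta:
  fixes g :: "nat \<Rightarrow> nat \<Rightarrow> 'a::comm_monoid_add"
  assumes "j < n" "i < j"
  shows "(\<Sum>b<n. \<Sum>a<b. if b = j \<and> a = i then g a b else 0) = g i j"
proof -
  have "(\<Sum>b<n. \<Sum>a<b. if b = j \<and> a = i then g a b else 0) = (\<Sum>b<n. if b = j then g i j else 0)"
    using assms by (intro sum.cong refl) auto
  then show ?thesis
    using assms by simp
qed

lemma spinor_act_mult:
  assumes "i < n" "j < n"
  shows "spinor_act n (mat_unit n i (j + n) - mat_unit n j (i + n)) f =
     (if i = j then 0 else ext_mult i (ext_mult j f))"
proof -
  have less: "spinor_act n (mat_unit n i (j + n) - mat_unit n j (i + n)) f =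
      ext_mult i (ext_mult j f)" (is "spinor_act n ?X f = _") if "i < j" "j < n" for i j
  proof -
    have X: "?X $$ (a, b) = 0" "?X $$ (a + n, b) = 0"
      "a < b \<Longrightarrow> ?X $$ (a, b + n) = (if b = j \<and> a = i then 1 else 0)" if "a < n" "b < n" for a b
      using that \<open>i < j\<close> \<open>j < n\<close> by (auto simp: mat_unit_def)
    have "(\<Sum>b<n. \<Sum>a<b. cscale (?X $$ (a, b + n)) (ext_mult a (ext_mult b f))) =
        (\<Sum>b<n. \<Sum>a<b. if b = j \<and> a = i then ext_mult a (ext_mult b f) else 0)"
      by (intro sum.cong refl) (simp add: X)
    then show ?thesis
      unfolding spinor_act_def using that by (simp add: X sum_triangle_delta)
  qed
  show ?thesis
  proof (cases i j rule: linorder_cases)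
    case equal
    have "(mat_unit n i (j + n) - mat_unit n j (i + n)) $$ (a, b) = 0" if "a < 2 * n" "b < 2 * n" for a b
      using that equal by (simp add: mat_unit_def)
    then show ?thesis
      using equal by (simp add: spinor_act_def)
  next
    case greater
    have "spinor_act n (mat_unit n i (j + n) - mat_unit n j (i + n)) f =
        - spinor_act n (mat_unit n j (i + n) - mat_unit n i (j + n)) f"
    proof -
      have "(mat_unit n i (j + n) - mat_unit n j (i + n)) $$ (a, b) =
          - (mat_unit n j (i + n) - mat_unit n i (j + n)) $$ (a, b)"
        if "a < 2 * n" "b < 2 * n" for a b
        using that by (simp add: mat_unit_def)
      then show ?thesis
        by (simp add: spinor_act_def sum_negf)
    qed
    then show ?thesis
      using less[of j i] greater assms ext_mult_anticomm[of i j f] by simp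
  qed (use less assms in simp)
qed

lemma spinor_act_contract:
  assumes "i < n" "j < n"
  shows "spinor_act n (mat_unit n (i + n) j - mat_unit n (j + n) i) f =
     (if i = j then 0 else ext_contract i (ext_contract j f))"
proof -
  have less: "spinor_act n (mat_unit n (i + n) j - mat_unit n (j + n) i) f =
      ext_contract i (ext_contract j f)" (is "spinor_act n ?X f = _") if "i < j" "j < n" for i j
  proof -
    have X: "?X $$ (a, b) = 0" "?X $$ (a, b + n) = 0"
      "a < b \<Longrightarrow> ?X $$ (a + n, b) = (if b = j \<and> a = i then 1 else 0)" if "a < n" "b < n" for a b
      using that \<open>i < j\<close> \<open>j < n\<close> by (auto simp: mat_unit_def)
    have "(\<Sum>b<n. \<Sum>a<b. cscale (?X $$ (a + n, b)) (ext_contract a (ext_contract b f))) =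
        (\<Sum>b<n. \<Sum>a<b. if b = j \<and> a = i then ext_contract a (ext_contract b f) else 0)"
      by (intro sum.cong refl) (simp add: X)
    then show ?thesis
      unfolding spinor_act_def using that by (simp add: X sum_triangle_delta)
  qed
  show ?thesis
  proof (cases i j rule: linorder_cases)
    case equal
    have "(mat_unit n (i + n) j - mat_unit n (j + n) i) $$ (a, b) = 0" if "a < 2 * n" "b < 2 * n" for a b
      using that equal by (simp add: mat_unit_def)
    then show ?thesis
      using equal by (simp add: spinor_act_def)
  next
    case greater
    have "spinor_act n (mat_unit n (i + n) j - mat_unit n (j + n) i) f =
        - spinor_act n (mat_unit n (j + n) i - mat_unit n (i + n) j) f"
    proof -
      have "(mat_unit n (i + n) j - mat_unit n (j + n) i) $$ (a, b) =
          - (mat_unit n (j + n) i - mat_unit n (i + n) j) $$ (a, b)"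
        if "a < 2 * n" "b < 2 * n" for a b
        using that by (simp add: mat_unit_def)
      then show ?thesis
        by (simp add: spinor_act_def sum_negf)
    qed
    then show ?thesis
      using less[of j i] greater assms ext_contract_anticomm[of i j f] by simp
  qed (use less assms in simp)
qed

lemma spinor_act_cartan:
  assumes "i < n"
  shows "spinor_act n (cartan_h n i) f = (\<lambda>I. (if i \<in> I then 1 / 2 else - 1 / 2) * f I)"
proof -
  have "ext_sign i I * (ext_sign i I * x) = x" for I x
    by (simp add: ext_sign_def flip: mult.assoc power_mult_distrib)
  then show ?thesis
    unfolding cartan_h_def spinor_act_gl[OF assms assms]
    by (auto simp: fun_eq_iff cscale_def ext_mult_def ext_contract_def ext_sign_remove
        ext_sign_insert insert_absorb)
qed

lemma weights_spinor_rep: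
  "weights n (spinor_rep n) =
     {\<mu>. (\<forall>i<n. \<mu> i = 1 / 2 \<or> \<mu> i = - 1 / 2) \<and> (\<forall>i\<ge>n. \<mu> i = 0)}" (is "?L = ?R")
proof
  show "?L \<subseteq> ?R"
  proof
    fix \<mu> assume "\<mu> \<in> ?L"
    then obtain v where z: "\<forall>i\<ge>n. \<mu> i = 0" and "v \<noteq> 0"
      and v: "\<And>i. i < n \<Longrightarrow> spinor_act n (cartan_h n i) v = cscale (complex_of_real (\<mu> i)) v"
      by (auto simp: weights_def weight_vector_def spinor_rep_def)
    then obtain I where I: "v I \<noteq> 0"
      by (auto simp: fun_eq_iff)
    have "\<mu> i = 1 / 2 \<or> \<mu> i = - 1 / 2" if "i < n" for i
    proof -
      have "(if i \<in> I then 1 / 2 else - 1 / 2) * v I = complex_of_real (\<mu> i) * v I"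
        using v[OF that] unfolding spinor_act_cartan[OF that] cscale_def by metis
      then have "(if i \<in> I then 1 / 2 else - 1 / 2) = complex_of_real (\<mu> i)"
        using I by (simp only: mult_right_cancel[OF I])
      then have "complex_of_real (\<mu> i) = complex_of_real (if i \<in> I then 1 / 2 else - 1 / 2)"
        by (cases "i \<in> I") (simp_all only: if_True if_False, simp_all)
      then have "\<mu> i = (if i \<in> I then 1 / 2 else - 1 / 2)"
        by (simp only: of_real_eq_iff)
      then show ?thesis
        by auto
    qed
    with z show "\<mu> \<in> ?R"
      by simp
  qed
  show "?R \<subseteq> ?L"
  proof
    fix \<mu> assume \<mu>: "\<mu> \<in> ?R"
    define J where "J = {i. i < n \<and> \<mu> i = 1 / 2}"
    define v :: "nat set \<Rightarrow> complex" where "v = (\<lambda>I. if I = J then 1 else 0)"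
    have "v \<in> ext_space n"
      by (auto simp: ext_space_def v_def J_def)
    moreover have "v J \<noteq> 0"
      by (simp add: v_def)
    then have "v \<noteq> 0"
      by auto
    moreover have "spinor_act n (cartan_h n i) v = cscale (complex_of_real (\<mu> i)) v" if "i < n" for i
    proof -
      have "\<mu> i = (if i \<in> J then 1 / 2 else - 1 / 2)"
        using \<mu> that by (auto simp: J_def)
      then have "complex_of_real (\<mu> i) = (if i \<in> J then 1 / 2 else - 1 / 2)"
        by simp
      then show ?thesis
        unfolding spinor_act_cartan[OF that] by (auto simp: cscale_def v_def)
    qed
    ultimately have "weight_vector n (spinor_rep n) \<mu> v"
      by (simp add: weight_vector_def spinor_rep_def)
    with \<mu> show "\<mu> \<in> ?L"
      by (auto simp: weights_def)
  qed
qed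

definition omega_plus :: "nat \<Rightarrow> nat \<Rightarrow> real" where
  "omega_plus n = (\<lambda>i. if i < n then 1 / 2 else 0)"

definition omega_minus :: "nat \<Rightarrow> nat \<Rightarrow> real" where
  "omega_minus n = (\<lambda>i. if i < n - 1 then 1 / 2 else if i = n - 1 then - 1 / 2 else 0)"

definition spinor_paths :: "nat \<Rightarrow> nat \<Rightarrow> (nat \<Rightarrow> real) list set" where
  "spinor_paths n N = {\<mu>s.
     length \<mu>s = N \<and> set \<mu>s \<subseteq> weights n (spinor_rep n) \<and>
     \<mu>s ! 0 \<in> {omega_plus n, omega_minus n} \<and>
     (\<forall>k\<in>{1..N}. (\<Sum>i<k. \<mu>s ! i) \<in> dominant_weights n)}"

end

theory Submission
  imports Defs "HOL-Library.Poly_Mapping"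
begin

text \<open>
  The standard Hermitian form makes the tensor power \<open>V\<close> of the spinor representation unitary, so
  \<open>V\<close> is an orthogonal direct sum of irreducible representations, each generated by a highest
  weight vector. For an irreducible summand \<open>L\<close> of highest weight \<open>\<nu>\<close>, the Casimir operator is a
  scalar; taking its trace on the weight spaces of \<open>L\<close> shows that the coefficients of
  \<open>D \<cdot> ch L\<close>, where \<open>D\<close> is the Weyl denominator, are supported on the weights \<open>\<kappa>\<close> with
  \<open>|\<kappa>| = |\<nu> + \<rho>|\<close>. Hence \<open>\<nu> + \<rho>\<close> is the only strictly dominant exponent, it has
  coefficient 1, and the multiplicity of \<open>L_\<nu>\<close> in \<open>V\<close> is the coefficient of \<open>e^(\<nu> + \<rho>)\<close> in
  \<open>D \<cdot> ch V\<close>. Since \<open>ch V\<close> is the \<open>N\<close>-th power of the spinor character and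
  \<open>D\<close> is antisymmetric under the Weyl group, this coefficient is computed recursively in \<open>N\<close>:
  a step by a spinor weight leads out of the dominant chamber only into a wall of the shifted
  chamber, where the coefficients vanish. So it counts the paths.
\<close>

section \<open>The Weyl denominator\<close>

text \<open>Weyl's character formula is bypassed. The coefficient of \<open>weyl_denom n * p\<close>
  at \<open>\<kappa> + rho n\<close> is an alternating sum of coefficients of \<open>p\<close> over
  sets of positive roots. For the weight multiplicities of an irreducible summand this sum can be
  handled term by term, because the trace of f_\<alpha> e_\<alpha> changes between \<kappa> and
  \<kappa> + \<alpha> by a known multiple of the multiplicity at \<kappa> + \<alpha>. What is left
  is a fact about the denominator alone: all its exponents have the norm of \<open>rho n\<close>.
  Multiplicities enter as traces of orthogonal projections over coordinate vectors of one weight, so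
  no basis of a summand is ever chosen. Walls are met because a spinor weight pairs with a simple
  root to -1, 0 or 1: a dominance inequality that breaks in one step breaks by exactly 1, and the
  shift by \<open>rho n\<close> turns this into an equality. The modules L_\<nu> are not constructed
  separately: each one in the statement is found inside the tensor power and copied to
  \<open>nat \<Rightarrow> complex\<close>.\<close>

definition root_pairs :: "nat \<Rightarrow> (nat \<times> nat) set" where
  "root_pairs n = {(i, j). i < j \<and> j < n}"

definition root_of :: "(nat \<times> nat) \<times> bool \<Rightarrow> nat \<Rightarrow> real" where
  "root_of \<alpha> = (case \<alpha> of ((i, j), s) \<Rightarrow>
     if s then unit_weight i + unit_weight j else unit_weight i - unit_weight j)"

text \<open>Roots are addressed by labels, so that sets of roots are sets of labels and the root
  vectors \<open>raise\<close> and \<open>lower\<close> can read their matrix indices off the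
  label.\<close>

definition pos_index :: "nat \<Rightarrow> ((nat \<times> nat) \<times> bool) set" where
  "pos_index n = root_pairs n \<times> UNIV"

text \<open>Half the sum of the positive roots: for each i < j the two roots belonging to the pair
  have half sum \<open>unit_weight i\<close>.\<close>

definition rho :: "nat \<Rightarrow> nat \<Rightarrow> real" where
  "rho n = (\<Sum>(i, j)\<in>root_pairs n. unit_weight i)"

definition wt_inner :: "nat \<Rightarrow> (nat \<Rightarrow> real) \<Rightarrow> (nat \<Rightarrow> real) \<Rightarrow> real" where
  "wt_inner n \<kappa> \<nu> = (\<Sum>i<n. \<kappa> i * \<nu> i)"

text \<open>The group algebra of the weights, in which formal characters live. Real exponents
  accommodate half-integral weights.\<close>

type_synonym group_ring = "(nat \<Rightarrow> real) \<Rightarrow>\<^sub>0 complex"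

definition xexp :: "(nat \<Rightarrow> real) \<Rightarrow> group_ring" where
  "xexp \<kappa> = Poly_Mapping.single \<kappa> 1"

definition xcosh :: "nat \<Rightarrow> group_ring" where
  "xcosh i = xexp (unit_weight i) + xexp (- unit_weight i)"

text \<open>With x_i = \<open>xexp (unit_weight i)\<close>, the factor for i < j is x_i + 1/x_i -
  x_j - 1/x_j = x_i (1 - 1/(x_i x_j)) (1 - x_j/x_i), so the product is the usual Weyl denominator.
  In this form its behaviour under permutations and sign changes of the coordinates can be read
  off.\<close>

definition weyl_denom :: "nat \<Rightarrow> group_ring" where
  "weyl_denom n = (\<Prod>(i, j)\<in>root_pairs n. xcosh i - xcosh j)"

lemma finite_root_pairs [simp]: "finite (root_pairs n)"
  by (rule finite_subset[of _ "{..<n} \<times> {..<n}"]) (auto simp: root_pairs_def)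

lemma finite_pos_index [simp]: "finite (pos_index n)"
  by (simp add: pos_index_def)

lemma sum_fun_apply: "(\<Sum>a\<in>A. f a) x = (\<Sum>a\<in>A. f a x)"
  by (induction A rule: infinite_finite_induct) auto

lemma rho_apply: "rho n i = (if i < n then real (n - 1 - i) else 0)"
proof -
  have "rho n i = (\<Sum>p\<in>root_pairs n. if fst p = i then 1 else 0)"
    unfolding rho_def sum_fun_apply by (intro sum.cong) (auto simp: unit_weight_def)
  also have "\<dots> = real (card {p \<in> root_pairs n. fst p = i})"
    by (simp flip: sum.inter_filter)
  also have "{p \<in> root_pairs n. fst p = i} = Pair i ` {i<..<n}"
    by (auto simp: root_pairs_def)
  also have "real (card (Pair i ` {i<..<n})) = (if i < n then real (n - 1 - i) else 0)"
    by (subst card_image) (auto simp: inj_on_def)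
  finally show ?thesis .
qed

lemma root_of_zero:
  assumes "\<alpha> \<in> pos_index n" "i \<ge> n" shows "root_of \<alpha> i = 0"
  using assms by (auto simp: pos_index_def root_pairs_def root_of_def unit_weight_def)

lemma root_of_in_positive_roots:
  assumes "\<alpha> \<in> pos_index n" shows "root_of \<alpha> \<in> positive_roots n"
proof -
  obtain i j s where \<alpha>: "\<alpha> = ((i, j), s)" "i < j" "j < n"
    using assms by (auto simp: pos_index_def root_pairs_def)
  then show ?thesis
    unfolding positive_roots_def by (cases s) (auto simp: root_of_def simp del: plus_fun_apply)
qed

lemma positive_roots_cases:
  assumes "\<beta> \<in> positive_roots n"
  obtains \<alpha> where "\<alpha> \<in> pos_index n" "\<beta> = root_of \<alpha>"
proof -
  from assms consider i j where "i < j" "j < n" "\<beta> = unit_weight i + unit_weight j"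
    | i j where "i < j" "j < n" "\<beta> = unit_weight i - unit_weight j"
    unfolding positive_roots_def by blast
  then show ?thesis
  proof cases
    case (1 i j)
    then show ?thesis using that[of "((i, j), True)"]
      by (auto simp: pos_index_def root_pairs_def root_of_def)
  next
    case (2 i j)
    then show ?thesis using that[of "((i, j), False)"]
      by (auto simp: pos_index_def root_pairs_def root_of_def)
  qed
qed

lemma wt_inner_add_left: "wt_inner n (a + b) c = wt_inner n a c + wt_inner n b c"
  by (simp add: wt_inner_def algebra_simps sum.distrib)

lemma wt_inner_add_right: "wt_inner n c (a + b) = wt_inner n c a + wt_inner n c b"
  by (simp add: wt_inner_def algebra_simps sum.distrib)

lemma wt_inner_diff_left: "wt_inner n (a - b) c = wt_inner n a c - wt_inner n b c"
  by (simp add: wt_inner_def algebra_simps sum_subtractf)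

lemma wt_inner_diff_right: "wt_inner n c (a - b) = wt_inner n c a - wt_inner n c b"
  by (simp add: wt_inner_def algebra_simps sum_subtractf)

lemma wt_inner_commute: "wt_inner n a b = wt_inner n b a"
  by (simp add: wt_inner_def mult.commute)

lemma wt_inner_sum_right: "wt_inner n c (\<Sum>x\<in>A. f x) = (\<Sum>x\<in>A. wt_inner n c (f x))"
  unfolding wt_inner_def sum_fun_apply sum_distrib_left by (rule sum.swap)

lemma wt_inner_root:
  assumes "i < j" "j < n"
  shows "wt_inner n \<kappa> (root_of ((i, j), s)) = (if s then \<kappa> i + \<kappa> j else \<kappa> i - \<kappa> j)"
proof -
  have *: "(\<Sum>k<n. \<kappa> k * (if k = l then 1 else 0)) = \<kappa> l" if "l < n" for l
    using that by (simp add: sum.delta if_distrib[of "\<lambda>x. _ * x"] cong: if_cong)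
  show ?thesis
    using assms by (simp add: wt_inner_def root_of_def unit_weight_def algebra_simps sum.distrib
        sum_subtractf *)
qed

text \<open>The pairing with \<open>rho\<close> is the height of a root. Being a positive integer,
  it serves as the grading in all triangularity arguments below.\<close>

lemma wt_inner_rho_root_pos:
  assumes "\<alpha> \<in> pos_index n"
  shows "\<exists>k>0. wt_inner n (rho n) (root_of \<alpha>) = real k"
proof -
  obtain i j s where \<alpha>: "\<alpha> = ((i, j), s)" "i < j" "j < n"
    using assms by (auto simp: pos_index_def root_pairs_def)
  have "wt_inner n (rho n) (root_of \<alpha>) = real (if s then (n - 1 - i) + (n - 1 - j) else j - i)"
    using \<alpha> by (auto simp: wt_inner_root rho_apply of_nat_diff)
  then show ?thesis
    using \<alpha> by (intro exI[of _ "if s then (n - 1 - i) + (n - 1 - j) else j - i"]) auto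
qed

lemma xexp_zero: "xexp 0 = 1"
  by (simp add: xexp_def)

lemma xexp_add: "xexp (a + b) = xexp a * xexp b"
  by (simp add: xexp_def mult_single)

lemma xexp_sum: "xexp (\<Sum>x\<in>A. f x) = (\<Prod>x\<in>A. xexp (f x))"
  by (induction A rule: infinite_finite_induct)
     (simp_all only: sum.infinite prod.infinite sum.empty prod.empty sum.insert prod.insert
        xexp_zero xexp_add not_False_eq_True)

text \<open>Exponents form a group, so multiplying by a monomial translates the
  coefficients.\<close>

lemma lookup_mult_single:
  "Poly_Mapping.lookup (p * Poly_Mapping.single \<mu> c) \<kappa> = Poly_Mapping.lookup p (\<kappa> - \<mu>) * c"
  for p :: group_ring
proof -
  have "Poly_Mapping.lookup (p * Poly_Mapping.single \<mu> c) \<kappa> =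
      (\<Sum>l. Poly_Mapping.lookup p l * (\<Sum>q. (c when \<mu> = q) when \<kappa> = l + q))"
    by (simp add: lookup_mult lookup_single)
  also have "(\<lambda>l. \<Sum>q. (c when \<mu> = q) when \<kappa> = l + q) = (\<lambda>l. c when l = \<kappa> - \<mu>)"
  proof
    fix l
    have "(\<lambda>q. (c when \<mu> = q) when \<kappa> = l + q) = (\<lambda>q. (c when \<kappa> = l + \<mu>) when q = \<mu>)"
      by (auto simp: when_def fun_eq_iff)
    moreover have "\<kappa> = l + \<mu> \<longleftrightarrow> l = \<kappa> - \<mu>"
      by (auto simp: algebra_simps)
    ultimately have "(\<lambda>q. (c when \<mu> = q) when \<kappa> = l + q) = (\<lambda>q. (c when l = \<kappa> - \<mu>) when q = \<mu>)"
      by simp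
    then show "(\<Sum>q. (c when \<mu> = q) when \<kappa> = l + q) = (c when l = \<kappa> - \<mu>)"
      by (simp only: Sum_any_when_equal)
  qed
  also have "(\<Sum>l. Poly_Mapping.lookup p l * (c when l = \<kappa> - \<mu>)) = Poly_Mapping.lookup p (\<kappa> - \<mu>) * c"
    by (simp only: mult_when Sum_any_when_equal)
  finally show ?thesis .
qed

section \<open>Automorphisms of the group ring and symmetries of the denominator\<close>

lemma poly_mapping_sum_single:
  "p = (\<Sum>k\<in>Poly_Mapping.keys p. Poly_Mapping.single k (Poly_Mapping.lookup p k))"
  by (rule poly_mapping_eqI) (auto simp: lookup_sum lookup_single when_def in_keys_iff)

lemma map_key_uminus: "inj f \<Longrightarrow> Poly_Mapping.map_key f (- p) = - Poly_Mapping.map_key f p"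
  for p :: "'a \<Rightarrow>\<^sub>0 'b::ab_group_add"
  by (rule poly_mapping_eqI) (simp add: map_key.rep_eq)

lemma map_key_sum:
  "inj f \<Longrightarrow> Poly_Mapping.map_key f (\<Sum>x\<in>A. g x) = (\<Sum>x\<in>A. Poly_Mapping.map_key f (g x))"
  by (induction A rule: infinite_finite_induct) (auto simp: map_key_plus)

text \<open>\<open>Poly_Mapping.map_key r\<close> composes the coefficient function with r. For an
  additive involution this is a ring automorphism that sends the monomial of k to the monomial of
  \<open>r k\<close>. Coordinate swaps and sign changes are both instances.\<close>

locale key_involution =
  fixes r :: "(nat \<Rightarrow> real) \<Rightarrow> nat \<Rightarrow> real"
  assumes add: "r (a + b) = r a + r b" and invol: "r (r a) = a"
begin

lemma inj: "inj r"
  by (metis injI invol)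

abbreviation mk :: "group_ring \<Rightarrow> group_ring" where "mk \<equiv> Poly_Mapping.map_key r"

lemma mk_single: "mk (Poly_Mapping.single k c) = Poly_Mapping.single (r k) c"
  using map_key_single[OF inj, of "r k" c] by (simp add: invol)

lemma mk_mult_single:
  "mk (p * Poly_Mapping.single k c) = mk p * Poly_Mapping.single (r k) c"
proof (rule poly_mapping_eqI)
  fix l
  have "r (l - r k) = r l - k"
    using add[of "l - r k" "r k"] by (simp add: invol)
  then show "Poly_Mapping.lookup (mk (p * Poly_Mapping.single k c)) l =
      Poly_Mapping.lookup (mk p * Poly_Mapping.single (r k) c) l"
    by (simp add: map_key.rep_eq[OF inj] lookup_mult_single)
qed

lemma mk_mult: "mk (p * q) = mk p * mk q"
proof -
  \<comment> \<open>By additivity it is enough to treat monomials in the second factor.\<close>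
  let ?q = "\<Sum>k\<in>Poly_Mapping.keys q. Poly_Mapping.single k (Poly_Mapping.lookup q k)"
  have "mk (p * ?q) = mk p * mk ?q"
    by (simp add: sum_distrib_left map_key_sum[OF inj] mk_mult_single mk_single)
  then show ?thesis
    unfolding poly_mapping_sum_single[of q, symmetric] .
qed

lemma mk_one: "mk 1 = 1"
  using mk_single[of 0 1] add[of 0 0] by simp

lemma mk_prod: "mk (\<Prod>x\<in>A. g x) = (\<Prod>x\<in>A. mk (g x))"
  by (induction A rule: infinite_finite_induct) (auto simp: mk_one mk_mult)

lemma mk_power: "mk (p ^ k) = mk p ^ k"
  by (induction k) (auto simp: mk_one mk_mult)

lemma mk_diff: "mk (p - q) = mk p - mk q"
  using map_key_plus[OF inj, of p "- q"] by (simp add: map_key_uminus[OF inj])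

lemma mk_xexp: "mk (xexp k) = xexp (r k)"
  by (simp add: xexp_def mk_single)

lemma lookup_mk: "Poly_Mapping.lookup (mk p) k = Poly_Mapping.lookup p (r k)"
  by (simp add: map_key.rep_eq[OF inj])

end

definition wt_swap :: "nat \<Rightarrow> (nat \<Rightarrow> real) \<Rightarrow> nat \<Rightarrow> real" where
  "wt_swap p \<kappa> = (\<lambda>i. \<kappa> (if i = p then Suc p else if i = Suc p then p else i))"

text \<open>A single sign change lies outside the Weyl group of type D, which changes signs in
  pairs. The denominator and the spin character are nevertheless invariant under it.\<close>

definition wt_flip :: "nat \<Rightarrow> (nat \<Rightarrow> real) \<Rightarrow> nat \<Rightarrow> real" where
  "wt_flip p \<kappa> = (\<lambda>i. if i = p then - \<kappa> i else \<kappa> i)"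

interpretation swap: key_involution "wt_swap p"
  by unfold_locales (auto simp: wt_swap_def fun_eq_iff)

interpretation flip: key_involution "wt_flip p"
  by unfold_locales (auto simp: wt_flip_def fun_eq_iff)

lemma swap_xcosh:
  "swap.mk p (xcosh i) = xcosh (if i = p then Suc p else if i = Suc p then p else i)"
proof -
  have "wt_swap p (unit_weight i) = unit_weight (if i = p then Suc p else if i = Suc p then p else i)"
    by (auto simp: wt_swap_def unit_weight_def fun_eq_iff)
  moreover have "wt_swap p (- unit_weight i) = - wt_swap p (unit_weight i)"
    by (auto simp: wt_swap_def fun_eq_iff)
  ultimately show ?thesis
    by (simp only: xcosh_def map_key_plus[OF swap.inj] swap.mk_xexp)
qed

lemma flip_xcosh: "flip.mk p (xcosh i) = xcosh i"
proof -
  have "wt_flip p (unit_weight i) = (if i = p then - unit_weight i else unit_weight i)"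
       "wt_flip p (- unit_weight i) = (if i = p then unit_weight i else - unit_weight i)"
    by (auto simp: wt_flip_def unit_weight_def fun_eq_iff)
  then show ?thesis
    by (auto simp: xcosh_def map_key_plus[OF flip.inj] flip.mk_xexp)
qed

text \<open>Exchanging p and p + 1 permutes the factors of all other pairs among themselves and
  negates the factor of the pair (p, p + 1).\<close>

lemma swap_weyl_denom:
  assumes "Suc p < n"
  shows "swap.mk p (weyl_denom n) = - weyl_denom n"
proof -
  define t where "t i = (if i = p then Suc p else if i = Suc p then p else i)" for i
  let ?A = "root_pairs n - {(p, Suc p)}"
  have mem: "(p, Suc p) \<in> root_pairs n"
    using assms by (simp add: root_pairs_def)
  have "(\<Prod>(i, j)\<in>?A. xcosh (t i) - xcosh (t j)) = (\<Prod>(i, j)\<in>?A. xcosh i - xcosh j)"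
    using assms
    by (intro prod.reindex_bij_witness[where i = "\<lambda>(i, j). (t i, t j)" and j = "\<lambda>(i, j). (t i, t j)"])
       (auto simp: t_def root_pairs_def split: if_splits)
  then have "(\<Prod>(i, j)\<in>root_pairs n. xcosh (t i) - xcosh (t j)) = - weyl_denom n"
    unfolding weyl_denom_def prod.remove[OF finite_root_pairs mem]
    by (simp add: t_def flip: mult_minus_left)
  moreover have "swap.mk p (weyl_denom n) = (\<Prod>(i, j)\<in>root_pairs n. xcosh (t i) - xcosh (t j))"
    unfolding weyl_denom_def swap.mk_prod
    by (intro prod.cong) (auto simp: swap.mk_diff swap_xcosh t_def)
  ultimately show ?thesis by simp
qed

lemma flip_weyl_denom: "flip.mk p (weyl_denom n) = weyl_denom n"
  unfolding weyl_denom_def flip.mk_prod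
  by (intro prod.cong) (auto simp: flip.mk_diff flip_xcosh)

text \<open>Adjacent swaps move the two equal entries next to each other and only change the sign of
  the coefficient. Once they are adjacent, one more swap fixes the exponent while negating the
  coefficient.\<close>

lemma weyl_denom_eq_0_of_repeat:
  assumes "p < q" "q < n" "\<kappa> p = \<kappa> q"
  shows "Poly_Mapping.lookup (weyl_denom n) \<kappa> = 0"
  using assms
proof (induction q arbitrary: \<kappa>)
  case (Suc q)
  have swap: "Poly_Mapping.lookup (weyl_denom n) (wt_swap q \<kappa>) = - Poly_Mapping.lookup (weyl_denom n) \<kappa>"
    using arg_cong[OF swap_weyl_denom, of q n "\<lambda>D. Poly_Mapping.lookup D \<kappa>"] Suc.prems
    by (simp add: swap.lookup_mk)
  show ?case
  proof (cases "p = q")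
    case True
    then have "wt_swap q \<kappa> = \<kappa>"
      using Suc.prems by (auto simp: wt_swap_def fun_eq_iff)
    then show ?thesis using swap by simp
  next
    case False
    then have "Poly_Mapping.lookup (weyl_denom n) (wt_swap q \<kappa>) = 0"
      using Suc.prems by (intro Suc.IH) (auto simp: wt_swap_def)
    then show ?thesis using swap by simp
  qed
qed simp

lemma weyl_denom_eq_0_of_abs_repeat:
  assumes "p < q" "q < n" "\<bar>\<kappa> p\<bar> = \<bar>\<kappa> q\<bar>"
  shows "Poly_Mapping.lookup (weyl_denom n) \<kappa> = 0"
proof (cases "\<kappa> p = \<kappa> q")
  case False
  then have "\<kappa> p = - \<kappa> q" using assms by linarith
  then have "Poly_Mapping.lookup (weyl_denom n) (wt_flip p \<kappa>) = 0"
    using assms by (intro weyl_denom_eq_0_of_repeat[of p q]) (auto simp: wt_flip_def)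
  then show ?thesis
    using flip_weyl_denom[of p n] flip.lookup_mk[of p "weyl_denom n" \<kappa>] by simp
qed (use assms weyl_denom_eq_0_of_repeat in blast)

text \<open>Coordinate i is touched only by the n - 1 factors whose pair contains i, and each of
  them changes it by -1, 0 or 1.\<close>

lemma weyl_denom_key_bound:
  assumes "\<kappa> \<in> Poly_Mapping.keys (weyl_denom n)" "i < n"
  shows "\<kappa> i \<in> \<int> \<and> \<bar>\<kappa> i\<bar> \<le> real (n - 1)"
proof -
  have keys: "\<kappa> i \<in> \<int> \<and> \<bar>\<kappa> i\<bar> \<le> real (card {p \<in> A. i = fst p \<or> i = snd p})"
    if "finite A" "\<kappa> \<in> Poly_Mapping.keys (\<Prod>(a, b)\<in>A. xcosh a - xcosh b)" "\<forall>(a, b)\<in>A. a \<noteq> b"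
    for A \<kappa>
    using that
  proof (induction A arbitrary: \<kappa> rule: finite_induct)
    case (insert p A)
    obtain a b where p: "p = (a, b)" "a \<noteq> b" using insert.prems by (cases p) auto
    let ?P = "\<Prod>(a, b)\<in>A. xcosh a - xcosh b"
    have "\<kappa> \<in> Poly_Mapping.keys ((xcosh a - xcosh b) * ?P)"
      using insert p by simp
    then obtain \<mu> \<nu> where k: "\<kappa> = \<mu> + \<nu>" "\<mu> \<in> Poly_Mapping.keys (xcosh a - xcosh b)" "\<nu> \<in> Poly_Mapping.keys ?P"
      using keys_mult by blast
    have "Poly_Mapping.keys (xcosh a - xcosh b) \<subseteq>
        {unit_weight a, - unit_weight a, unit_weight b, - unit_weight b}"
      unfolding xcosh_def xexp_def
      by (intro order.trans[OF keys_diff] Un_least order.trans[OF keys_add]) auto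
    then have "\<mu> i \<in> \<int> \<and> \<bar>\<mu> i\<bar> \<le> (if i = a \<or> i = b then 1 else 0)"
      using k(2) by (auto simp: unit_weight_def)
    moreover have "\<nu> i \<in> \<int> \<and> \<bar>\<nu> i\<bar> \<le> real (card {p \<in> A. i = fst p \<or> i = snd p})"
      using insert k by auto
    moreover have "{q \<in> insert p A. i = fst q \<or> i = snd q} =
       (if i = a \<or> i = b then insert p {p \<in> A. i = fst p \<or> i = snd p} else {p \<in> A. i = fst p \<or> i = snd p})"
      using p by auto
    ultimately show ?case
      using insert.hyps k by auto
  qed simp
  \<comment> \<open>A pair containing i is determined by its other member.\<close>
  have "{p \<in> root_pairs n. i = fst p \<or> i = snd p} \<subseteq> (\<lambda>k. (min i k, max i k)) ` ({..<n} - {i})"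
  proof
    fix p assume p: "p \<in> {p \<in> root_pairs n. i = fst p \<or> i = snd p}"
    then have "p = (\<lambda>k. (min i k, max i k)) (if i = fst p then snd p else fst p)"
      by (auto simp: root_pairs_def)
    moreover have "(if i = fst p then snd p else fst p) \<in> {..<n} - {i}"
      using p by (auto simp: root_pairs_def)
    ultimately show "p \<in> (\<lambda>k. (min i k, max i k)) ` ({..<n} - {i})"
      by (rule image_eqI)
  qed
  then have "card {p \<in> root_pairs n. i = fst p \<or> i = snd p} \<le> card ({..<n} - {i})"
    by (rule surj_card_le[rotated]) simp
  also have "\<dots> = n - 1"
    using assms by simp
  finally have "real (card {p \<in> root_pairs n. i = fst p \<or> i = snd p}) \<le> real (n - 1)"
    by simp
  moreover have "\<forall>(a, b)\<in>root_pairs n. a \<noteq> b"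
    by (auto simp: root_pairs_def)
  ultimately show ?thesis
    using keys[of "root_pairs n" \<kappa>] assms unfolding weyl_denom_def by fastforce
qed

text \<open>The absolute values of the coordinates are integers in {0, ..., n - 1}, and pairwise
  distinct because a repetition kills the coefficient. So they are a rearrangement of the
  coordinates of \<open>rho n\<close>.\<close>

lemma weyl_denom_key_norm:
  assumes "Poly_Mapping.lookup (weyl_denom n) \<kappa> \<noteq> 0"
  shows "wt_inner n \<kappa> \<kappa> = wt_inner n (rho n) (rho n)"
proof -
  define f where "f i = nat \<lfloor>\<bar>\<kappa> i\<bar>\<rfloor>" for i
  have f: "real (f i) = \<bar>\<kappa> i\<bar>" "f i < n" if "i < n" for i
  proof -
    have *: "\<kappa> i \<in> \<int>" "\<bar>\<kappa> i\<bar> \<le> real (n - 1)"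
      using weyl_denom_key_bound[of \<kappa> n i] assms that by (auto simp: in_keys_iff)
    then show "real (f i) = \<bar>\<kappa> i\<bar>"
      by (auto simp: f_def elim!: Ints_cases)
    with * show "f i < n" using that by linarith
  qed
  have inj: "inj_on f {..<n}"
  proof (rule linorder_inj_onI)
    fix p q assume pq: "p < q" "p \<in> {..<n}" "q \<in> {..<n}"
    show "f p \<noteq> f q"
      using weyl_denom_eq_0_of_abs_repeat[of p q n \<kappa>] pq assms f(1)[of p] f(1)[of q] by auto
  qed auto
  have img: "f ` {..<n} = {..<n}"
    using f(2) inj by (intro endo_inj_surj) auto
  have "wt_inner n \<kappa> \<kappa> = (\<Sum>i<n. (real (f i))\<^sup>2)"
    unfolding wt_inner_def using f(1) by (intro sum.cong) (auto simp: power2_eq_square)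
  also have "\<dots> = (\<Sum>k\<in>f ` {..<n}. (real k)\<^sup>2)"
    using inj by (simp add: sum.reindex)
  also have "\<dots> = (\<Sum>k<n. (real k)\<^sup>2)" unfolding img ..
  also have "\<dots> = (\<Sum>i<n. (real (n - Suc i))\<^sup>2)"
    by (rule sum.nat_diff_reindex[symmetric])
  also have "\<dots> = wt_inner n (rho n) (rho n)"
    unfolding wt_inner_def by (intro sum.cong) (auto simp: power2_eq_square rho_apply)
  finally show ?thesis .
qed

section \<open>Expansion of the denominator over sets of positive roots\<close>

definition root_sum :: "((nat \<times> nat) \<times> bool) set \<Rightarrow> nat \<Rightarrow> real" where
  "root_sum S = (\<Sum>\<alpha>\<in>S. root_of \<alpha>)"

lemma weyl_denom_expand:
  "weyl_denom n = (\<Sum>S\<in>Pow (pos_index n). Poly_Mapping.single (rho n - root_sum S) ((-1) ^ card S))"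
proof -
  have fac: "xcosh i - xcosh j =
      xexp (unit_weight i) * (\<Prod>s\<in>UNIV. 1 - xexp (- root_of ((i, j), s)))" for i j
    by (simp add: UNIV_bool xcosh_def root_of_def algebra_simps xexp_zero flip: xexp_add)
  have "weyl_denom n = xexp (rho n) * (\<Prod>p\<in>root_pairs n. \<Prod>s\<in>UNIV. 1 - xexp (- root_of (p, s)))"
    unfolding weyl_denom_def rho_def xexp_sum fac
    by (simp add: case_prod_beta' prod.distrib)
  also have "(\<Prod>p\<in>root_pairs n. \<Prod>s\<in>UNIV. 1 - xexp (- root_of (p, s))) =
      (\<Prod>\<alpha>\<in>pos_index n. - xexp (- root_of \<alpha>) + 1)"
    unfolding pos_index_def by (subst prod.cartesian_product) (simp add: case_prod_beta')
  also have "\<dots> = (\<Sum>S\<in>Pow (pos_index n). \<Prod>\<alpha>\<in>S. - xexp (- root_of \<alpha>))"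
    by (subst prod_add) auto
  also have "xexp (rho n) * \<dots> =
     (\<Sum>S\<in>Pow (pos_index n). Poly_Mapping.single (rho n - root_sum S) ((-1) ^ card S))"
    unfolding sum_distrib_left
  proof (intro sum.cong refl)
    fix S :: "((nat \<times> nat) \<times> bool) set"
    have "(\<Prod>\<alpha>\<in>S. - xexp (- root_of \<alpha>)) = (-1) ^ card S * xexp (\<Sum>\<alpha>\<in>S. - root_of \<alpha>)"
      by (simp add: xexp_sum prod_uminus)
    also have "(-1) ^ card S = (Poly_Mapping.single 0 ((-1) ^ card S) :: group_ring)"
      by (cases "even (card S)") (simp_all add: single_uminus)
    finally have prod: "(\<Prod>\<alpha>\<in>S. - xexp (- root_of \<alpha>)) =
        Poly_Mapping.single 0 ((-1) ^ card S) * xexp (- root_sum S)"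
      by (simp only: root_sum_def sum_negf)
    have "rho n + (0 + - root_sum S) = rho n - root_sum S" by simp
    then show "xexp (rho n) * (\<Prod>\<alpha>\<in>S. - xexp (- root_of \<alpha>)) =
        Poly_Mapping.single (rho n - root_sum S) ((-1) ^ card S)"
      unfolding prod by (simp only: xexp_def mult_single mult_1_left mult_1_right)
  qed
  finally show ?thesis .
qed

text \<open>The bridge between products in the group ring and alternating sums of multiplicities.
  Evaluating at a point shifted by \<open>rho n\<close> cancels the leading monomial of the
  denominator.\<close>

lemma lookup_weyl_denom_mult:
  "Poly_Mapping.lookup (weyl_denom n * p) (\<kappa> + rho n) =
     (\<Sum>S\<in>Pow (pos_index n). (-1) ^ card S * Poly_Mapping.lookup p (\<kappa> + root_sum S))"
  unfolding weyl_denom_expand sum_distrib_right lookup_sum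
proof (intro sum.cong refl)
  fix S :: "((nat \<times> nat) \<times> bool) set"
  have *: "\<kappa> + rho n - (rho n - root_sum S) = \<kappa> + root_sum S" by simp
  show "Poly_Mapping.lookup (Poly_Mapping.single (rho n - root_sum S) ((-1) ^ card S) * p) (\<kappa> + rho n) =
      (-1) ^ card S * Poly_Mapping.lookup p (\<kappa> + root_sum S)"
    by (subst mult.commute) (simp only: lookup_mult_single * mult.commute)
qed

text \<open>Grouping the sets S by the exponent \<open>rho n - root_sum S\<close> turns the sum into
  one over the coefficients of the denominator. Where such a coefficient is nonzero, the norm
  difference vanishes by \<open>weyl_denom_key_norm\<close>.\<close>

lemma weyl_denom_norm_sum:
  "(\<Sum>S\<in>Pow (pos_index n). (-1) ^ card S *
      of_real (wt_inner n (rho n) (rho n) -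
        wt_inner n (rho n - root_sum S) (rho n - root_sum S)) * g (root_sum S)) = (0 :: complex)"
proof -
  let ?P = "Pow (pos_index n)"
  let ?k = "\<lambda>S. rho n - root_sum S"
  let ?h = "\<lambda>\<kappa>. of_real (wt_inner n (rho n) (rho n) - wt_inner n \<kappa> \<kappa>) * g (rho n - \<kappa>)"
  have "(\<Sum>S\<in>?P. (-1) ^ card S * of_real (wt_inner n (rho n) (rho n) - wt_inner n (?k S) (?k S))
      * g (root_sum S)) = (\<Sum>S\<in>?P. (-1) ^ card S * ?h (?k S))"
    by (intro sum.cong) (auto simp: mult.assoc)
  also have "\<dots> = (\<Sum>\<kappa>\<in>?k ` ?P. \<Sum>S | S \<in> ?P \<and> ?k S = \<kappa>. (-1) ^ card S * ?h (?k S))"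
    by (intro sum.image_gen) simp
  also have "\<dots> = (\<Sum>\<kappa>\<in>?k ` ?P. Poly_Mapping.lookup (weyl_denom n) \<kappa> * ?h \<kappa>)"
  proof (intro sum.cong refl)
    fix \<kappa>
    have "(\<Sum>S | S \<in> ?P \<and> ?k S = \<kappa>. (-1) ^ card S * ?h (?k S)) =
        (\<Sum>S | S \<in> ?P \<and> ?k S = \<kappa>. (-1) ^ card S) * ?h \<kappa>"
      unfolding sum_distrib_right by (intro sum.cong) auto
    also have "(\<Sum>S | S \<in> ?P \<and> ?k S = \<kappa>. (-1) ^ card S) = Poly_Mapping.lookup (weyl_denom n) \<kappa>"
      unfolding weyl_denom_expand lookup_sum lookup_single when_def
      by (subst sum.inter_filter) auto
    finally show "(\<Sum>S | S \<in> ?P \<and> ?k S = \<kappa>. (-1) ^ card S * ?h (?k S)) =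
        Poly_Mapping.lookup (weyl_denom n) \<kappa> * ?h \<kappa>" .
  qed
  also have "\<dots> = 0"
    using weyl_denom_key_norm by (intro sum.neutral) force
  finally show ?thesis .
qed


section \<open>Counting paths\<close>

definition spin_wts :: "nat \<Rightarrow> (nat \<Rightarrow> real) set" where
  "spin_wts n = {\<mu>. (\<forall>i<n. \<mu> i = 1 / 2 \<or> \<mu> i = - 1 / 2) \<and> (\<forall>i\<ge>n. \<mu> i = 0)}"

text \<open>The weight of the basis vector e_I of the exterior algebra.\<close>

definition set_wt :: "nat \<Rightarrow> nat set \<Rightarrow> nat \<Rightarrow> real" where
  "set_wt n I = (\<lambda>i. if i < n then if i \<in> I then 1 / 2 else - 1 / 2 else 0)"

definition spin_char :: "nat \<Rightarrow> group_ring" where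
  "spin_char n = (\<Sum>\<mu>\<in>spin_wts n. xexp \<mu>)"

lemma bij_betw_set_wt: "bij_betw (set_wt n) (Pow {..<n}) (spin_wts n)"
  by (intro bij_betw_byWitness[where f' = "\<lambda>\<mu>. {i. i < n \<and> \<mu> i = 1 / 2}"])
     (auto simp: set_wt_def spin_wts_def fun_eq_iff split: if_splits)

lemma finite_spin_wts [simp]: "finite (spin_wts n)"
  using bij_betw_finite[OF bij_betw_set_wt, of n] by simp

lemma lookup_mult_spin_char:
  "Poly_Mapping.lookup (p * spin_char n) \<kappa> = (\<Sum>\<mu>\<in>spin_wts n. Poly_Mapping.lookup p (\<kappa> - \<mu>))"
  by (simp add: spin_char_def sum_distrib_left lookup_sum xexp_def lookup_mult_single)

lemma swap_spin_char:
  assumes "Suc p < n" shows "swap.mk p (spin_char n) = spin_char n"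
proof -
  have "wt_swap p \<mu> \<in> spin_wts n" if "\<mu> \<in> spin_wts n" for \<mu>
    using that assms by (auto simp: spin_wts_def wt_swap_def)
  then have "(\<Sum>\<mu>\<in>spin_wts n. xexp (wt_swap p \<mu>)) = (\<Sum>\<mu>\<in>spin_wts n. xexp \<mu>)"
    by (intro sum.reindex_bij_witness[where i = "wt_swap p" and j = "wt_swap p"])
       (auto simp: swap.invol)
  then show ?thesis
    by (simp add: spin_char_def map_key_sum[OF swap.inj] swap.mk_xexp)
qed

lemma flip_spin_char: "flip.mk p (spin_char n) = spin_char n"
proof -
  have "wt_flip p \<mu> \<in> spin_wts n" if "\<mu> \<in> spin_wts n" for \<mu>
    using that by (auto simp: spin_wts_def wt_flip_def)
  then have "(\<Sum>\<mu>\<in>spin_wts n. xexp (wt_flip p \<mu>)) = (\<Sum>\<mu>\<in>spin_wts n. xexp \<mu>)"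
    by (intro sum.reindex_bij_witness[where i = "wt_flip p" and j = "wt_flip p"])
       (auto simp: flip.invol)
  then show ?thesis
    by (simp add: spin_char_def map_key_sum[OF flip.inj] flip.mk_xexp)
qed

text \<open>If the two entries agree, swapping them fixes \<kappa> but negates the product, so the
  coefficient is zero. Opposite entries reduce to this case by the invariance under one sign
  change.\<close>

lemma weyl_denom_spin_char_wall:
  assumes "Suc p < n" "\<bar>\<kappa> p\<bar> = \<bar>\<kappa> (Suc p)\<bar>"
  shows "Poly_Mapping.lookup (weyl_denom n * spin_char n ^ N) \<kappa> = 0"
proof -
  let ?P = "weyl_denom n * spin_char n ^ N"
  have flip: "flip.mk p ?P = ?P"
    by (simp add: flip.mk_mult flip.mk_power flip_weyl_denom flip_spin_char)
  have zero: "Poly_Mapping.lookup ?P \<kappa> = 0" if "\<kappa> p = \<kappa> (Suc p)" for \<kappa>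
  proof -
    have "wt_swap p \<kappa> = \<kappa>"
      using that by (auto simp: wt_swap_def fun_eq_iff)
    moreover have "swap.mk p ?P = - ?P"
      using assms by (simp add: swap.mk_mult swap.mk_power swap_weyl_denom swap_spin_char)
    ultimately show ?thesis
      using swap.lookup_mk[of p ?P \<kappa>] by simp
  qed
  show ?thesis
  proof (cases "\<kappa> p = \<kappa> (Suc p)")
    case False
    then have "wt_flip p \<kappa> p = wt_flip p \<kappa> (Suc p)"
      using assms by (auto simp: wt_flip_def)
    then show ?thesis
      using zero[of "wt_flip p \<kappa>"] flip.lookup_mk[of p ?P \<kappa>] flip by simp
  qed (use zero in blast)
qed

lemma dominant_weightsD:
  assumes "\<nu> \<in> dominant_weights n" "n \<ge> 2" "i < j" "j < n"
  shows "\<nu> i \<ge> \<bar>\<nu> j\<bar>"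
proof -
  have mono: "\<nu> j \<le> \<nu> i" if "i \<le> j" "j \<le> n - 2" for i j
    using that
  proof (induction j rule: dec_induct)
    case (step k)
    have "k + 1 < n - 1 \<longrightarrow> \<nu> (k + 1) \<le> \<nu> k"
      using assms(1) unfolding dominant_weights_def by blast
    moreover have "k + 1 < n - 1"
      using step assms(2) by linarith
    ultimately show ?case
      using step by simp
  qed simp
  have last: "\<nu> (n - 2) \<ge> \<bar>\<nu> (n - 1)\<bar>"
    using assms(1) by (simp add: dominant_weights_def)
  show ?thesis
  proof (cases "j = n - 1")
    case True
    then have "i \<le> n - 2" using assms by linarith
    then show ?thesis using mono[of i "n - 2"] last True by auto
  next
    case False
    then have "i \<le> j" "j \<le> n - 2" using assms by linarith+
    then show ?thesis using mono[of i j] mono[of j "n - 2"] last by auto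
  qed
qed

lemma wt_inner_dominant_root_nonneg:
  assumes "\<nu> \<in> dominant_weights n" "n \<ge> 2" "\<alpha> \<in> pos_index n"
  shows "wt_inner n \<nu> (root_of \<alpha>) \<ge> 0"
proof -
  obtain i j s where \<alpha>: "\<alpha> = ((i, j), s)" "i < j" "j < n"
    using assms by (auto simp: pos_index_def root_pairs_def)
  then show ?thesis
    using dominant_weightsD[OF assms(1,2), of i j] by (auto simp: wt_inner_root)
qed

lemma wt_inner_rho_dominant_nonneg:
  assumes "\<nu> \<in> dominant_weights n" "n \<ge> 2"
  shows "wt_inner n (rho n) \<nu> \<ge> 0"
  unfolding wt_inner_def
proof (rule sum_nonneg)
  fix i assume i: "i \<in> {..<n}"
  show "rho n i * \<nu> i \<ge> 0"
  \<comment> \<open>The last entry of a dominant weight may be negative, but there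
    \<open>rho\<close> vanishes.\<close>
  proof (cases "i = n - 1")
    case False
    then have "\<nu> i \<ge> 0" using dominant_weightsD[OF assms, of i "n - 1"] i by fastforce
    then show ?thesis by (simp add: rho_apply)
  qed (simp add: rho_apply)
qed

lemma wt_inner_rho_root_sum:
  assumes "S \<subseteq> pos_index n"
  shows "wt_inner n (rho n) (root_sum S) \<ge> 0"
    and "wt_inner n (rho n) (root_sum S) = 0 \<Longrightarrow> S = {}"
proof -
  have fin: "finite S" using assms finite_subset finite_pos_index by blast
  have pos: "wt_inner n (rho n) (root_of \<alpha>) > 0" if "\<alpha> \<in> S" for \<alpha>
    using wt_inner_rho_root_pos[of \<alpha> n] assms that by fastforce
  show "wt_inner n (rho n) (root_sum S) \<ge> 0"
    unfolding root_sum_def wt_inner_sum_right using pos by (intro sum_nonneg) force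
  show "S = {}" if z: "wt_inner n (rho n) (root_sum S) = 0"
  proof (rule ccontr)
    assume "S \<noteq> {}"
    then have "(\<Sum>\<alpha>\<in>S. wt_inner n (rho n) (root_of \<alpha>)) > 0"
      using pos fin by (intro sum_pos) auto
    then show False using z by (simp add: root_sum_def wt_inner_sum_right)
  qed
qed

text \<open>A set S contributes only if \<open>\<nu> + root_sum S = 0\<close>. Pairing this equation
  with \<open>rho\<close> gives a sum of two nonnegative numbers, so the height of
  \<open>root_sum S\<close> is 0 and S is empty.\<close>

lemma lookup_weyl_denom_dominant:
  assumes "\<nu> \<in> dominant_weights n" "n \<ge> 2"
  shows "Poly_Mapping.lookup (weyl_denom n) (\<nu> + rho n) = (if \<nu> = 0 then 1 else 0)"
proof -
  have empty: "S = {}" if S: "S \<subseteq> pos_index n" "\<nu> + root_sum S = 0" for S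
  proof -
    have "wt_inner n (rho n) \<nu> + wt_inner n (rho n) (root_sum S) = wt_inner n (rho n) 0"
      using S(2) by (metis wt_inner_add_right)
    then have "wt_inner n (rho n) (root_sum S) = 0"
      using wt_inner_rho_dominant_nonneg[OF assms] wt_inner_rho_root_sum(1)[OF S(1)]
      by (simp add: wt_inner_def)
    then show ?thesis using wt_inner_rho_root_sum(2)[OF S(1)] by blast
  qed
  have "Poly_Mapping.lookup (weyl_denom n) (\<nu> + rho n) =
      (\<Sum>S\<in>Pow (pos_index n). (-1) ^ card S * Poly_Mapping.lookup 1 (\<nu> + root_sum S))"
    using lookup_weyl_denom_mult[of n 1 \<nu>] by simp
  also have "\<dots> = (\<Sum>S\<in>{{}}. (-1) ^ card S * Poly_Mapping.lookup 1 (\<nu> + root_sum S))"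
    using empty by (intro sum.mono_neutral_right) (auto simp: lookup_one when_def)
  also have "\<dots> = (if \<nu> = 0 then 1 else 0)"
    by (simp add: lookup_one root_sum_def)
  finally show ?thesis .
qed

text \<open>The minuscule property of the spinor weights. A dominant \<nu> pairs with a simple root
  to a nonnegative integer, a spinor weight to -1, 0 or 1. So a dominance inequality that fails for
  \<nu> - \<mu> fails by exactly 1, and since \<open>rho\<close> pairs to 1 with every simple root,
  the shift makes both sides equal up to sign.\<close>

lemma dominant_weights_diff_spin:
  assumes \<nu>: "\<nu> \<in> dominant_weights n" and \<mu>: "\<mu> \<in> spin_wts n" and n: "n \<ge> 2"
    and nd: "\<nu> - \<mu> \<notin> dominant_weights n"
  shows "\<exists>p. Suc p < n \<and> \<bar>(\<nu> - \<mu> + rho n) p\<bar> = \<bar>(\<nu> - \<mu> + rho n) (Suc p)\<bar>"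
proof -
  define \<kappa> where "\<kappa> = \<nu> - \<mu>"
  have \<mu>': "\<mu> i = 1 / 2 \<or> \<mu> i = - 1 / 2" if "i < n" for i
    using \<mu> that by (auto simp: spin_wts_def)
  \<comment> \<open>Subtracting a spinor weight exchanges integral and half-integral
    entries.\<close>
  have shift: "(\<nu> i - \<mu> i - 1 / 2 \<in> \<int> \<longleftrightarrow> \<nu> i \<in> \<int>) \<and> (\<nu> i - \<mu> i \<in> \<int> \<longleftrightarrow> \<nu> i - 1 / 2 \<in> \<int>)" if "i < n" for i
  proof -
    have "\<nu> i + 1 / 2 \<in> \<int> \<longleftrightarrow> \<nu> i - 1 / 2 \<in> \<int>"
      using Ints_add[of "\<nu> i - 1 / 2" 1] Ints_diff[of "\<nu> i + 1 / 2" 1] by (auto simp: algebra_simps)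
    moreover have "\<nu> i - 1 \<in> \<int> \<longleftrightarrow> \<nu> i \<in> \<int>"
      using Ints_add[of "\<nu> i - 1" 1] Ints_diff[of "\<nu> i" 1] by auto
    moreover have "\<nu> i - 1 / 2 - 1 / 2 = \<nu> i - 1" "\<nu> i - - 1 / 2 = \<nu> i + 1 / 2"
      "\<nu> i - - 1 / 2 - 1 / 2 = \<nu> i" by simp_all
    ultimately show ?thesis
      using \<mu>'[OF that] by (elim disjE) (simp_all only: simp_thms)
  qed
  have lattice: "(\<forall>i<n. \<kappa> i \<in> \<int>) \<or> (\<forall>i<n. \<kappa> i - 1 / 2 \<in> \<int>)"
    using \<nu> shift by (auto simp: dominant_weights_def \<kappa>_def)
  \<comment> \<open>The sign s treats the roots of both kinds, differences and sums of two unit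
    weights, at once.\<close>
  have dint: "\<exists>z::int. \<nu> i - s * \<nu> j = of_int z" if "i < n" "j < n" "s = 1 \<or> s = - 1" for i j s
  proof -
    have "\<nu> i - s * \<nu> j \<in> \<int>"
    proof (cases "\<forall>i<n. \<nu> i \<in> \<int>")
      case True
      then show ?thesis using that by auto
    next
      case False
      then have *: "\<nu> i - 1 / 2 \<in> \<int>" "\<nu> j - 1 / 2 \<in> \<int>"
        using \<nu> that by (auto simp: dominant_weights_def)
      show ?thesis
        using that(3) Ints_diff[OF *] Ints_add[OF Ints_add[OF *] Ints_1]
        by (auto simp: algebra_simps)
    qed
    then show ?thesis by (auto elim: Ints_cases)
  qed
  have key: "\<kappa> i - s * \<kappa> j = - 1" if "i < j" "j < n" "s = 1 \<or> s = - 1" "\<kappa> i < s * \<kappa> j" for i j s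
  proof -
    have "i < n" and s: "s = 1 \<or> s = - 1" using that by simp_all
    obtain z where z: "\<nu> i - s * \<nu> j = of_int z" using dint[OF \<open>i < n\<close> \<open>j < n\<close> s] by blast
    have "\<nu> i - s * \<nu> j \<ge> 0" using dominant_weightsD[OF \<nu> n, of i j] that by auto
    then have "z \<ge> 0" using z by simp
    moreover have "\<mu> i - s * \<mu> j \<in> {-1, 0, 1}" using \<mu>'[of i] \<mu>'[of j] that by auto
    moreover have "\<kappa> i - s * \<kappa> j = of_int z - (\<mu> i - s * \<mu> j)"
      using z by (simp add: \<kappa>_def algebra_simps)
    ultimately show ?thesis using that(4) by auto
  qed
  have zero: "\<forall>i\<ge>n. \<kappa> i = 0" using \<nu> \<mu> by (auto simp: \<kappa>_def dominant_weights_def spin_wts_def)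
  have n2: "Suc (n - 2) = n - 1" using n by simp
  have "\<not> (\<forall>i. i + 1 < n - 1 \<longrightarrow> \<kappa> i \<ge> \<kappa> (i + 1)) \<or> \<not> \<kappa> (n - 2) \<ge> \<bar>\<kappa> (n - 1)\<bar>"
    using nd lattice zero unfolding \<kappa>_def[symmetric] dominant_weights_def by blast
  then consider i where "i + 1 < n - 1" "\<kappa> i < \<kappa> (i + 1)" | "\<kappa> (n - 2) < \<bar>\<kappa> (n - 1)\<bar>"
    by (meson not_le)
  then show ?thesis
    unfolding \<kappa>_def[symmetric]
  proof cases
    case (1 i)
    then show "\<exists>p. Suc p < n \<and> \<bar>(\<kappa> + rho n) p\<bar> = \<bar>(\<kappa> + rho n) (Suc p)\<bar>"
      using key[of i "i + 1" 1] by (intro exI[of _ i]) (auto simp: rho_apply of_nat_diff)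
  next
    case 2
    \<comment> \<open>The absolute value in the last inequality combines the two simple roots that
      involve the entries n - 2 and n - 1.\<close>
    then consider "\<kappa> (n - 2) < \<kappa> (n - 1)" | "\<kappa> (n - 2) < - \<kappa> (n - 1)" by linarith
    then have "\<kappa> (n - 2) - \<kappa> (n - 1) = - 1 \<or> \<kappa> (n - 2) + \<kappa> (n - 1) = - 1"
      using key[of "n - 2" "n - 1" 1] key[of "n - 2" "n - 1" "- 1"] n by cases auto
    moreover have "rho n (n - 2) = 1" "rho n (n - 1) = 0"
      using n by (auto simp: rho_apply)
    ultimately show "\<exists>p. Suc p < n \<and> \<bar>(\<kappa> + rho n) p\<bar> = \<bar>(\<kappa> + rho n) (Suc p)\<bar>"
      using n by (intro exI[of _ "n - 2"]) (auto simp: n2)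
  qed
qed

text \<open>A recursive form of \<open>spinor_paths\<close>: with the trivial prefix k = 0 included
  and no special rule for the first step, deleting the last step gives a path of the same kind and
  the induction can start at N = 0.\<close>

definition dominant_paths :: "nat \<Rightarrow> nat \<Rightarrow> (nat \<Rightarrow> real) list set" where
  "dominant_paths n N = {\<mu>s. length \<mu>s = N \<and> set \<mu>s \<subseteq> spin_wts n \<and>
     (\<forall>k\<le>N. (\<Sum>i<k. \<mu>s ! i) \<in> dominant_weights n)}"

lemma finite_dominant_paths: "finite (dominant_paths n N)"
  by (rule finite_subset[OF _ finite_lists_length_eq[of "spin_wts n" N]])
     (auto simp: dominant_paths_def)

lemma dominant_paths_Suc_iff:
  "xs @ [\<mu>] \<in> dominant_paths n (Suc N) \<longleftrightarrow>
     xs \<in> dominant_paths n N \<and> \<mu> \<in> spin_wts n \<and> (\<Sum>i<N. xs ! i) + \<mu> \<in> dominant_weights n"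
proof (cases "length xs = N")
  case True
  have pre: "(\<Sum>i<k. (xs @ [\<mu>]) ! i) = (\<Sum>i<k. xs ! i)" if "k \<le> N" for k
    using that True by (intro sum.cong) (auto simp: nth_append)
  have "(\<Sum>i<Suc N. (xs @ [\<mu>]) ! i) = (\<Sum>i<N. xs ! i) + \<mu>"
    using pre[of N] True by (simp add: nth_append)
  then show ?thesis
    using True pre by (auto simp: dominant_paths_def le_Suc_eq simp del: sum.lessThan_Suc)
qed (auto simp: dominant_paths_def)

lemma card_dominant_paths_Suc:
  assumes "\<nu> \<in> dominant_weights n"
  shows "card {\<mu>s \<in> dominant_paths n (Suc N). (\<Sum>i<Suc N. \<mu>s ! i) = \<nu>} =
    (\<Sum>\<mu>\<in>spin_wts n. card {\<mu>s \<in> dominant_paths n N. (\<Sum>i<N. \<mu>s ! i) = \<nu> - \<mu>})"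
proof -
  let ?A = "\<lambda>\<mu>. {\<mu>s \<in> dominant_paths n N. (\<Sum>i<N. \<mu>s ! i) = \<nu> - \<mu>}"
  have sum: "(\<Sum>i<Suc N. (xs @ [\<mu>]) ! i) = (\<Sum>i<N. xs ! i) + \<mu>" if "length xs = N" for xs \<mu>
  proof -
    have "(\<Sum>i<N. (xs @ [\<mu>]) ! i) = (\<Sum>i<N. xs ! i)"
      using that by (intro sum.cong) (auto simp: nth_append)
    then show ?thesis using that by (simp add: nth_append)
  qed
  have len: "length xs = N" if "xs \<in> dominant_paths n N" for xs N
    using that by (simp add: dominant_paths_def)
  have "{\<mu>s \<in> dominant_paths n (Suc N). (\<Sum>i<Suc N. \<mu>s ! i) = \<nu>} =
      (\<Union>\<mu>\<in>spin_wts n. (\<lambda>xs. xs @ [\<mu>]) ` ?A \<mu>)" (is "?L = ?R")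
  proof (intro equalityI subsetI)
    fix \<mu>s assume "\<mu>s \<in> ?L"
    moreover from this obtain xs \<mu> where \<mu>s: "\<mu>s = xs @ [\<mu>]"
      by (cases \<mu>s rule: rev_cases) (auto simp: dominant_paths_def)
    ultimately have *: "xs @ [\<mu>] \<in> dominant_paths n (Suc N)" "(\<Sum>i<Suc N. (xs @ [\<mu>]) ! i) = \<nu>"
      by auto
    then have "xs \<in> dominant_paths n N" "\<mu> \<in> spin_wts n"
      by (auto simp: dominant_paths_Suc_iff)
    moreover have "(\<Sum>i<N. xs ! i) = \<nu> - \<mu>"
      using *(2) sum[OF len[OF calculation(1)], of \<mu>] by (simp add: algebra_simps del: sum.lessThan_Suc)
    ultimately show "\<mu>s \<in> ?R" unfolding \<mu>s by blast
  next
    fix \<mu>s assume "\<mu>s \<in> ?R"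
    then obtain xs \<mu> where *: "\<mu>s = xs @ [\<mu>]" "xs \<in> ?A \<mu>" "\<mu> \<in> spin_wts n" by blast
    then show "\<mu>s \<in> ?L"
      using sum[OF len, of xs \<mu>] assms by (auto simp: dominant_paths_Suc_iff simp del: sum.lessThan_Suc)
  qed
  also have "card \<dots> = (\<Sum>\<mu>\<in>spin_wts n. card ((\<lambda>xs. xs @ [\<mu>]) ` ?A \<mu>))"
    using finite_dominant_paths by (intro card_UN_disjoint) auto
  also have "\<dots> = (\<Sum>\<mu>\<in>spin_wts n. card (?A \<mu>))"
    by (intro sum.cong card_image) (auto simp: inj_on_def)
  finally show ?thesis .
qed

lemma card_dominant_paths:
  assumes n: "n \<ge> 2" and "\<nu> \<in> dominant_weights n"
  shows "Poly_Mapping.lookup (weyl_denom n * spin_char n ^ N) (\<nu> + rho n) =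
    of_nat (card {\<mu>s \<in> dominant_paths n N. (\<Sum>i<N. \<mu>s ! i) = \<nu>})"
  using assms(2)
proof (induction N arbitrary: \<nu>)
  case 0
  have "0 \<in> dominant_weights n" by (auto simp: dominant_weights_def)
  then have "{\<mu>s \<in> dominant_paths n 0. (\<Sum>i<0. \<mu>s ! i) = \<nu>} = (if \<nu> = 0 then {[]} else {})"
    by (auto simp: dominant_paths_def)
  then have "Poly_Mapping.lookup (weyl_denom n * spin_char n ^ 0) (\<nu> + rho n) =
      of_nat (card {\<mu>s \<in> dominant_paths n 0. (\<Sum>i<0. \<mu>s ! i) = \<nu>})"
    using lookup_weyl_denom_dominant[OF 0 n] by (simp only: power_0 mult_1_right) simp
  then show ?case .
next
  case (Suc N)
  \<comment> \<open>If \<nu> - \<mu> is not dominant, both sides vanish: no path ends there, and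
    \<nu> - \<mu> + \<rho> lies on a wall.\<close>
  have step: "Poly_Mapping.lookup (weyl_denom n * spin_char n ^ N) (\<nu> - \<mu> + rho n) =
      of_nat (card {\<mu>s \<in> dominant_paths n N. (\<Sum>i<N. \<mu>s ! i) = \<nu> - \<mu>})"
    if \<mu>: "\<mu> \<in> spin_wts n" for \<mu>
  proof (cases "\<nu> - \<mu> \<in> dominant_weights n")
    case False
    then have "{\<mu>s \<in> dominant_paths n N. (\<Sum>i<N. \<mu>s ! i) = \<nu> - \<mu>} = {}"
      by (auto simp: dominant_paths_def)
    moreover obtain p where "Suc p < n" "\<bar>(\<nu> - \<mu> + rho n) p\<bar> = \<bar>(\<nu> - \<mu> + rho n) (Suc p)\<bar>"
      using dominant_weights_diff_spin[OF Suc.prems \<mu> n False] by blast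
    ultimately show ?thesis
      by (simp only: weyl_denom_spin_char_wall card.empty of_nat_0)
  qed (rule Suc.IH)
  have "Poly_Mapping.lookup (weyl_denom n * spin_char n ^ Suc N) (\<nu> + rho n) =
      (\<Sum>\<mu>\<in>spin_wts n. Poly_Mapping.lookup (weyl_denom n * spin_char n ^ N) (\<nu> + rho n - \<mu>))"
    by (simp only: power_Suc2 mult.assoc[symmetric] lookup_mult_spin_char)
  also have "\<dots> = (\<Sum>\<mu>\<in>spin_wts n. of_nat (card {\<mu>s \<in> dominant_paths n N. (\<Sum>i<N. \<mu>s ! i) = \<nu> - \<mu>}))"
  proof (intro sum.cong refl)
    fix \<mu> assume "\<mu> \<in> spin_wts n"
    moreover have "\<nu> + rho n - \<mu> = \<nu> - \<mu> + rho n" by simp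
    ultimately show "Poly_Mapping.lookup (weyl_denom n * spin_char n ^ N) (\<nu> + rho n - \<mu>) =
        of_nat (card {\<mu>s \<in> dominant_paths n N. (\<Sum>i<N. \<mu>s ! i) = \<nu> - \<mu>})"
      using step by (simp only:)
  qed
  finally show ?case
    by (simp only: card_dominant_paths_Suc[OF Suc.prems] of_nat_sum)
qed

text \<open>Dominance makes all entries but the last nonnegative, so only the sign of the last one
  is free. This identifies the prescribed first steps with the dominant ones.\<close>

lemma spin_wts_dominant_iff:
  assumes "n \<ge> 2" "\<mu> \<in> spin_wts n"
  shows "\<mu> \<in> dominant_weights n \<longleftrightarrow> \<mu> = omega_plus n \<or> \<mu> = omega_minus n"
proof
  assume d: "\<mu> \<in> dominant_weights n"
  have "\<mu> i = 1 / 2" if "i < n - 1" for i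
  proof -
    have "\<mu> i \<ge> 0" using dominant_weightsD[OF d assms(1), of i "n - 1"] that by fastforce
    moreover have "\<mu> i = 1 / 2 \<or> \<mu> i = - 1 / 2" using assms(2) that by (simp add: spin_wts_def)
    ultimately show ?thesis by auto
  qed
  moreover have "\<mu> (n - 1) = 1 / 2 \<or> \<mu> (n - 1) = - 1 / 2"
    using assms by (auto simp: spin_wts_def)
  moreover have "\<mu> i = 0" if "i \<ge> n" for i
    using assms(2) that by (auto simp: spin_wts_def)
  ultimately have "\<mu> i = (if i < n - 1 then 1 / 2 else if i = n - 1 then \<mu> (n - 1) else 0)" for i
    by (cases i "n - 1" rule: linorder_cases) auto
  then have \<mu>: "\<mu> = (\<lambda>i. if i < n - 1 then 1 / 2 else if i = n - 1 then \<mu> (n - 1) else 0)"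
    by (rule ext)
  have plus: "omega_plus n = (\<lambda>i. if i < n - 1 then 1 / 2 else if i = n - 1 then 1 / 2 else 0)"
  proof
    fix i show "omega_plus n i = (if i < n - 1 then 1 / 2 else if i = n - 1 then 1 / 2 else 0)"
      using assms(1) by (cases i "n - 1" rule: linorder_cases) (auto simp: omega_plus_def)
  qed
  show "\<mu> = omega_plus n \<or> \<mu> = omega_minus n"
    using \<open>\<mu> (n - 1) = 1 / 2 \<or> \<mu> (n - 1) = - 1 / 2\<close>
  proof
    assume "\<mu> (n - 1) = 1 / 2"
    then have "\<mu> = omega_plus n" by (intro trans[OF \<mu>]) (simp only: plus)
    then show ?thesis ..
  next
    assume "\<mu> (n - 1) = - 1 / 2"
    then have "\<mu> = omega_minus n" by (intro trans[OF \<mu>]) (simp only: omega_minus_def)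
    then show ?thesis ..
  qed
next
  assume \<mu>: "\<mu> = omega_plus n \<or> \<mu> = omega_minus n"
  have "\<mu> i - 1 / 2 \<in> \<int>" if "i < n" for i
  proof -
    have "\<mu> i - 1 / 2 = 0 \<or> \<mu> i - 1 / 2 = - 1"
      using assms(2) that by (auto simp: spin_wts_def)
    then show ?thesis by (elim disjE) (simp_all only: Ints_0 Ints_1 Ints_minus)
  qed
  then show "\<mu> \<in> dominant_weights n"
    using \<mu> assms(1) by (auto simp: dominant_weights_def omega_plus_def omega_minus_def)
qed

lemma spinor_paths_eq_dominant_paths:
  assumes "n \<ge> 2" "N \<ge> 1"
  shows "spinor_paths n N = dominant_paths n N"
proof -
  have "0 \<in> dominant_weights n" by (auto simp: dominant_weights_def)
  then have all: "(\<forall>k\<le>N. (\<Sum>i<k. \<mu>s ! i) \<in> dominant_weights n) \<longleftrightarrow>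
      (\<forall>k\<in>{1..N}. (\<Sum>i<k. \<mu>s ! i) \<in> dominant_weights n)" for \<mu>s :: "(nat \<Rightarrow> real) list"
  proof (intro iffI ballI allI impI)
    fix k assume "\<forall>k\<in>{1..N}. (\<Sum>i<k. \<mu>s ! i) \<in> dominant_weights n" "k \<le> N"
    then show "(\<Sum>i<k. \<mu>s ! i) \<in> dominant_weights n"
      using \<open>0 \<in> dominant_weights n\<close> by (cases "k = 0") auto
  qed auto
  have first: "\<mu>s ! 0 \<in> {omega_plus n, omega_minus n}"
    if "length \<mu>s = N" "set \<mu>s \<subseteq> spin_wts n" "\<forall>k\<in>{1..N}. (\<Sum>i<k. \<mu>s ! i) \<in> dominant_weights n" for \<mu>s
  proof -
    have "\<mu>s ! 0 \<in> set \<mu>s" using that assms by (intro nth_mem) simp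
    then have "\<mu>s ! 0 \<in> spin_wts n" using that by blast
    moreover have "\<mu>s ! 0 \<in> dominant_weights n"
      using that(3) assms by (auto dest: bspec[of _ _ 1])
    ultimately show ?thesis using spin_wts_dominant_iff[OF assms(1)] by blast
  qed
  show ?thesis
    unfolding spinor_paths_def dominant_paths_def weights_spinor_rep spin_wts_def[symmetric] all
    using first by (intro Collect_cong iffI conjI) (auto simp only:)
qed

section \<open>The orthogonal Lie algebra in coordinates\<close>

text \<open>The index that the symmetric form pairs with a: basis vectors of E and their duals are
  exchanged.\<close>

definition bar :: "nat \<Rightarrow> nat \<Rightarrow> nat" where
  "bar n a = (if a < n then a + n else a - n)"

lemma bar_less [simp]: "a < 2 * n \<Longrightarrow> bar n a < 2 * n"
  by (auto simp: bar_def)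

lemma bar_bar [simp]: "a < 2 * n \<Longrightarrow> bar n (bar n a) = a"
  by (auto simp: bar_def)

lemma bar_eq_iff: "a < 2 * n \<Longrightarrow> b < 2 * n \<Longrightarrow> bar n a = b \<longleftrightarrow> a = bar n b"
  by auto

lemma sum_bar: "(\<Sum>a<2 * n. f (bar n a)) = (\<Sum>a<2 * n. f a)"
  by (rule sum.reindex_bij_witness[where i = "bar n" and j = "bar n"]) auto

lemma sum_double: "(\<Sum>a<2 * n. f a) = (\<Sum>i<n. f i + f (i + n))" for f :: "nat \<Rightarrow> 'a::comm_monoid_add"
proof -
  have "(\<Sum>a<2 * n. f a) = (\<Sum>a<n. f a) + (\<Sum>a=n..<2 * n. f a)"
    by (simp add: lessThan_atLeast0 sum.atLeastLessThan_concat)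
  also have "(\<Sum>a=n..<2 * n. f a) = (\<Sum>i<n. f (i + n))"
    by (rule sum.reindex_bij_witness[where i = "\<lambda>i. i + n" and j = "\<lambda>a. a - n"]) auto
  finally show ?thesis by (simp add: sum.distrib)
qed

lemma sform_bar: "sform n x y = (\<Sum>a<2 * n. x $ a * y $ bar n a)"
  unfolding sform_def sum_double by (intro sum.cong) (auto simp: bar_def)

text \<open>Testing the invariance of the form on pairs of basis vectors gives skew-symmetry of the
  matrix after its rows are permuted by \<open>bar\<close>.\<close>

lemma orth_alg_iff:
  "X \<in> orth_alg n \<longleftrightarrow> X \<in> carrier_mat (2 * n) (2 * n) \<and>
     (\<forall>a<2 * n. \<forall>b<2 * n. X $$ (bar n a, b) = - X $$ (bar n b, a))"
proof (intro iffI conjI allI impI)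
  assume X: "X \<in> orth_alg n"
  then show c: "X \<in> carrier_mat (2 * n) (2 * n)"
    by (simp add: orth_alg_def)
  fix a b assume ab: "a < 2 * n" "b < 2 * n"
  let ?e = "unit_vec (2 * n) :: nat \<Rightarrow> complex vec"
  have ent: "(X *\<^sub>v ?e d) $ k = X $$ (k, d)" if "k < 2 * n" "d < 2 * n" for k d
    using c that by (simp add: row_def)
  have "sform n (X *\<^sub>v ?e a) (?e b) = (\<Sum>k<2 * n. if k = bar n b then X $$ (k, a) else 0)"
    unfolding sform_bar using ab by (intro sum.cong refl) (auto simp: ent bar_eq_iff)
  moreover have "sform n (?e a) (X *\<^sub>v ?e b) = (\<Sum>k<2 * n. if k = a then X $$ (bar n k, b) else 0)"
    unfolding sform_bar using ab by (intro sum.cong refl) (auto simp: ent)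
  moreover have "sform n (X *\<^sub>v ?e a) (?e b) + sform n (?e a) (X *\<^sub>v ?e b) = 0"
    using X by (simp add: orth_alg_def)
  ultimately show "X $$ (bar n a, b) = - X $$ (bar n b, a)"
    using ab by (simp add: eq_neg_iff_add_eq_0 add.commute)
next
  assume asm: "X \<in> carrier_mat (2 * n) (2 * n) \<and>
     (\<forall>a<2 * n. \<forall>b<2 * n. X $$ (bar n a, b) = - X $$ (bar n b, a))"
  then have c: "X \<in> carrier_mat (2 * n) (2 * n)"
    by blast
  have X: "X $$ (bar n a, bar n b) = - X $$ (b, a)" if "a < 2 * n" "b < 2 * n" for a b
  proof -
    have "X $$ (bar n a, bar n b) = - X $$ (bar n (bar n b), a)"
      using asm bar_less that by blast
    then show ?thesis using that by (simp only: bar_bar)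
  qed
  have "sform n (X *\<^sub>v x) y + sform n x (X *\<^sub>v y) = 0"
    if x: "x \<in> carrier_vec (2 * n)" and y: "y \<in> carrier_vec (2 * n)" for x y
  proof -
    have ent: "(X *\<^sub>v z) $ k = (\<Sum>d<2 * n. X $$ (k, d) * z $ d)"
      if "k < 2 * n" "z \<in> carrier_vec (2 * n)" for k z
      using c that by (simp add: scalar_prod_def lessThan_atLeast0)
    have left: "sform n (X *\<^sub>v x) y = (\<Sum>k<2 * n. \<Sum>d<2 * n. X $$ (k, d) * x $ d * y $ bar n k)"
      unfolding sform_bar using x by (simp add: ent sum_distrib_right)
    have "sform n x (X *\<^sub>v y) = (\<Sum>d<2 * n. \<Sum>k<2 * n. x $ d * (X $$ (bar n d, k) * y $ k))"
      unfolding sform_bar using y by (simp add: ent sum_distrib_left)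
    also have "\<dots> = (\<Sum>d<2 * n. \<Sum>k<2 * n. x $ d * (X $$ (bar n d, bar n k) * y $ bar n k))"
      by (rule sum.cong[OF refl], rule sum_bar[symmetric])
    also have "\<dots> = (\<Sum>d<2 * n. \<Sum>k<2 * n. - (X $$ (k, d) * x $ d * y $ bar n k))"
      by (intro sum.cong refl) (simp add: X)
    also have "\<dots> = - (\<Sum>k<2 * n. \<Sum>d<2 * n. X $$ (k, d) * x $ d * y $ bar n k)"
      by (subst sum.swap) (simp add: sum_negf)
    finally show ?thesis using left by simp
  qed
  with c show "X \<in> orth_alg n" by (auto simp: orth_alg_def)
qed

lemma orth_alg_carrier [simp]: "X \<in> orth_alg n \<Longrightarrow> X \<in> carrier_mat (2 * n) (2 * n)"
  by (simp add: orth_alg_iff)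

lemma orth_alg_bar:
  assumes "X \<in> orth_alg n" "a < 2 * n" "b < 2 * n"
  shows "X $$ (bar n a, bar n b) = - X $$ (b, a)"
proof -
  have "X $$ (bar n a, bar n b) = - X $$ (bar n (bar n b), a)"
    using assms bar_less unfolding orth_alg_iff by blast
  then show ?thesis using assms by (simp only: bar_bar)
qed

lemma orth_alg_swap:
  assumes "X \<in> orth_alg n" "a < 2 * n" "b < 2 * n"
  shows "X $$ (bar n a, b) = - X $$ (bar n b, a)"
  using assms unfolding orth_alg_iff by blast

lemma orth_algI:
  assumes "X \<in> carrier_mat (2 * n) (2 * n)"
    and "\<And>a b. a < 2 * n \<Longrightarrow> b < 2 * n \<Longrightarrow> X $$ (bar n a, b) = - X $$ (bar n b, a)"
  shows "X \<in> orth_alg n"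
  using assms unfolding orth_alg_iff by blast

lemma orth_alg_add:
  assumes "X \<in> orth_alg n" "Y \<in> orth_alg n"
  shows "X + Y \<in> orth_alg n"
proof (rule orth_algI)
  fix a b assume "a < 2 * n" "b < 2 * n"
  then show "(X + Y) $$ (bar n a, b) = - (X + Y) $$ (bar n b, a)"
    using assms carrier_matD[OF orth_alg_carrier[OF assms(2)]]
      orth_alg_swap[OF assms(1), of a b] orth_alg_swap[OF assms(2), of a b] by simp
qed (use assms in simp)

lemma orth_alg_smult:
  assumes "X \<in> orth_alg n"
  shows "c \<cdot>\<^sub>m X \<in> orth_alg n"
proof (rule orth_algI)
  fix a b assume "a < 2 * n" "b < 2 * n"
  then show "(c \<cdot>\<^sub>m X) $$ (bar n a, b) = - (c \<cdot>\<^sub>m X) $$ (bar n b, a)"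
    using carrier_matD[OF orth_alg_carrier[OF assms]] orth_alg_swap[OF assms, of a b] by simp
qed (use assms in simp)

lemma index_mult_mat_square:
  assumes "X \<in> carrier_mat m m" "Y \<in> carrier_mat m m" "i < m" "j < m"
  shows "(X * Y) $$ (i, j) = (\<Sum>k<m. X $$ (i, k) * Y $$ (k, j))"
  using assms by (simp add: scalar_prod_def lessThan_atLeast0)

lemma lie_bracket_index:
  assumes "X \<in> carrier_mat (2 * n) (2 * n)" "Y \<in> carrier_mat (2 * n) (2 * n)" "i < 2 * n" "j < 2 * n"
  shows "lie_bracket X Y $$ (i, j) =
    (\<Sum>k<2 * n. X $$ (i, k) * Y $$ (k, j)) - (\<Sum>k<2 * n. Y $$ (i, k) * X $$ (k, j))"
  using assms by (simp add: lie_bracket_def index_mult_mat_square[symmetric])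

lemma lie_bracket_carrier:
  "X \<in> carrier_mat m m \<Longrightarrow> Y \<in> carrier_mat m m \<Longrightarrow> lie_bracket X Y \<in> carrier_mat m m"
  by (auto simp: lie_bracket_def)

lemma orth_alg_bracket:
  assumes X: "X \<in> orth_alg n" and Y: "Y \<in> orth_alg n"
  shows "lie_bracket X Y \<in> orth_alg n"
  unfolding orth_alg_iff
proof (intro conjI allI impI)
  show "lie_bracket X Y \<in> carrier_mat (2 * n) (2 * n)"
    using X Y by (simp add: lie_bracket_carrier)
  fix a b assume ab: "a < 2 * n" "b < 2 * n"
  have *: "(\<Sum>k<2 * n. U $$ (bar n a, k) * W $$ (k, b)) = (\<Sum>k<2 * n. W $$ (bar n b, k) * U $$ (k, a))"
    if "U \<in> orth_alg n" "W \<in> orth_alg n" for U W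
  proof -
    have "(\<Sum>k<2 * n. U $$ (bar n a, k) * W $$ (k, b)) =
        (\<Sum>k<2 * n. U $$ (bar n a, bar n k) * W $$ (bar n k, b))"
      by (rule sum_bar[symmetric])
    also have "\<dots> = (\<Sum>k<2 * n. W $$ (bar n b, k) * U $$ (k, a))"
    proof (intro sum.cong refl)
      fix k assume k: "k \<in> {..<2 * n}"
      have "W $$ (bar n k, b) = - W $$ (bar n b, k)"
        using that(2) ab k unfolding orth_alg_iff by blast
      then show "U $$ (bar n a, bar n k) * W $$ (bar n k, b) = W $$ (bar n b, k) * U $$ (k, a)"
        using orth_alg_bar[OF that(1)] ab k by simp
    qed
    finally show ?thesis .
  qed
  show "lie_bracket X Y $$ (bar n a, b) = - lie_bracket X Y $$ (bar n b, a)"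
    unfolding lie_bracket_index[OF orth_alg_carrier[OF X] orth_alg_carrier[OF Y] bar_less[OF ab(1)] ab(2)]
      lie_bracket_index[OF orth_alg_carrier[OF X] orth_alg_carrier[OF Y] bar_less[OF ab(2)] ab(1)]
      *[OF X Y] *[OF Y X] by simp
qed

text \<open>The anti-involution attached to the compact real form. Unitarity below means that X and
  \<open>dagger n X\<close> act as adjoint operators.\<close>

definition dagger :: "nat \<Rightarrow> complex mat \<Rightarrow> complex mat" where
  "dagger n X = mat (2 * n) (2 * n) (\<lambda>(i, j). cnj (X $$ (j, i)))"

lemma orth_alg_dagger: "X \<in> orth_alg n \<Longrightarrow> dagger n X \<in> orth_alg n"
proof -
  assume X: "X \<in> orth_alg n"
  have swap: "X $$ (b, bar n a) = - X $$ (a, bar n b)" if "a < 2 * n" "b < 2 * n" for a b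
    using orth_alg_bar[OF X, of "bar n b" a] that by simp
  show ?thesis
  proof (rule orth_algI)
    fix a b assume "a < 2 * n" "b < 2 * n"
    then show "dagger n X $$ (bar n a, b) = - dagger n X $$ (bar n b, a)"
      using swap[of a b] by (simp add: dagger_def)
  qed (simp add: dagger_def)
qed

text \<open>One family for the three kinds of generators on which the spinor action is given. Since
  \<open>Fmat n (bar n b) (bar n a)\<close> is the negative of \<open>Fmat n a b\<close>, a sum over
  all index pairs meets each generator twice.\<close>

definition Fmat :: "nat \<Rightarrow> nat \<Rightarrow> nat \<Rightarrow> complex mat" where
  "Fmat n a b = mat_unit n a b - mat_unit n (bar n b) (bar n a)"

lemma Fmat_carrier [simp]: "Fmat n a b \<in> carrier_mat (2 * n) (2 * n)"
  unfolding Fmat_def mat_unit_def by (rule minus_carrier_mat) simp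

lemma Fmat_index:
  "c < 2 * n \<Longrightarrow> d < 2 * n \<Longrightarrow>
   Fmat n a b $$ (c, d) = (if c = a \<and> d = b then 1 else 0) - (if c = bar n b \<and> d = bar n a then 1 else 0)"
  by (simp add: Fmat_def mat_unit_def)

lemma Fmat_orth [simp]:
  assumes "a < 2 * n" "b < 2 * n"
  shows "Fmat n a b \<in> orth_alg n"
proof (rule orth_algI)
  fix c d assume cd: "c < 2 * n" "d < 2 * n"
  then have "bar n c = a \<longleftrightarrow> c = bar n a" "bar n d = a \<longleftrightarrow> d = bar n a"
    "bar n c = bar n b \<longleftrightarrow> c = b" "bar n d = bar n b \<longleftrightarrow> d = b"
    using assms bar_bar by metis+
  then show "Fmat n a b $$ (bar n c, d) = - Fmat n a b $$ (bar n d, c)"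
    by (simp only: Fmat_index[OF bar_less[OF cd(1)] cd(2)] Fmat_index[OF bar_less[OF cd(2)] cd(1)] conj_commute) simp
qed simp

lemma cartan_h_eq_Fmat: "i < n \<Longrightarrow> cartan_h n i = Fmat n i i"
  by (simp add: cartan_h_def Fmat_def bar_def)

lemma cartan_h_orth [simp]: "i < n \<Longrightarrow> cartan_h n i \<in> orth_alg n"
  by (simp add: cartan_h_eq_Fmat)

lemma Fmat_bar: "a < 2 * n \<Longrightarrow> b < 2 * n \<Longrightarrow> Fmat n (bar n b) (bar n a) = (-1) \<cdot>\<^sub>m Fmat n a b"
  by (rule eq_matI) (auto simp: Fmat_def mat_unit_def)

lemma dagger_Fmat: "a < 2 * n \<Longrightarrow> b < 2 * n \<Longrightarrow> dagger n (Fmat n a b) = Fmat n b a"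
proof (rule eq_matI)
  fix i j assume "i < dim_row (Fmat n b a)" "j < dim_col (Fmat n b a)"
  then have "i < 2 * n" "j < 2 * n"
    using carrier_matD[OF Fmat_carrier[of n b a]] by auto
  then show "dagger n (Fmat n a b) $$ (i, j) = Fmat n b a $$ (i, j)"
    by (simp add: dagger_def Fmat_index conj_commute)
qed (use carrier_matD[OF Fmat_carrier[of n b a]] in \<open>auto simp: dagger_def\<close>)

text \<open>The weight of the a-th basis vector of the vector representation. The generator
  \<open>Fmat n a b\<close> has weight \<open>idx_wt n a - idx_wt n b\<close>.\<close>

definition idx_wt :: "nat \<Rightarrow> nat \<Rightarrow> nat \<Rightarrow> real" where
  "idx_wt n a = (if a < n then unit_weight a else - unit_weight (a - n))"

lemma cartan_bracket_index:
  assumes "X \<in> carrier_mat (2 * n) (2 * n)" "k < n" "i < 2 * n" "j < 2 * n"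
  shows "lie_bracket (cartan_h n k) X $$ (i, j) =
    complex_of_real (idx_wt n i k - idx_wt n j k) * X $$ (i, j)"
proof -
  have h: "cartan_h n k $$ (c, d) = (if c = d then complex_of_real (idx_wt n d k) else 0)"
    if "c < 2 * n" "d < 2 * n" for c d
    using that assms(2) unfolding cartan_h_eq_Fmat[OF assms(2)]
    by (auto simp: Fmat_index bar_def idx_wt_def unit_weight_def)
  have "(\<Sum>d<2 * n. cartan_h n k $$ (i, d) * X $$ (d, j)) =
      (\<Sum>d<2 * n. if d = i then complex_of_real (idx_wt n i k) * X $$ (i, j) else 0)"
    using assms by (intro sum.cong refl) (auto simp: h)
  moreover have "(\<Sum>d<2 * n. X $$ (i, d) * cartan_h n k $$ (d, j)) =
      (\<Sum>d<2 * n. if d = j then complex_of_real (idx_wt n j k) * X $$ (i, j) else 0)"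
    using assms by (intro sum.cong refl) (auto simp: h)
  ultimately show ?thesis
    unfolding lie_bracket_index[OF orth_alg_carrier[OF cartan_h_orth[OF assms(2)]] assms(1,3,4)]
    using assms by (simp add: left_diff_distrib)
qed

lemma cartan_bracket_Fmat:
  assumes "k < n" "a < 2 * n" "b < 2 * n"
  shows "lie_bracket (cartan_h n k) (Fmat n a b) =
    complex_of_real (idx_wt n a k - idx_wt n b k) \<cdot>\<^sub>m Fmat n a b"
proof -
  have c: "lie_bracket (cartan_h n k) (Fmat n a b) \<in> carrier_mat (2 * n) (2 * n)"
    using assms by (simp add: lie_bracket_carrier)
  have bar: "idx_wt n (bar n c) k = - idx_wt n c k" if "c < 2 * n" for c
    using that assms by (auto simp: idx_wt_def bar_def)
  show ?thesis
  proof (rule eq_matI)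
    fix i j
    assume "i < dim_row (complex_of_real (idx_wt n a k - idx_wt n b k) \<cdot>\<^sub>m Fmat n a b)"
      "j < dim_col (complex_of_real (idx_wt n a k - idx_wt n b k) \<cdot>\<^sub>m Fmat n a b)"
    then have ij: "i < 2 * n" "j < 2 * n"
      using carrier_matD[OF Fmat_carrier[of n a b]] by auto
    then have "lie_bracket (cartan_h n k) (Fmat n a b) $$ (i, j) =
        complex_of_real (idx_wt n i k - idx_wt n j k) * Fmat n a b $$ (i, j)"
      using assms by (intro cartan_bracket_index) simp_all
    also have "\<dots> = complex_of_real (idx_wt n a k - idx_wt n b k) * Fmat n a b $$ (i, j)"
    proof (cases "(i = a \<and> j = b) \<or> (i = bar n b \<and> j = bar n a)")
      case True
      then have "idx_wt n i k - idx_wt n j k = idx_wt n a k - idx_wt n b k"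
        using bar[OF assms(2)] bar[OF assms(3)] by (elim disjE conjE) (simp_all only:)
      then show ?thesis by (simp only:)
    next
      case False
      then have "Fmat n a b $$ (i, j) = 0"
        unfolding Fmat_index[OF ij] by (simp only: de_Morgan_disj if_False) simp
      then show ?thesis by (simp only: mult_zero_right)
    qed
    finally show "lie_bracket (cartan_h n k) (Fmat n a b) $$ (i, j) =
        (complex_of_real (idx_wt n a k - idx_wt n b k) \<cdot>\<^sub>m Fmat n a b) $$ (i, j)"
      using ij carrier_matD[OF Fmat_carrier[of n a b]] by simp
  qed (use c carrier_matD[OF Fmat_carrier[of n a b]] in auto)
qed

text \<open>For a root labelled ((i, j), s), this is the index l with
  \<open>idx_wt n i - idx_wt n l\<close> equal to the root, so that \<open>Fmat n i l\<close> and
  \<open>Fmat n l i\<close> are root vectors for the root and its negative.\<close>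

definition low_idx :: "nat \<Rightarrow> (nat \<times> nat) \<times> bool \<Rightarrow> nat" where
  "low_idx n \<alpha> = (if snd \<alpha> then snd (fst \<alpha>) + n else snd (fst \<alpha>))"

definition raise :: "nat \<Rightarrow> (nat \<times> nat) \<times> bool \<Rightarrow> complex mat" where
  "raise n \<alpha> = Fmat n (fst (fst \<alpha>)) (low_idx n \<alpha>)"

definition lower :: "nat \<Rightarrow> (nat \<times> nat) \<times> bool \<Rightarrow> complex mat" where
  "lower n \<alpha> = Fmat n (low_idx n \<alpha>) (fst (fst \<alpha>))"

lemma pos_index_idx:
  assumes "\<alpha> \<in> pos_index n"
  shows "fst (fst \<alpha>) < 2 * n" "low_idx n \<alpha> < 2 * n"
    "idx_wt n (fst (fst \<alpha>)) - idx_wt n (low_idx n \<alpha>) = root_of \<alpha>"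
  using assms by (auto simp: pos_index_def root_pairs_def low_idx_def idx_wt_def root_of_def)

lemma raise_orth [simp]: "\<alpha> \<in> pos_index n \<Longrightarrow> raise n \<alpha> \<in> orth_alg n"
  by (simp add: raise_def pos_index_idx)

lemma lower_orth [simp]: "\<alpha> \<in> pos_index n \<Longrightarrow> lower n \<alpha> \<in> orth_alg n"
  by (simp add: lower_def pos_index_idx)

lemma dagger_lower: "\<alpha> \<in> pos_index n \<Longrightarrow> dagger n (lower n \<alpha>) = raise n \<alpha>"
  by (simp add: lower_def raise_def dagger_Fmat pos_index_idx)

lemma cartan_bracket_raise:
  assumes "k < n" "\<alpha> \<in> pos_index n"
  shows "lie_bracket (cartan_h n k) (raise n \<alpha>) = complex_of_real (root_of \<alpha> k) \<cdot>\<^sub>m raise n \<alpha>"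
  using assms pos_index_idx[OF assms(2)]
  by (simp add: raise_def cartan_bracket_Fmat flip: minus_apply)

lemma cartan_bracket_lower:
  assumes "k < n" "\<alpha> \<in> pos_index n"
  shows "lie_bracket (cartan_h n k) (lower n \<alpha>) = complex_of_real (- root_of \<alpha> k) \<cdot>\<^sub>m lower n \<alpha>"
proof -
  have "idx_wt n (low_idx n \<alpha>) k - idx_wt n (fst (fst \<alpha>)) k = - root_of \<alpha> k"
    using fun_cong[OF pos_index_idx(3)[OF assms(2)], of k] by simp
  then show ?thesis
    using assms pos_index_idx[OF assms(2)] by (simp only: lower_def cartan_bracket_Fmat)
qed

lemma raise_root_space: "\<alpha> \<in> pos_index n \<Longrightarrow> raise n \<alpha> \<in> root_space n (root_of \<alpha>)"
  by (simp add: root_space_def cartan_bracket_raise)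

text \<open>Up to a scalar each generator is a Cartan element or a root vector. The scalar -1 arises
  when the indices must first be brought into order by \<open>Fmat_bar\<close>.\<close>

lemma Fmat_cases:
  assumes "a < 2 * n" "b < 2 * n"
  obtains c i where "i < n" "Fmat n a b = c \<cdot>\<^sub>m cartan_h n i"
  | c \<alpha> where "\<alpha> \<in> pos_index n" "Fmat n a b = c \<cdot>\<^sub>m raise n \<alpha>"
  | c \<alpha> where "\<alpha> \<in> pos_index n" "Fmat n a b = c \<cdot>\<^sub>m lower n \<alpha>"
proof -
  have one: "Fmat n a b = 1 \<cdot>\<^sub>m Fmat n a b" for a b
    by (rule eq_matI) auto
  have flip: "Fmat n a b = (-1) \<cdot>\<^sub>m Fmat n (bar n b) (bar n a)"
    using Fmat_bar[of "bar n b" n "bar n a"] assms by simp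
  \<comment> \<open>For these indices the two matrix units coincide and cancel. The zero matrix is
    filed under the Cartan case with scalar 0.\<close>
  have zero: "Fmat n i (i + n) = 0 \<cdot>\<^sub>m cartan_h n i" "Fmat n (i + n) i = 0 \<cdot>\<^sub>m cartan_h n i" if "i < n" for i
    using that by (auto intro!: eq_matI simp: Fmat_def cartan_h_def mat_unit_def bar_def)
  have diag: "Fmat n a b = c \<cdot>\<^sub>m cartan_h n i \<Longrightarrow> i < n \<Longrightarrow> thesis" for c i
    using that(1) by blast
  have up: "i < j \<Longrightarrow> j < n \<Longrightarrow> Fmat n a b = c \<cdot>\<^sub>m raise n ((i, j), s) \<Longrightarrow> thesis" for c i j s
    by (rule that(2)) (auto simp: pos_index_def root_pairs_def)
  have down: "i < j \<Longrightarrow> j < n \<Longrightarrow> Fmat n a b = c \<cdot>\<^sub>m lower n ((i, j), s) \<Longrightarrow> thesis" for c i j s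
    by (rule that(3)) (auto simp: pos_index_def root_pairs_def)
  have rl: "raise n ((i, j), False) = Fmat n i j" "raise n ((i, j), True) = Fmat n i (j + n)"
    "lower n ((i, j), False) = Fmat n j i" "lower n ((i, j), True) = Fmat n (j + n) i" for i j
    by (auto simp: raise_def lower_def low_idx_def)
  consider "a < n" "b < n" | i where "a < n" "b = i + n" "i < n"
    | j where "a = j + n" "b < n" "j < n" | i j where "a = j + n" "b = i + n" "i < n" "j < n"
    using assms by (metis add.commute add_less_cancel_left le_add_diff_inverse mult_2 not_le)
  then show ?thesis
  proof cases
    case 1
    then show ?thesis
      using up[of a b 1 False] down[of b a 1 False] diag[of 1 a] one[of a b]
      by (cases a b rule: linorder_cases) (auto simp: rl cartan_h_eq_Fmat)
  next
    case (2 i)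
    then show ?thesis
      using up[of a i 1 True] up[of i a "-1" True] diag[of 0 a] one[of a b] flip zero[of a]
      by (cases a i rule: linorder_cases) (auto simp: rl bar_def)
  next
    case (3 j)
    then show ?thesis
      using down[of b j 1 True] down[of j b "-1" True] diag[of 0 b] one[of a b] flip zero[of b]
      by (cases b j rule: linorder_cases) (auto simp: rl bar_def)
  next
    case (4 i j)
    then show ?thesis
      using up[of i j "-1" False] down[of j i "-1" False] diag[of "-1" i] flip
      by (cases i j rule: linorder_cases) (auto simp: rl bar_def cartan_h_eq_Fmat)
  qed
qed

text \<open>Under the adjoint action of X, the generator transforms in a like a basis vector and in
  b like a dual one. This single formula replaces a table of brackets between generators.\<close>

lemma lie_bracket_Fmat_index:
  assumes X: "X \<in> orth_alg n" and ab: "a < 2 * n" "b < 2 * n" and pq: "p < 2 * n" "q < 2 * n"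
  shows "lie_bracket X (Fmat n a b) $$ (p, q) =
    (\<Sum>c<2 * n. X $$ (c, a) * Fmat n c b $$ (p, q)) - (\<Sum>d<2 * n. X $$ (b, d) * Fmat n a d $$ (p, q))"
proof -
  have delta: "(\<Sum>k<2 * n. f k * (if k = l then 1 else 0)) = f l" "(\<Sum>k<2 * n. (if k = l then 1 else 0) * f k) = f l"
    if "l < 2 * n" for f :: "nat \<Rightarrow> complex" and l
    using that by (simp_all add: if_distrib[of "\<lambda>x. _ * x"] if_distrib[of "\<lambda>x. x * _"] cong: if_cong)
  \<comment> \<open>With all entries written as products of Kronecker deltas, every sum over an
    index collapses by the rules \<open>s\<close>.\<close>
  define \<delta> :: "nat \<Rightarrow> nat \<Rightarrow> complex" where "\<delta> i j = (if i = j then 1 else 0)" for i j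
  have F: "Fmat n c d $$ (k, l) = \<delta> k c * \<delta> l d - \<delta> k (bar n d) * \<delta> l (bar n c)"
    if "k < 2 * n" "l < 2 * n" for c d k l
  proof -
    have "(if P \<and> Q then 1 else 0) = (if P then 1 else 0) * (if Q then 1 else (0::complex))" for P Q
      by simp
    then show ?thesis unfolding Fmat_index[OF that] \<delta>_def by (simp only:)
  qed
  have s: "(\<Sum>k<2 * n. f k * \<delta> k l) = f l" "(\<Sum>k<2 * n. f k * \<delta> l k) = f l"
    "(\<Sum>k<2 * n. f k * \<delta> l (bar n k)) = f (bar n l)" "(\<Sum>k<2 * n. f k * \<delta> (bar n k) l) = f (bar n l)"
    if "l < 2 * n" for f :: "nat \<Rightarrow> complex" and l
  proof -
    have e: "\<delta> l (bar n k) = \<delta> k (bar n l)" "\<delta> (bar n k) l = \<delta> k (bar n l)" "\<delta> l k = \<delta> k l" if "k < 2 * n" for k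
      using that \<open>l < 2 * n\<close> bar_bar unfolding \<delta>_def by metis+
    show s1: "(\<Sum>k<2 * n. f k * \<delta> k l) = f l" using delta(1)[OF that] by (simp add: \<delta>_def)
    have s2: "(\<Sum>k<2 * n. f k * \<delta> k (bar n l)) = f (bar n l)"
      using delta(1)[of "bar n l" f] that by (simp add: \<delta>_def)
    show "(\<Sum>k<2 * n. f k * \<delta> l k) = f l"
      by (rule trans[OF _ s1]) (intro sum.cong refl, simp add: e)
    show "(\<Sum>k<2 * n. f k * \<delta> l (bar n k)) = f (bar n l)"
      by (rule trans[OF _ s2]) (intro sum.cong refl, simp add: e)
    show "(\<Sum>k<2 * n. f k * \<delta> (bar n k) l) = f (bar n l)"
      by (rule trans[OF _ s2]) (intro sum.cong refl, simp add: e)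
  qed
  have 1: "(\<Sum>k<2 * n. X $$ (p, k) * Fmat n a b $$ (k, q)) = X $$ (p, a) * \<delta> q b - X $$ (p, bar n b) * \<delta> q (bar n a)"
  proof -
    have "(\<Sum>k<2 * n. X $$ (p, k) * Fmat n a b $$ (k, q)) =
      (\<Sum>k<2 * n. X $$ (p, k) * \<delta> k a) * \<delta> q b - (\<Sum>k<2 * n. X $$ (p, k) * \<delta> k (bar n b)) * \<delta> q (bar n a)"
      unfolding sum_distrib_left sum_distrib_right sum_subtractf[symmetric]
      by (intro sum.cong refl) (simp only: F pq lessThan_iff, simp add: algebra_simps)
    then show ?thesis using ab by (simp add: s)
  qed
  have 2: "(\<Sum>k<2 * n. Fmat n a b $$ (p, k) * X $$ (k, q)) = \<delta> p a * X $$ (b, q) - \<delta> p (bar n b) * X $$ (bar n a, q)"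
  proof -
    have "(\<Sum>k<2 * n. Fmat n a b $$ (p, k) * X $$ (k, q)) =
      \<delta> p a * (\<Sum>k<2 * n. X $$ (k, q) * \<delta> k b) - \<delta> p (bar n b) * (\<Sum>k<2 * n. X $$ (k, q) * \<delta> k (bar n a))"
      unfolding sum_distrib_left sum_distrib_right sum_subtractf[symmetric]
      by (intro sum.cong refl) (simp only: F pq lessThan_iff, simp add: algebra_simps)
    then show ?thesis using ab by (simp add: s)
  qed
  have 3: "(\<Sum>c<2 * n. X $$ (c, a) * Fmat n c b $$ (p, q)) = X $$ (p, a) * \<delta> q b - \<delta> p (bar n b) * X $$ (bar n q, a)"
  proof -
    have "(\<Sum>c<2 * n. X $$ (c, a) * Fmat n c b $$ (p, q)) =
      (\<Sum>c<2 * n. X $$ (c, a) * \<delta> p c) * \<delta> q b - \<delta> p (bar n b) * (\<Sum>c<2 * n. X $$ (c, a) * \<delta> q (bar n c))"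
      unfolding sum_distrib_left sum_distrib_right sum_subtractf[symmetric]
      by (intro sum.cong refl) (simp only: F pq lessThan_iff, simp add: algebra_simps)
    then show ?thesis using pq by (simp add: s)
  qed
  have 4: "(\<Sum>d<2 * n. X $$ (b, d) * Fmat n a d $$ (p, q)) = \<delta> p a * X $$ (b, q) - X $$ (b, bar n p) * \<delta> q (bar n a)"
  proof -
    have "(\<Sum>d<2 * n. X $$ (b, d) * Fmat n a d $$ (p, q)) =
      \<delta> p a * (\<Sum>d<2 * n. X $$ (b, d) * \<delta> q d) - (\<Sum>d<2 * n. X $$ (b, d) * \<delta> p (bar n d)) * \<delta> q (bar n a)"
      unfolding sum_distrib_left sum_distrib_right sum_subtractf[symmetric]
      by (intro sum.cong refl) (simp only: F pq lessThan_iff, simp add: algebra_simps)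
    then show ?thesis using pq by (simp add: s)
  qed
  have "X $$ (bar n a, q) = - X $$ (bar n q, a)"
    using X ab pq unfolding orth_alg_iff by blast
  moreover have "X $$ (b, bar n p) = - X $$ (p, bar n b)"
    using orth_alg_bar[OF X, of "bar n b" p] ab pq by simp
  ultimately show ?thesis
    unfolding lie_bracket_index[OF orth_alg_carrier[OF X] Fmat_carrier pq] 1 2 3 4
    by (simp add: mult.commute)
qed

section \<open>Representations and the Casimir operator\<close>

lemma sum_triple_reverse:
  "(\<Sum>a\<in>A. \<Sum>b\<in>A. \<Sum>c\<in>A. f c b a) = (\<Sum>a\<in>A. \<Sum>b\<in>A. \<Sum>c\<in>A. f a b c)"
  for f :: "'b \<Rightarrow> 'b \<Rightarrow> 'b \<Rightarrow> 'a::comm_monoid_add"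
proof -
  have "(\<Sum>a\<in>A. \<Sum>b\<in>A. \<Sum>c\<in>A. f c b a) = (\<Sum>a\<in>A. \<Sum>c\<in>A. \<Sum>b\<in>A. f c b a)"
    by (rule sum.cong[OF refl], rule sum.swap)
  also have "\<dots> = (\<Sum>c\<in>A. \<Sum>a\<in>A. \<Sum>b\<in>A. f c b a)"
    by (rule sum.swap)
  also have "\<dots> = (\<Sum>c\<in>A. \<Sum>b\<in>A. \<Sum>a\<in>A. f c b a)"
    by (rule sum.cong[OF refl], rule sum.swap)
  finally show ?thesis .
qed

lemma sum_square_split:
  "(\<Sum>i<n. \<Sum>j<n. f i j) = (\<Sum>i<n. f i i) + (\<Sum>(i, j)\<in>root_pairs n. f i j + f j i)"
  for f :: "nat \<Rightarrow> nat \<Rightarrow> 'a::comm_monoid_add"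
proof -
  have "(\<Sum>i<n. \<Sum>j<n. f i j) = (\<Sum>p\<in>{..<n} \<times> {..<n}. f (fst p) (snd p))"
    by (simp add: sum.cartesian_product case_prod_beta')
  also have "{..<n} \<times> {..<n} = (\<lambda>i. (i, i)) ` {..<n} \<union> (root_pairs n \<union> prod.swap ` root_pairs n)"
    by (auto simp: root_pairs_def image_iff)
  also have "(\<Sum>p\<in>\<dots>. f (fst p) (snd p)) =
      (\<Sum>p\<in>(\<lambda>i. (i, i)) ` {..<n}. f (fst p) (snd p)) +
      ((\<Sum>p\<in>root_pairs n. f (fst p) (snd p)) + (\<Sum>p\<in>prod.swap ` root_pairs n. f (fst p) (snd p)))"
  proof -
    have "root_pairs n \<inter> prod.swap ` root_pairs n = {}"
      "(\<lambda>i. (i, i)) ` {..<n} \<inter> (root_pairs n \<union> prod.swap ` root_pairs n) = {}"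
      by (auto simp: root_pairs_def)
    then show ?thesis by (simp add: sum.union_disjoint)
  qed
  also have "(\<Sum>p\<in>(\<lambda>i. (i, i)) ` {..<n}. f (fst p) (snd p)) = (\<Sum>i<n. f i i)"
    by (subst sum.reindex) (auto simp: inj_on_def)
  also have "(\<Sum>p\<in>prod.swap ` root_pairs n. f (fst p) (snd p)) = (\<Sum>p\<in>root_pairs n. f (snd p) (fst p))"
    by (subst sum.reindex) auto
  finally show ?thesis
    by (simp add: sum.distrib case_prod_beta')
qed

locale orth_rep =
  fixes n :: nat and R :: "'i rep"
  assumes rep: "is_rep n R"
begin

lemma subspace: "cfun.subspace (space R)"
  using rep by (simp add: is_rep_def)

lemma closed: "X \<in> orth_alg n \<Longrightarrow> v \<in> space R \<Longrightarrow> act R X v \<in> space R"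
  using rep by (auto simp: is_rep_def)

lemma act_add:
  "X \<in> orth_alg n \<Longrightarrow> u \<in> space R \<Longrightarrow> v \<in> space R \<Longrightarrow> act R X (u + v) = act R X u + act R X v"
  using rep by (simp add: is_rep_def linear_on_def)

lemma act_scale:
  "X \<in> orth_alg n \<Longrightarrow> v \<in> space R \<Longrightarrow> act R X (cscale c v) = cscale c (act R X v)"
  using rep by (simp add: is_rep_def linear_on_def)

lemma mat_add:
  "X \<in> orth_alg n \<Longrightarrow> Y \<in> orth_alg n \<Longrightarrow> v \<in> space R \<Longrightarrow> act R (X + Y) v = act R X v + act R Y v"
  using rep unfolding is_rep_def by blast

lemma mat_smult:
  "X \<in> orth_alg n \<Longrightarrow> v \<in> space R \<Longrightarrow> act R (c \<cdot>\<^sub>m X) v = cscale c (act R X v)"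
  using rep unfolding is_rep_def by blast

lemma act_bracket:
  "X \<in> orth_alg n \<Longrightarrow> Y \<in> orth_alg n \<Longrightarrow> v \<in> space R \<Longrightarrow>
   act R (lie_bracket X Y) v = act R X (act R Y v) - act R Y (act R X v)"
  using rep unfolding is_rep_def by blast

lemma act_commute:
  "X \<in> orth_alg n \<Longrightarrow> Y \<in> orth_alg n \<Longrightarrow> v \<in> space R \<Longrightarrow>
   act R X (act R Y v) = act R Y (act R X v) + act R (lie_bracket X Y) v"
  by (simp add: act_bracket)

lemma act_zero: "X \<in> orth_alg n \<Longrightarrow> act R X 0 = 0"
  using act_scale[of X 0 0] cfun.subspace_0[OF subspace] by simp

lemma act_diff:
  assumes "X \<in> orth_alg n" "u \<in> space R" "v \<in> space R"
  shows "act R X (u - v) = act R X u - act R X v"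
  using act_add[OF assms(1), of "u - v" v] cfun.subspace_diff[OF subspace assms(2,3)] assms by simp

lemma act_sum:
  assumes X: "X \<in> orth_alg n" and f: "\<And>a. a \<in> A \<Longrightarrow> f a \<in> space R"
  shows "act R X (\<Sum>a\<in>A. f a) = (\<Sum>a\<in>A. act R X (f a))"
proof (cases "finite A")
  case True
  then have "act R X (sum f A) = (\<Sum>a\<in>A. act R X (f a))"
    using f
  proof (induction A rule: finite_induct)
    case (insert a A)
    have "act R X (sum f (insert a A)) = act R X (f a + sum f A)"
      using insert.hyps by (simp only: sum.insert not_False_eq_True)
    also have "\<dots> = act R X (f a) + act R X (sum f A)"
      using insert.prems by (intro act_add[OF X] cfun.subspace_sum[OF subspace]) auto
    also have "\<dots> = (\<Sum>a\<in>insert a A. act R X (f a))"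
      using insert by (simp only: sum.insert insert_iff not_False_eq_True simp_thms)
    finally show ?case .
  qed (use act_zero[OF X] in \<open>simp only: sum.empty\<close>)
  then show ?thesis .
next
  case False
  then show ?thesis using act_zero[OF X] by (simp only: sum.infinite not_False_eq_True)
qed

text \<open>The action is linear only on matrices of \<open>orth_alg n\<close>, so the partial sums
  are built as matrices inside the algebra. The target Z is compared with the total entry by
  entry.\<close>

lemma act_lincomb:
  assumes fin: "finite A" and G: "\<And>a. a \<in> A \<Longrightarrow> G a \<in> orth_alg n" and Z: "Z \<in> orth_alg n"
    and v: "v \<in> space R"
    and ent: "\<And>i j. i < 2 * n \<Longrightarrow> j < 2 * n \<Longrightarrow> Z $$ (i, j) = (\<Sum>a\<in>A. c a * G a $$ (i, j))"
  shows "act R Z v = (\<Sum>a\<in>A. cscale (c a) (act R (G a) v))"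
proof -
  define M where "M B = mat (2 * n) (2 * n) (\<lambda>(i, j). \<Sum>a\<in>B. c a * G a $$ (i, j))" for B
  have "M A \<in> orth_alg n \<and> act R (M A) v = (\<Sum>a\<in>A. cscale (c a) (act R (G a) v))"
    using fin G
  proof (induction A rule: finite_induct)
    case empty
    have "M {} = 0 \<cdot>\<^sub>m Z"
      using carrier_matD[OF orth_alg_carrier[OF Z]] by (intro eq_matI) (auto simp: M_def)
    then have "M {} \<in> orth_alg n \<and> act R (M {}) v = (\<Sum>a\<in>{}. cscale (c a) (act R (G a) v))"
      by (simp add: orth_alg_smult[OF Z] mat_smult[OF Z v])
    then show ?case .
  next
    case (insert a A)
    have Ga: "G a \<in> orth_alg n" using insert.prems by simp
    have IH: "M A \<in> orth_alg n" "act R (M A) v = (\<Sum>a\<in>A. cscale (c a) (act R (G a) v))"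
      using insert.IH insert.prems by auto
    have "M (insert a A) = c a \<cdot>\<^sub>m G a + M A"
      using insert.hyps carrier_matD[OF orth_alg_carrier[OF Ga]]
      by (intro eq_matI) (auto simp: M_def)
    then have "M (insert a A) \<in> orth_alg n \<and>
        act R (M (insert a A)) v = (\<Sum>a\<in>insert a A. cscale (c a) (act R (G a) v))"
      using insert.hyps
      by (simp add: orth_alg_add orth_alg_smult mat_add mat_smult Ga IH v)
    then show ?case .
  qed
  moreover have "M A = Z"
    using carrier_matD[OF orth_alg_carrier[OF Z]] by (intro eq_matI) (auto simp: M_def ent)
  ultimately show ?thesis by simp
qed

text \<open>The factor 1/2 is there because each term occurs twice: passing from (a, b) to
  (\<open>bar n b\<close>, \<open>bar n a\<close>) changes the sign of both the entry and the
  generator.\<close>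

lemma act_expand:
  assumes X: "X \<in> orth_alg n" and v: "v \<in> space R"
  shows "act R X v = (\<Sum>p\<in>{..<2 * n} \<times> {..<2 * n}.
    cscale (X $$ p / 2) (act R (Fmat n (fst p) (snd p)) v))"
proof (rule act_lincomb[OF _ _ X v])
  fix i j assume ij: "i < 2 * n" "j < 2 * n"
  let ?A = "{..<2 * n} \<times> {..<2 * n}"
  have p: "(i, j) \<in> ?A" "(bar n j, bar n i) \<in> ?A" using ij by simp_all
  have "(\<Sum>p\<in>?A. X $$ p / 2 * Fmat n (fst p) (snd p) $$ (i, j)) =
      (\<Sum>p\<in>?A. (if p = (i, j) then X $$ p / 2 else 0) - (if p = (bar n j, bar n i) then X $$ p / 2 else 0))"
  proof (intro sum.cong refl)
    fix p assume "p \<in> ?A"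
    then obtain a b where ab: "p = (a, b)" "a < 2 * n" "b < 2 * n" by auto
    have "i = bar n b \<longleftrightarrow> b = bar n i" "j = bar n a \<longleftrightarrow> a = bar n j"
      using ab ij bar_bar by metis+
    then have "i = bar n b \<and> j = bar n a \<longleftrightarrow> p = (bar n j, bar n i)" "i = a \<and> j = b \<longleftrightarrow> p = (i, j)"
      unfolding ab(1) by blast+
    moreover have "x * ((if P then 1 else 0) - (if Q then 1 else 0)) = (if P then x else 0) - (if Q then x else 0)"
      for x :: complex and P Q by simp
    moreover have "Fmat n (fst p) (snd p) $$ (i, j) =
        (if i = a \<and> j = b then 1 else 0) - (if i = bar n b \<and> j = bar n a then 1 else 0)"
      unfolding ab(1) fst_conv snd_conv by (rule Fmat_index[OF ij])
    ultimately show "X $$ p / 2 * Fmat n (fst p) (snd p) $$ (i, j) =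
      (if p = (i, j) then X $$ p / 2 else 0) - (if p = (bar n j, bar n i) then X $$ p / 2 else 0)"
      by (simp only:)
  qed
  also have "\<dots> = X $$ (i, j) / 2 - X $$ (bar n j, bar n i) / 2"
    using p by (simp add: sum_subtractf)
  also have "\<dots> = X $$ (i, j)"
    using orth_alg_bar[OF X ij(2,1)] by simp
  finally show "X $$ (i, j) = (\<Sum>p\<in>?A. X $$ p / 2 * Fmat n (fst p) (snd p) $$ (i, j))" ..
qed auto

lemma act_bracket_Fmat:
  assumes X: "X \<in> orth_alg n" and ab: "a < 2 * n" "b < 2 * n" and v: "v \<in> space R"
  shows "act R (lie_bracket X (Fmat n a b)) v =
    (\<Sum>c<2 * n. cscale (X $$ (c, a)) (act R (Fmat n c b) v)) -
    (\<Sum>d<2 * n. cscale (X $$ (b, d)) (act R (Fmat n a d) v))"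
proof -
  \<comment> \<open>A Boolean tag merges the two sums into one, as \<open>act_lincomb\<close>
    requires.\<close>
  let ?A = "UNIV \<times> {..<2 * n}"
  let ?c = "\<lambda>(s, c). if s then X $$ (c, a) else - X $$ (b, c)"
  let ?G = "\<lambda>(s, c). if s then Fmat n c b else Fmat n a c"
  have split: "(\<Sum>p\<in>?A. f p) = (\<Sum>c<2 * n. f (True, c)) + (\<Sum>c<2 * n. f (False, c))"
    for f :: "bool \<times> nat \<Rightarrow> 'z::comm_monoid_add"
  proof -
    have "(\<Sum>p\<in>?A. f p) = (\<Sum>s\<in>UNIV. \<Sum>c<2 * n. f (s, c))"
      by (simp add: sum.cartesian_product case_prod_beta')
    then show ?thesis by (simp add: UNIV_bool add.commute)
  qed
  have "act R (lie_bracket X (Fmat n a b)) v = (\<Sum>p\<in>?A. cscale (?c p) (act R (?G p) v))"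
  proof (rule act_lincomb[OF _ _ _ v])
    show "lie_bracket X (Fmat n a b) \<in> orth_alg n"
      using X ab by (intro orth_alg_bracket) auto
    fix i j assume "i < 2 * n" "j < 2 * n"
    then show "lie_bracket X (Fmat n a b) $$ (i, j) = (\<Sum>p\<in>?A. ?c p * ?G p $$ (i, j))"
      unfolding split by (simp add: sum_negf lie_bracket_Fmat_index[OF X ab])
  qed (use ab in auto)
  then show ?thesis
    unfolding split by (simp add: sum_negf)
qed

section \<open>The Casimir operator\<close>

abbreviation A :: "nat \<Rightarrow> nat \<Rightarrow> ('i \<Rightarrow> complex) \<Rightarrow> 'i \<Rightarrow> complex" where
  "A a b \<equiv> act R (Fmat n a b)"

text \<open>Summing over all index pairs instead of dual bases gives a multiple of the usual Casimir
  element. In this normalisation it acts on a highest weight vector of weight \<nu> by 2 (\<nu>,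
  \<nu> + 2 \<rho>), which follows from \<open>casimir_weight\<close>.\<close>

definition casimir :: "('i \<Rightarrow> complex) \<Rightarrow> 'i \<Rightarrow> complex" where
  "casimir v = (\<Sum>a<2 * n. \<Sum>b<2 * n. A a b (A b a v))"

lemma A_closed: "a < 2 * n \<Longrightarrow> b < 2 * n \<Longrightarrow> v \<in> space R \<Longrightarrow> A a b v \<in> space R"
  by (rule closed) simp_all

lemma A_commute:
  assumes X: "X \<in> orth_alg n" and ab: "a < 2 * n" "b < 2 * n" and v: "v \<in> space R"
  shows "act R X (A a b v) = A a b (act R X v) +
    ((\<Sum>c<2 * n. cscale (X $$ (c, a)) (A c b v)) - (\<Sum>d<2 * n. cscale (X $$ (b, d)) (A a d v)))"
  using act_commute[OF X Fmat_orth[OF ab] v] act_bracket_Fmat[OF X ab v] by simp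

text \<open>Commuting X past both factors produces four triple sums, two of the form P and two of
  the form Q, which cancel after renaming indices.\<close>

lemma casimir_commute:
  assumes X: "X \<in> orth_alg n" and v: "v \<in> space R"
  shows "act R X (casimir v) = casimir (act R X v)"
proof -
  let ?I = "{..<2 * n}"
  define P where "P c b a = cscale (X $$ (c, a)) (A c b (A b a v))" for c b a
  define Q where "Q a b d = cscale (X $$ (b, d)) (A a d (A b a v))" for a b d
  have inner: "act R X (A a b (A b a v)) = A a b (A b a (act R X v)) +
      ((\<Sum>c<2 * n. Q a c b) - (\<Sum>d<2 * n. P a b d)) + ((\<Sum>c<2 * n. P c b a) - (\<Sum>d<2 * n. Q a b d))"
    if ab: "a < 2 * n" "b < 2 * n" for a b
  proof -
    have o: "Fmat n a b \<in> orth_alg n" using ab by simp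
    have sumA: "A a b (\<Sum>c<2 * n. cscale (f c) (g c)) = (\<Sum>c<2 * n. cscale (f c) (A a b (g c)))"
      if "\<And>c. c < 2 * n \<Longrightarrow> g c \<in> space R" for f :: "nat \<Rightarrow> complex" and g
    proof -
      have "A a b (\<Sum>c<2 * n. cscale (f c) (g c)) = (\<Sum>c<2 * n. A a b (cscale (f c) (g c)))"
        using that by (intro act_sum[OF o] cfun.subspace_scale[OF subspace]) auto
      also have "\<dots> = (\<Sum>c<2 * n. cscale (f c) (A a b (g c)))"
        using that by (intro sum.cong refl act_scale[OF o]) auto
      finally show ?thesis .
    qed
    let ?u = "\<Sum>c<2 * n. cscale (X $$ (c, b)) (A c a v)"
    let ?w = "\<Sum>d<2 * n. cscale (X $$ (a, d)) (A b d v)"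
    have uw: "?u \<in> space R" "?w \<in> space R"
      using ab v by (auto intro!: cfun.subspace_sum[OF subspace] cfun.subspace_scale[OF subspace] A_closed)
    have Xv: "act R X v \<in> space R" using X v by (rule closed)
    have "A a b (act R X (A b a v)) = A a b (A b a (act R X v) + (?u - ?w))"
      using A_commute[OF X ab(2,1) v] by simp
    also have "\<dots> = A a b (A b a (act R X v)) + (A a b ?u - A a b ?w)"
      using ab uw Xv by (simp add: act_add[OF o] act_diff[OF o] A_closed cfun.subspace_diff[OF subspace])
    also have "A a b ?u = (\<Sum>c<2 * n. Q a c b)"
      unfolding Q_def using ab v by (intro sumA A_closed) auto
    also have "A a b ?w = (\<Sum>d<2 * n. P a b d)"
      unfolding P_def using ab v by (intro sumA A_closed) auto
    finally have 1: "A a b (act R X (A b a v)) =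
        A a b (A b a (act R X v)) + ((\<Sum>c<2 * n. Q a c b) - (\<Sum>d<2 * n. P a b d))" .
    have "act R X (A a b (A b a v)) = A a b (act R X (A b a v)) +
        ((\<Sum>c<2 * n. P c b a) - (\<Sum>d<2 * n. Q a b d))"
      unfolding P_def Q_def using ab v by (intro A_commute[OF X ab] A_closed)
    then show ?thesis unfolding 1 .
  qed
  have "act R X (casimir v) = (\<Sum>a<2 * n. \<Sum>b<2 * n. act R X (A a b (A b a v)))"
    unfolding casimir_def using X v
    by (subst act_sum) (auto intro!: sum.cong act_sum cfun.subspace_sum[OF subspace] A_closed)
  also have "\<dots> = (\<Sum>a<2 * n. \<Sum>b<2 * n. A a b (A b a (act R X v)) +
      ((\<Sum>c<2 * n. Q a c b) - (\<Sum>d<2 * n. P a b d)) + ((\<Sum>c<2 * n. P c b a) - (\<Sum>d<2 * n. Q a b d)))"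
    by (intro sum.cong refl) (simp add: inner)
  also have "\<dots> = casimir (act R X v) +
      (((\<Sum>a<2 * n. \<Sum>b<2 * n. \<Sum>c<2 * n. Q a c b) - (\<Sum>a<2 * n. \<Sum>b<2 * n. \<Sum>d<2 * n. P a b d)) +
      ((\<Sum>a<2 * n. \<Sum>b<2 * n. \<Sum>c<2 * n. P c b a) - (\<Sum>a<2 * n. \<Sum>b<2 * n. \<Sum>d<2 * n. Q a b d)))"
    by (simp only: casimir_def sum.distrib sum_subtractf add.assoc)
  also have "(\<Sum>a<2 * n. \<Sum>b<2 * n. \<Sum>c<2 * n. P c b a) = (\<Sum>a<2 * n. \<Sum>b<2 * n. \<Sum>d<2 * n. P a b d)"
    by (rule sum_triple_reverse)
  also have "(\<Sum>a<2 * n. \<Sum>b<2 * n. \<Sum>c<2 * n. Q a c b) = (\<Sum>a<2 * n. \<Sum>b<2 * n. \<Sum>d<2 * n. Q a b d)"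
    by (rule sum.cong[OF refl], rule sum.swap)
  finally show ?thesis by simp
qed

text \<open>Unlike in \<open>weight_vector\<close>, zero is allowed, so that projections preserve
  the notion and root vectors merely shift the weight.\<close>

definition wvec :: "(nat \<Rightarrow> real) \<Rightarrow> ('i \<Rightarrow> complex) \<Rightarrow> bool" where
  "wvec \<nu> v \<longleftrightarrow> v \<in> space R \<and> (\<forall>k<n. act R (cartan_h n k) v = cscale (complex_of_real (\<nu> k)) v)"

lemma A_bar:
  assumes "a < 2 * n" "b < 2 * n" "v \<in> space R"
  shows "A (bar n b) (bar n a) v = - A a b v"
  using mat_smult[OF Fmat_orth[OF assms(1,2)] assms(3), of "-1"] Fmat_bar[OF assms(1,2)] by simp

lemma A_diag:
  assumes "wvec \<nu> v" "a < 2 * n"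
  shows "A a a v = cscale (complex_of_real (if a < n then \<nu> a else - \<nu> (a - n))) v"
proof (cases "a < n")
  case True
  then show ?thesis using assms by (simp add: wvec_def flip: cartan_h_eq_Fmat)
next
  case False
  then have b: "bar n a < n" "bar n a = a - n" using assms(2) by (auto simp: bar_def)
  have "A a a v = - A (bar n a) (bar n a) v"
    using A_bar[of "bar n a" "bar n a" v] assms by (simp add: wvec_def)
  also have "\<dots> = - cscale (complex_of_real (\<nu> (bar n a))) v"
    using assms b(1) by (simp add: wvec_def flip: cartan_h_eq_Fmat)
  finally show ?thesis using False b by simp
qed

text \<open>The sl_2 relation for a pair of opposite generators. For p = \<open>bar n q\<close> both
  generators are zero, while the Cartan term on the right need not vanish.\<close>

lemma A_swap_weight:
  assumes v: "wvec \<nu> v" and pq: "p < 2 * n" "q < 2 * n" "p \<noteq> bar n q"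
  shows "A p q (A q p v) = A q p (A p q v) + (A p p v - A q q v)"
proof -
  have vV: "v \<in> space R" using v by (simp add: wvec_def)
  have "q \<noteq> bar n p" using pq by auto
  have 1: "(\<Sum>c<2 * n. cscale (Fmat n p q $$ (c, q)) (A c p v)) = (\<Sum>c<2 * n. if c = p then A p p v else 0)"
    using pq \<open>q \<noteq> bar n p\<close> by (intro sum.cong refl) (simp add: Fmat_index)
  have 2: "(\<Sum>d<2 * n. cscale (Fmat n p q $$ (p, d)) (A q d v)) = (\<Sum>d<2 * n. if d = q then A q q v else 0)"
    using pq by (intro sum.cong refl) (simp add: Fmat_index)
  show ?thesis
    using A_commute[OF Fmat_orth[OF pq(1,2)] pq(2,1) vV] pq unfolding 1 2 by simp
qed

text \<open>All roots have squared length 2, so coroots equal roots and the bracket of the two root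
  vectors acts on weight \<nu> by the pairing with the root.\<close>

lemma raise_lower_commute:
  assumes v: "wvec \<nu> v" and \<alpha>: "\<alpha> \<in> pos_index n"
  shows "act R (raise n \<alpha>) (act R (lower n \<alpha>) v) =
    act R (lower n \<alpha>) (act R (raise n \<alpha>) v) + cscale (complex_of_real (wt_inner n \<nu> (root_of \<alpha>))) v"
proof -
  obtain i j s where a: "\<alpha> = ((i, j), s)" "i < j" "j < n"
    using \<alpha> by (auto simp: pos_index_def root_pairs_def)
  have "A i i v - A (low_idx n \<alpha>) (low_idx n \<alpha>) v = cscale (complex_of_real (wt_inner n \<nu> (root_of \<alpha>))) v"
    using a by (auto simp: A_diag[OF v] low_idx_def wt_inner_root cfun.scale_left_diff_distrib cfun.scale_left_distrib)
  moreover have "i \<noteq> bar n (low_idx n \<alpha>)" using a by (auto simp: low_idx_def bar_def)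
  ultimately show ?thesis
    using A_swap_weight[OF v, of i "low_idx n \<alpha>"] pos_index_idx[OF \<alpha>] a
    by (simp add: raise_def lower_def)
qed

text \<open>All products are reordered so that raising operators act first. For i < j this costs
  (\<nu>_i - \<nu>_j) + (\<nu>_i + \<nu>_j) = 2 \<nu>_i, and these costs, counted for (i, j) and (j,
  i), add up to 4 (\<rho>, \<nu>).\<close>

lemma casimir_weight:
  assumes v: "wvec \<nu> v"
  shows "casimir v = cscale (complex_of_real (2 * wt_inner n \<nu> \<nu> + 4 * wt_inner n (rho n) \<nu>)) v +
    cscale 4 (\<Sum>\<alpha>\<in>pos_index n. act R (lower n \<alpha>) (act R (raise n \<alpha>) v))"
proof -
  have vV: "v \<in> space R" using v by (simp add: wvec_def)
  \<comment> \<open>The contribution of (i, j) together with its barred variants. It is symmetric in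
    i and j, so only the diagonal and i < j have to be computed.\<close>
  define T where "T i j = A i j (A j i v) + A j i (A i j v) +
      (A i (j + n) (A (j + n) i v) + A (j + n) i (A i (j + n) v))" for i j
  have neg: "A a b (- u) = - A a b u" if "a < 2 * n" "b < 2 * n" "u \<in> space R" for a b u
    using act_scale[OF Fmat_orth[OF that(1,2)] that(3), of "-1"] by simp
  have b4: "A (i + n) (j + n) u = - A j i u" "A (i + n) j u = - A (j + n) i u" "A j (i + n) u = - A i (j + n) u"
    if "i < n" "j < n" "u \<in> space R" for i j u
    using A_bar[of j i u] A_bar[of "j + n" i u] A_bar[of i "j + n" u] that by (auto simp: bar_def)
  have cl: "A a b v \<in> space R" if "a < 2 * n" "b < 2 * n" for a b
    using that vV by (rule A_closed)
  have dbl: "A (i + n) j (A j (i + n) v) = A (j + n) i (A i (j + n) v)"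
    "A (i + n) (j + n) (A (j + n) (i + n) v) = A j i (A i j v)"
    "A j (i + n) (A (i + n) j v) = A i (j + n) (A (j + n) i v)" if ij: "i < n" "j < n" for i j
  proof -
    have lt: "i < 2 * n" "j < 2 * n" "i + n < 2 * n" "j + n < 2 * n" using ij by auto
    have "A (i + n) j (A j (i + n) v) = A (i + n) j (- A i (j + n) v)"
      by (simp only: b4(3)[OF ij vV])
    also have "\<dots> = A (j + n) i (A i (j + n) v)"
      by (simp only: neg[OF lt(3,2) cl[OF lt(1,4)]] b4(2)[OF ij cl[OF lt(1,4)]] minus_minus)
    finally show "A (i + n) j (A j (i + n) v) = A (j + n) i (A i (j + n) v)" .
    have "A (i + n) (j + n) (A (j + n) (i + n) v) = A (i + n) (j + n) (- A i j v)"
      by (simp only: b4(1)[OF ij(2,1) vV])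
    also have "\<dots> = A j i (A i j v)"
      by (simp only: neg[OF lt(3,4) cl[OF lt(1,2)]] b4(1)[OF ij cl[OF lt(1,2)]] minus_minus)
    finally show "A (i + n) (j + n) (A (j + n) (i + n) v) = A j i (A i j v)" .
    have "A j (i + n) (A (i + n) j v) = A j (i + n) (- A (j + n) i v)"
      by (simp only: b4(2)[OF ij vV])
    also have "\<dots> = A i (j + n) (A (j + n) i v)"
      by (simp only: neg[OF lt(2,3) cl[OF lt(4,1)]] b4(3)[OF ij cl[OF lt(4,1)]] minus_minus)
    finally show "A j (i + n) (A (i + n) j v) = A i (j + n) (A (j + n) i v)" .
  qed
  have cas: "casimir v = (\<Sum>i<n. \<Sum>j<n. T i j)"
  proof -
    have "casimir v = (\<Sum>i<n. \<Sum>j<n. (A i j (A j i v) + A i (j + n) (A (j + n) i v)) +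
        (A (i + n) j (A j (i + n) v) + A (i + n) (j + n) (A (j + n) (i + n) v)))"
      by (simp only: casimir_def sum_double sum.distrib add_ac)
    also have "\<dots> = (\<Sum>i<n. \<Sum>j<n. T i j)"
    proof (intro sum.cong refl)
      fix i j assume "i \<in> {..<n}" "j \<in> {..<n}"
      then have ij: "i < n" "j < n" by simp_all
      show "(A i j (A j i v) + A i (j + n) (A (j + n) i v)) +
        (A (i + n) j (A j (i + n) v) + A (i + n) (j + n) (A (j + n) (i + n) v)) = T i j"
        by (simp only: T_def dbl(1,2)[OF ij] add_ac)
    qed
    finally show ?thesis .
  qed
  have sym: "T j i = T i j" if ij: "i < n" "j < n" for i j
    by (simp only: T_def dbl(1,3)[OF ij] add_ac)
  have diag: "T i i = cscale (complex_of_real (2 * (\<nu> i * \<nu> i))) v" if i: "i < n" for i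
  proof -
    have z: "A i (i + n) u = 0" if "u \<in> space R" for u
      using b4(3)[OF i i that] by (simp add: fun_eq_iff equal_neg_zero)
    have "A i i (A i i v) = cscale (complex_of_real (\<nu> i * \<nu> i)) v"
      using i by (simp add: A_diag[OF v] act_scale[OF Fmat_orth] vV)
    then show ?thesis
      using i vV cl act_zero[OF Fmat_orth[of "i + n" n i]]
      by (simp add: T_def z flip: cfun.scale_left_distrib)
  qed
  have off: "T i j = cscale 2 (\<Sum>s\<in>UNIV. act R (lower n ((i, j), s)) (act R (raise n ((i, j), s)) v)) +
      cscale (complex_of_real (2 * \<nu> i)) v" if ij: "i < j" "j < n" for i j
  proof -
    have mem: "((i, j), s) \<in> pos_index n" for s using ij by (simp add: pos_index_def root_pairs_def)
    have rl: "raise n ((i, j), False) = Fmat n i j" "raise n ((i, j), True) = Fmat n i (j + n)"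
      "lower n ((i, j), False) = Fmat n j i" "lower n ((i, j), True) = Fmat n (j + n) i"
      by (auto simp: raise_def lower_def low_idx_def)
    have c1: "A i j (A j i v) = A j i (A i j v) + cscale (complex_of_real (\<nu> i - \<nu> j)) v"
      using raise_lower_commute[OF v mem[of False]] wt_inner_root[OF ij, of \<nu> False] by (simp add: rl)
    have c2: "A i (j + n) (A (j + n) i v) = A (j + n) i (A i (j + n) v) + cscale (complex_of_real (\<nu> i + \<nu> j)) v"
      using raise_lower_commute[OF v mem[of True]] wt_inner_root[OF ij, of \<nu> True] by (simp add: rl)
    show ?thesis
      unfolding T_def c1 c2 UNIV_bool
      by (rule ext) (simp add: rl cscale_def algebra_simps)
  qed
  have "casimir v = (\<Sum>i<n. T i i) + (\<Sum>(i, j)\<in>root_pairs n. T i j + T j i)"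
    unfolding cas by (rule sum_square_split)
  also have "(\<Sum>i<n. T i i) = cscale (complex_of_real (2 * wt_inner n \<nu> \<nu>)) v"
    by (simp add: diag wt_inner_def sum_distrib_left flip: cfun.scale_sum_left)
  also have "(\<Sum>(i, j)\<in>root_pairs n. T i j + T j i) =
      (\<Sum>p\<in>root_pairs n. cscale 4 (\<Sum>s\<in>UNIV. act R (lower n (p, s)) (act R (raise n (p, s)) v)) +
        cscale (complex_of_real (4 * \<nu> (fst p))) v)"
  proof (intro sum.cong refl)
    fix p assume "p \<in> root_pairs n"
    then obtain i j where p: "p = (i, j)" "i < j" "j < n" by (auto simp: root_pairs_def)
    have "T i j + T j i = cscale 2 (T i j)"
      using sym[of i j] p by (simp add: fun_eq_iff cscale_def)
    also have "\<dots> = cscale 4 (\<Sum>s\<in>UNIV. act R (lower n (p, s)) (act R (raise n (p, s)) v)) +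
        cscale (complex_of_real (4 * \<nu> (fst p))) v"
      unfolding off[OF p(2,3)] p(1) by (simp add: cfun.scale_right_distrib)
    finally show "(case p of (i, j) \<Rightarrow> T i j + T j i) =
        cscale 4 (\<Sum>s\<in>UNIV. act R (lower n (p, s)) (act R (raise n (p, s)) v)) +
        cscale (complex_of_real (4 * \<nu> (fst p))) v"
      using p by simp
  qed
  also have "\<dots> = cscale 4 (\<Sum>\<alpha>\<in>pos_index n. act R (lower n \<alpha>) (act R (raise n \<alpha>) v)) +
      cscale (complex_of_real (4 * (\<Sum>p\<in>root_pairs n. \<nu> (fst p)))) v"
    unfolding pos_index_def sum.distrib
    by (simp add: sum.cartesian_product case_prod_beta' sum_distrib_left
        flip: cfun.scale_sum_left cfun.scale_sum_right)
  also have "(\<Sum>p\<in>root_pairs n. \<nu> (fst p)) = wt_inner n (rho n) \<nu>"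
  proof -
    have "wt_inner n \<nu> (unit_weight i) = \<nu> i" if "i < n" for i
      using that by (simp add: wt_inner_def unit_weight_def if_distrib[of "\<lambda>x. _ * x"] cong: if_cong)
    then have "(\<Sum>p\<in>root_pairs n. \<nu> (fst p)) = (\<Sum>p\<in>root_pairs n. wt_inner n \<nu> (case p of (i, j) \<Rightarrow> unit_weight i))"
      by (intro sum.cong refl) (auto simp: root_pairs_def)
    also have "\<dots> = wt_inner n \<nu> (rho n)"
      unfolding rho_def wt_inner_sum_right ..
    finally show ?thesis by (simp only: wt_inner_commute)
  qed
  finally show ?thesis
    by (simp only: cfun.scale_left_distrib of_real_add add_ac)
qed

end

section \<open>Highest weight representations\<close>

text \<open>Words of lowering operators applied to v. The total \<gamma> is recorded separately
  because a vector that has become zero no longer determines it.\<close>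

inductive lowered :: "nat \<Rightarrow> 'i rep \<Rightarrow> ('i \<Rightarrow> complex) \<Rightarrow> (nat \<Rightarrow> real) \<Rightarrow> ('i \<Rightarrow> complex) \<Rightarrow> bool"
  for n R v where
  base: "lowered n R v 0 v"
| step: "lowered n R v \<gamma> w \<Longrightarrow> \<alpha> \<in> pos_index n \<Longrightarrow>
    lowered n R v (\<gamma> + root_of \<alpha>) (act R (lower n \<alpha>) w)"

definition gen :: "nat \<Rightarrow> 'i rep \<Rightarrow> ('i \<Rightarrow> complex) \<Rightarrow> ('i \<Rightarrow> complex) set" where
  "gen n R v = cfun.span {w. \<exists>\<gamma>. lowered n R v \<gamma> w}"

text \<open>Each lowering adds a positive integer to the pairing with \<open>rho\<close>, so height
  0 means that no operator was applied.\<close>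

lemma lowered_height:
  assumes "lowered n R v \<gamma> w"
  shows "\<exists>m::nat. wt_inner n (rho n) \<gamma> = real m \<and> (m = 0 \<longrightarrow> \<gamma> = 0 \<and> w = v)"
  using assms
proof cases
  case base
  then show ?thesis by (auto simp: wt_inner_def)
next
  case (step \<gamma>' w' \<alpha>)
  have nat: "\<exists>m::nat. wt_inner n (rho n) \<gamma>' = real m"
    using step(3)
  proof (induction rule: lowered.induct)
    case base
    have "wt_inner n (rho n) 0 = real 0" by (simp add: wt_inner_def)
    then show ?case by blast
  next
    case (step \<gamma> w \<alpha>)
    then obtain m :: nat where "wt_inner n (rho n) \<gamma> = real m" by blast
    moreover obtain k :: nat where "wt_inner n (rho n) (root_of \<alpha>) = real k"
      using wt_inner_rho_root_pos[OF step.hyps(2)] by blast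
    ultimately have "wt_inner n (rho n) (\<gamma> + root_of \<alpha>) = real (m + k)"
      by (simp only: wt_inner_add_right of_nat_add)
    then show ?case by blast
  qed
  then obtain m :: nat where "wt_inner n (rho n) \<gamma>' = real m" by blast
  moreover obtain k :: nat where "k > 0" "wt_inner n (rho n) (root_of \<alpha>) = real k"
    using wt_inner_rho_root_pos[OF step(4)] by blast
  ultimately have "wt_inner n (rho n) \<gamma> = real (m + k)"
    using step(1) by (simp only: wt_inner_add_right of_nat_add)
  moreover have "m + k \<noteq> 0" using \<open>k > 0\<close> by simp
  ultimately show ?thesis by blast
qed

lemma lowered_dominant:
  assumes "lowered n R v \<gamma> w" "\<nu> \<in> dominant_weights n" "n \<ge> 2"
  shows "wt_inner n \<nu> \<gamma> \<ge> 0"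
  using assms(1)
proof (induction rule: lowered.induct)
  case base
  have "wt_inner n \<nu> 0 \<ge> 0" by (simp add: wt_inner_def)
  then show ?case .
next
  case (step \<gamma> w \<alpha>)
  then have "wt_inner n \<nu> (\<gamma> + root_of \<alpha>) \<ge> 0"
    using wt_inner_dominant_root_nonneg[OF assms(2,3)] by (simp only: wt_inner_add_right add_nonneg_nonneg)
  then show ?case .
qed

lemma lowered_zero:
  assumes "lowered n R v \<gamma> w" "i \<ge> n"
  shows "\<gamma> i = 0"
  using assms(1)
proof (induction rule: lowered.induct)
  case (step \<gamma> w \<alpha>)
  then show ?case using root_of_zero[OF step.hyps(2) assms(2)] by simp
qed simp

definition subrep :: "'i rep \<Rightarrow> ('i \<Rightarrow> complex) set \<Rightarrow> 'i rep" where
  "subrep R W = R\<lparr>space := W\<rparr>"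

lemma subrep_simps [simp]: "space (subrep R W) = W" "act (subrep R W) = act R"
  by (simp_all add: subrep_def)

lemma is_subrepD:
  assumes "is_subrep n R W"
  shows "W \<subseteq> space R" "cfun.subspace W" "0 \<in> W"
    "\<And>a b. a \<in> W \<Longrightarrow> b \<in> W \<Longrightarrow> a + b \<in> W" "\<And>a b. a \<in> W \<Longrightarrow> b \<in> W \<Longrightarrow> a - b \<in> W"
    "\<And>c a. a \<in> W \<Longrightarrow> cscale c a \<in> W"
    "\<And>X a. X \<in> orth_alg n \<Longrightarrow> a \<in> W \<Longrightarrow> act R X a \<in> W"
proof -
  show sub: "cfun.subspace W" and "W \<subseteq> space R"
    using assms by (simp_all only: is_subrep_def)
  show "0 \<in> W" "\<And>a b. a \<in> W \<Longrightarrow> b \<in> W \<Longrightarrow> a + b \<in> W" "\<And>a b. a \<in> W \<Longrightarrow> b \<in> W \<Longrightarrow> a - b \<in> W"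
    "\<And>c a. a \<in> W \<Longrightarrow> cscale c a \<in> W"
    by (rule cfun.subspace_0[OF sub] cfun.subspace_add[OF sub] cfun.subspace_diff[OF sub]
        cfun.subspace_scale[OF sub]; assumption)+
  fix X a assume "X \<in> orth_alg n" "a \<in> W"
  then show "act R X a \<in> W"
    using assms unfolding is_subrep_def by blast
qed

lemma is_rep_subrep:
  assumes "is_rep n R" "is_subrep n R W"
  shows "is_rep n (subrep R W)"
proof -
  interpret orth_rep n R by unfold_locales fact
  have W: "\<And>x. x \<in> W \<Longrightarrow> x \<in> space R" "cfun.subspace W"
    using is_subrepD(1,2)[OF assms(2)] by auto
  have W': "act R X ` W \<subseteq> W" if "X \<in> orth_alg n" for X
    using is_subrepD(7)[OF assms(2) that] by (rule image_subsetI)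
  show ?thesis
    unfolding is_rep_def linear_on_def subrep_simps
    by (intro conjI ballI allI W(2) W')
       (simp_all add: W(1) act_add act_scale mat_add mat_smult act_bracket)
qed

context orth_rep
begin

lemma act_span:
  assumes X: "X \<in> orth_alg n" and S: "S \<subseteq> space R" and W: "cfun.subspace W"
    and act: "\<And>s. s \<in> S \<Longrightarrow> act R X s \<in> W" and x: "x \<in> cfun.span S"
  shows "act R X x \<in> W"
proof -
  have "cfun.subspace {x. x \<in> space R \<and> act R X x \<in> W}"
    by (rule cfun.subspaceI)
       (auto simp: act_zero[OF X] act_add[OF X] act_scale[OF X] cfun.subspace_0[OF subspace]
         cfun.subspace_0[OF W] cfun.subspace_add[OF subspace] cfun.subspace_add[OF W]
         cfun.subspace_scale[OF subspace] cfun.subspace_scale[OF W])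
  moreover have "S \<subseteq> {x. x \<in> space R \<and> act R X x \<in> W}"
    using S act by auto
  ultimately have "cfun.span S \<subseteq> {x. x \<in> space R \<and> act R X x \<in> W}"
    by (rule cfun.span_minimal[rotated])
  then show ?thesis using x by blast
qed

lemma wvec_act:
  assumes X: "X \<in> orth_alg n" "\<And>k. k < n \<Longrightarrow> lie_bracket (cartan_h n k) X = complex_of_real (\<beta> k) \<cdot>\<^sub>m X"
    and v: "wvec \<nu> v"
  shows "wvec (\<nu> + \<beta>) (act R X v)"
proof -
  have vV: "v \<in> space R" using v by (simp add: wvec_def)
  have "act R (cartan_h n k) (act R X v) = cscale (complex_of_real ((\<nu> + \<beta>) k)) (act R X v)" if k: "k < n" for k
  proof -
    have "act R (cartan_h n k) (act R X v) =
        act R X (act R (cartan_h n k) v) + act R (lie_bracket (cartan_h n k) X) v"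
      using k X(1) vV by (intro act_commute) simp_all
    also have "\<dots> = cscale (complex_of_real (\<nu> k)) (act R X v) + cscale (complex_of_real (\<beta> k)) (act R X v)"
      using v k by (simp add: X wvec_def act_scale[OF X(1)] mat_smult[OF X(1) vV])
    also have "\<dots> = cscale (complex_of_real ((\<nu> + \<beta>) k)) (act R X v)"
      by (simp add: cfun.scale_left_distrib)
    finally show ?thesis .
  qed
  then show ?thesis
    unfolding wvec_def using closed[OF X(1) vV] by blast
qed

lemma hwv_wvec: "highest_weight_vector n R \<nu> v \<Longrightarrow> wvec \<nu> v"
  by (auto simp: highest_weight_vector_def weight_vector_def wvec_def)

lemma hwv_nonzero: "highest_weight_vector n R \<nu> v \<Longrightarrow> v \<noteq> 0"
  by (auto simp: highest_weight_vector_def weight_vector_def)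

lemma hwv_raise: "highest_weight_vector n R \<nu> v \<Longrightarrow> \<alpha> \<in> pos_index n \<Longrightarrow> act R (raise n \<alpha>) v = 0"
  using raise_root_space root_of_in_positive_roots unfolding highest_weight_vector_def by blast

lemma v_in_gen: "v \<in> gen n R v"
  unfolding gen_def using lowered.base by (intro cfun.span_base) blast

lemma gen_subspace: "cfun.subspace (gen n R v)"
  by (simp add: gen_def)

context
  fixes \<nu> :: "nat \<Rightarrow> real" and v :: "'i \<Rightarrow> complex"
  assumes hw: "highest_weight_vector n R \<nu> v"
begin

lemma lowered_wvec:
  assumes "lowered n R v \<gamma> w"
  shows "wvec (\<nu> - \<gamma>) w"
  using assms
proof (induction rule: lowered.induct)
  case base
  have "wvec (\<nu> - 0) v" using hwv_wvec[OF hw] by simp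
  then show ?case .
next
  case (step \<gamma> w \<alpha>)
  have "wvec (\<nu> - \<gamma> + (\<lambda>k. - root_of \<alpha> k)) (act R (lower n \<alpha>) w)"
    by (rule wvec_act[OF lower_orth[OF step.hyps(2)] cartan_bracket_lower[OF _ step.hyps(2)] step.IH])
  moreover have "\<nu> - \<gamma> + (\<lambda>k. - root_of \<alpha> k) = \<nu> - (\<gamma> + root_of \<alpha>)"
    by (auto simp: fun_eq_iff)
  ultimately have "wvec (\<nu> - (\<gamma> + root_of \<alpha>)) (act R (lower n \<alpha>) w)"
    by (simp only:)
  then show ?case .
qed

lemma lowered_subset: "{w. \<exists>\<gamma>. lowered n R v \<gamma> w} \<subseteq> space R"
  using lowered_wvec by (auto simp: wvec_def)

lemma gen_lower:
  assumes "\<alpha> \<in> pos_index n" "x \<in> gen n R v"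
  shows "act R (lower n \<alpha>) x \<in> gen n R v"
proof (rule act_span[OF lower_orth[OF assms(1)] lowered_subset gen_subspace])
  fix s assume "s \<in> {w. \<exists>\<gamma>. lowered n R v \<gamma> w}"
  then obtain \<gamma> where "lowered n R v \<gamma> s" by blast
  then have "lowered n R v (\<gamma> + root_of \<alpha>) (act R (lower n \<alpha>) s)"
    using assms(1) by (rule lowered.step)
  then show "act R (lower n \<alpha>) s \<in> gen n R v"
    unfolding gen_def by (intro cfun.span_base) blast
qed (use assms(2) in \<open>simp add: gen_def\<close>)

text \<open>On v a Cartan generator acts by a scalar, a raising one by zero, and a lowering one
  stays in the span. \<open>act_expand\<close> extends this to every X.\<close>

lemma gen_act_base:
  assumes X: "X \<in> orth_alg n"
  shows "act R X v \<in> gen n R v"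
proof -
  have v: "wvec \<nu> v" "v \<in> space R" using hwv_wvec[OF hw] by (simp_all add: wvec_def)
  have "A a b v \<in> gen n R v" if "a < 2 * n" "b < 2 * n" for a b
    using that
  proof (cases rule: Fmat_cases)
    case (1 c i)
    then have "A a b v = cscale (c * complex_of_real (\<nu> i)) v"
      using v by (simp add: mat_smult wvec_def)
    then show ?thesis using cfun.subspace_scale[OF gen_subspace v_in_gen] by simp
  next
    case (2 c \<alpha>)
    then have "A a b v = 0"
      using v hwv_raise[OF hw] by (simp add: mat_smult)
    then show ?thesis using cfun.subspace_0[OF gen_subspace] by simp
  next
    case (3 c \<alpha>)
    then have "A a b v = cscale c (act R (lower n \<alpha>) v)"
      using v by (simp add: mat_smult)
    then show ?thesis using 3 cfun.subspace_scale[OF gen_subspace] gen_lower v_in_gen by simp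
  qed
  then show ?thesis
    unfolding act_expand[OF X v(2)]
    by (intro cfun.subspace_sum[OF gen_subspace] cfun.subspace_scale[OF gen_subspace]) auto
qed

text \<open>Induction on the word, for all X at once: X f w = f X w + [X, f] w, and the induction
  hypothesis covers both X and the bracket. Thus no ordered basis of the enveloping algebra
  enters.\<close>

lemma gen_act_lowered:
  assumes "lowered n R v \<gamma> w" "X \<in> orth_alg n"
  shows "act R X w \<in> gen n R v"
  using assms
proof (induction arbitrary: X rule: lowered.induct)
  case base
  then show ?case by (rule gen_act_base)
next
  case (step \<gamma> w \<alpha>)
  have l: "lower n \<alpha> \<in> orth_alg n" using step.hyps by simp
  have "act R X (act R (lower n \<alpha>) w) = act R (lower n \<alpha>) (act R X w) + act R (lie_bracket X (lower n \<alpha>)) w"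
    using lowered_subset step by (intro act_commute) auto
  moreover have "act R (lower n \<alpha>) (act R X w) \<in> gen n R v"
    using step by (intro gen_lower) auto
  moreover have "act R (lie_bracket X (lower n \<alpha>)) w \<in> gen n R v"
    using step.IH[OF orth_alg_bracket[OF step.prems l]] .
  ultimately have "act R X (act R (lower n \<alpha>) w) \<in> gen n R v"
    using cfun.subspace_add[OF gen_subspace] by (simp only:)
  then show ?case .
qed

lemma gen_is_subrep: "is_subrep n R (gen n R v)"
  unfolding is_subrep_def
proof (intro conjI ballI gen_subspace)
  show "gen n R v \<subseteq> space R"
    unfolding gen_def by (rule cfun.span_minimal[OF lowered_subset subspace])
  fix X assume X: "X \<in> orth_alg n"
  show "act R X ` gen n R v \<subseteq> gen n R v"
  proof
    fix y assume "y \<in> act R X ` gen n R v"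
    then obtain x where x: "y = act R X x" "x \<in> cfun.span {w. \<exists>\<gamma>. lowered n R v \<gamma> w}"
      by (auto simp: gen_def)
    have "act R X x \<in> gen n R v"
      using gen_act_lowered X by (intro act_span[OF X lowered_subset gen_subspace _ x(2)]) auto
    then show "y \<in> gen n R v" using x by simp
  qed
qed

lemma gen_minimal:
  assumes "is_subrep n R W" "v \<in> W"
  shows "gen n R v \<subseteq> W"
proof -
  have "w \<in> W" if "lowered n R v \<gamma> w" for \<gamma> w
    using that
  proof (induction rule: lowered.induct)
    case (step \<gamma> w \<alpha>)
    then show ?case using assms(1) lower_orth unfolding is_subrep_def by blast
  qed (rule assms(2))
  then show ?thesis
    unfolding gen_def using assms(1) by (intro cfun.span_minimal) (auto simp: is_subrep_def)
qed

text \<open>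
  The grading by the eigenvalues of \<open>rho\<close>, regarded as an element of the Cartan subalgebra,
  separates \<open>v\<close> from all the vectors obtained from it by lowering.
\<close>

definition hrho :: "('i \<Rightarrow> complex) \<Rightarrow> 'i \<Rightarrow> complex" where
  "hrho x = (\<Sum>k<n. cscale (complex_of_real (rho n k)) (act R (cartan_h n k) x))"

lemma hrho_add: "x \<in> space R \<Longrightarrow> y \<in> space R \<Longrightarrow> hrho (x + y) = hrho x + hrho y"
  unfolding hrho_def sum.distrib[symmetric]
  by (intro sum.cong refl) (simp add: act_add cfun.scale_right_distrib)

lemma hrho_scale: "x \<in> space R \<Longrightarrow> hrho (cscale c x) = cscale c (hrho x)"
  unfolding hrho_def cfun.scale_sum_right
  by (intro sum.cong refl) (simp add: act_scale mult.commute)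

lemma hrho_sum:
  assumes "\<And>k. k \<le> (K::nat) \<Longrightarrow> f k \<in> space R"
  shows "hrho (\<Sum>k\<le>K. f k) = (\<Sum>k\<le>K. hrho (f k))"
proof -
  have "cscale (complex_of_real (rho n k)) (act R (cartan_h n k) (\<Sum>l\<le>K. f l)) =
      (\<Sum>l\<le>K. cscale (complex_of_real (rho n k)) (act R (cartan_h n k) (f l)))" if "k < n" for k
    using act_sum[OF cartan_h_orth[OF that], of "{..K}" f] assms
    by (simp only: atMost_iff cfun.scale_sum_right)
  then have "hrho (\<Sum>k\<le>K. f k) =
      (\<Sum>k<n. \<Sum>l\<le>K. cscale (complex_of_real (rho n k)) (act R (cartan_h n k) (f l)))"
    unfolding hrho_def by (intro sum.cong refl) (simp only: lessThan_iff)
  also have "\<dots> = (\<Sum>l\<le>K. hrho (f l))"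
    unfolding hrho_def by (rule sum.swap)
  finally show ?thesis .
qed

lemma hrho_wvec:
  assumes "wvec \<kappa> x"
  shows "hrho x = cscale (complex_of_real (wt_inner n (rho n) \<kappa>)) x"
proof -
  have "hrho x = (\<Sum>k<n. cscale (complex_of_real (rho n k * \<kappa> k)) x)"
    unfolding hrho_def using assms by (intro sum.cong refl) (simp add: wvec_def)
  then show ?thesis
    by (simp add: wt_inner_def flip: cfun.scale_sum_left)
qed

text \<open>The value f k stands for the component of height k below the top weight.\<close>

definition graded :: "(nat \<Rightarrow> 'i \<Rightarrow> complex) \<Rightarrow> bool" where
  "graded f \<longleftrightarrow> (\<forall>k. f k \<in> space R \<and>
     hrho (f k) = cscale (complex_of_real (wt_inner n (rho n) \<nu> - real k)) (f k))"

text \<open>This does the work of the independence of eigenvectors for distinct eigenvalues. If the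
  sum is an eigenvector for the top eigenvalue, then the sum of all k f_k is zero, and a rescaling
  of the components removes the last one without changing the claim.\<close>

lemma graded_top:
  assumes "graded f" "hrho (\<Sum>k\<le>K. f k) = cscale (complex_of_real (wt_inner n (rho n) \<nu>)) (\<Sum>k\<le>K. f k)"
  shows "(\<Sum>k\<le>K. f k) = f 0"
  using assms
proof (induction K arbitrary: f)
  case 0
  have "(\<Sum>k\<le>0. f k) = f 0" by simp
  then show ?case .
next
  case (Suc K)
  let ?l = "complex_of_real (wt_inner n (rho n) \<nu>)"
  let ?m = "complex_of_nat (Suc K)"
  define x where "x = (\<Sum>k\<le>Suc K. f k)"
  \<comment> \<open>The factor vanishes at k = Suc K, so g has one component fewer, while its sum is
    \<open>?m\<close> times x.\<close>
  define g where "g k = cscale (?m - complex_of_nat k) (f k)" for k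
  have f: "f k \<in> space R" "hrho (f k) = cscale (?l - complex_of_nat k) (f k)" for k
    using Suc.prems(1) by (simp_all add: graded_def)
  have xV: "x \<in> space R" unfolding x_def by (intro cfun.subspace_sum[OF subspace] f)
  have hx: "hrho x = cscale ?l x"
    using Suc.prems(2) unfolding x_def .
  have "hrho x = (\<Sum>k\<le>Suc K. cscale (?l - complex_of_nat k) (f k))"
    unfolding x_def using f by (simp only: hrho_sum)
  also have "\<dots> = cscale ?l x - (\<Sum>k\<le>Suc K. cscale (complex_of_nat k) (f k))"
    unfolding x_def cfun.scale_left_diff_distrib sum_subtractf cfun.scale_sum_right ..
  finally have "cscale ?l x = cscale ?l x - (\<Sum>k\<le>Suc K. cscale (complex_of_nat k) (f k))"
    unfolding hx .
  then have zero: "(\<Sum>k\<le>Suc K. cscale (complex_of_nat k) (f k)) = 0"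
    by (simp only: eq_diff_eq add_cancel_left_right)
  have "(\<Sum>k\<le>K. g k) = (\<Sum>k\<le>Suc K. g k)"
    by (simp add: g_def)
  also have "\<dots> = cscale ?m x - (\<Sum>k\<le>Suc K. cscale (complex_of_nat k) (f k))"
    unfolding g_def x_def cfun.scale_left_diff_distrib sum_subtractf cfun.scale_sum_right ..
  finally have sum_g: "(\<Sum>k\<le>K. g k) = cscale ?m x"
    unfolding zero by (simp only: diff_zero)
  have "graded g"
    unfolding graded_def
  proof (intro allI conjI)
    fix k
    show "g k \<in> space R" unfolding g_def by (intro cfun.subspace_scale[OF subspace] f)
    show "hrho (g k) = cscale (complex_of_real (wt_inner n (rho n) \<nu> - real k)) (g k)"
      unfolding g_def by (simp add: hrho_scale f mult.commute)
  qed
  moreover have "hrho (\<Sum>k\<le>K. g k) = cscale ?l (\<Sum>k\<le>K. g k)"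
    unfolding sum_g hrho_scale[OF xV] hx by (simp only: cfun.scale_scale mult.commute)
  ultimately have "(\<Sum>k\<le>K. g k) = g 0" by (rule Suc.IH)
  then have "cscale ?m x = cscale ?m (f 0)"
    unfolding sum_g by (simp add: g_def)
  then have "x = f 0"
    by (subst (asm) cfun.scale_cancel_left) (simp only: of_nat_eq_0_iff nat.simps simp_thms)
  then show ?case unfolding x_def .
qed

text \<open>The point is that the component of degree 0 is a multiple of v, because a word of height
  0 is empty.\<close>

lemma gen_graded:
  assumes "x \<in> gen n R v"
  shows "\<exists>f K c. graded f \<and> (\<forall>k>K. f k = 0) \<and> f 0 = cscale c v \<and> x = (\<Sum>k\<le>K. f k)"
proof -
  let ?T = "{x. \<exists>f K c. graded f \<and> (\<forall>k>K. f k = 0) \<and> f 0 = cscale c v \<and> x = (\<Sum>k\<le>(K::nat). f k)}"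
  have h0: "hrho 0 = 0" using hrho_scale[of 0 0] cfun.subspace_0[OF subspace] by simp
  have pad: "(\<Sum>k\<le>K. f k) = (\<Sum>k\<le>K'. f k)" if "\<forall>k>K. f k = 0" "K \<le> K'"
    for f :: "nat \<Rightarrow> 'i \<Rightarrow> complex" and K K'
    using that by (intro sum.mono_neutral_left) auto
  have "cfun.subspace ?T"
  proof (rule cfun.subspaceI)
    have "graded (\<lambda>_. 0)" using h0 cfun.subspace_0[OF subspace] by (simp add: graded_def)
    moreover have "(0 :: 'i \<Rightarrow> complex) = cscale 0 v" by simp
    moreover have "(0 :: 'i \<Rightarrow> complex) = (\<Sum>k\<le>(0::nat). 0)" by simp
    ultimately show "0 \<in> ?T" by blast
  next
    fix x y assume "x \<in> ?T" "y \<in> ?T"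
    then obtain f K c g L d where
      f: "graded f" "\<forall>k>K. f k = 0" "f 0 = cscale c v" "x = (\<Sum>k\<le>K. f k)" and
      g: "graded g" "\<forall>k>L. g k = 0" "g 0 = cscale d v" "y = (\<Sum>k\<le>L. g k)"
      by blast
    have "graded (\<lambda>k. f k + g k)"
      using f(1) g(1) unfolding graded_def
      by (auto simp: hrho_add cfun.scale_right_distrib intro: cfun.subspace_add[OF subspace])
    moreover have "\<forall>k>max K L. f k + g k = 0" using f(2) g(2) by auto
    moreover have "f 0 + g 0 = cscale (c + d) v" using f(3) g(3) by (simp add: cfun.scale_left_distrib)
    moreover have "x + y = (\<Sum>k\<le>max K L. f k + g k)"
      using pad[OF f(2), of "max K L"] pad[OF g(2), of "max K L"] f(4) g(4) by (simp add: sum.distrib)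
    ultimately show "x + y \<in> ?T" by blast
  next
    fix a x assume "x \<in> ?T"
    then obtain f K c where
      f: "graded f" "\<forall>k>K. f k = 0" "f 0 = cscale c v" "x = (\<Sum>k\<le>K. f k)" by blast
    have "graded (\<lambda>k. cscale a (f k))"
      using f(1) unfolding graded_def
      by (auto simp: hrho_scale mult.commute intro: cfun.subspace_scale[OF subspace])
    moreover have "\<forall>k>K. cscale a (f k) = 0" using f(2) by auto
    moreover have "cscale a (f 0) = cscale (a * c) v" using f(3) by simp
    moreover have "cscale a x = (\<Sum>k\<le>K. cscale a (f k))" using f(4) by (simp only: cfun.scale_sum_right)
    ultimately show "cscale a x \<in> ?T" by blast
  qed
  moreover have "{w. \<exists>\<gamma>. lowered n R v \<gamma> w} \<subseteq> ?T"
  proof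
    fix w assume "w \<in> {w. \<exists>\<gamma>. lowered n R v \<gamma> w}"
    then obtain \<gamma> where \<gamma>: "lowered n R v \<gamma> w" by blast
    obtain m :: nat where m: "wt_inner n (rho n) \<gamma> = real m" "m = 0 \<longrightarrow> \<gamma> = 0 \<and> w = v"
      using lowered_height[OF \<gamma>] by blast
    define f where "f k = (if k = m then w else 0)" for k
    have w: "w \<in> space R" "hrho w = cscale (complex_of_real (wt_inner n (rho n) \<nu> - real m)) w"
      using lowered_wvec[OF \<gamma>] hrho_wvec[OF lowered_wvec[OF \<gamma>]] m(1)
      by (simp_all add: wvec_def wt_inner_diff_right)
    have "graded f" using w h0 cfun.subspace_0[OF subspace] by (simp add: graded_def f_def)
    moreover have "\<forall>k>m. f k = 0" by (simp add: f_def)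
    moreover have "f 0 = cscale (if m = 0 then 1 else 0) v" using m(2) by (simp add: f_def)
    moreover have "w = (\<Sum>k\<le>m. f k)" by (simp add: f_def)
    ultimately show "w \<in> ?T" by blast
  qed
  ultimately have "gen n R v \<subseteq> ?T"
    unfolding gen_def by (rule cfun.span_minimal[rotated])
  then show ?thesis using assms by blast
qed

text \<open>Both \<open>hwv_irreducible\<close> and the uniqueness theorem rest on this: the top
  weight space of the generated subrepresentation is a line.\<close>

lemma gen_top_weight:
  assumes "x \<in> gen n R v" "wvec \<nu> x"
  shows "\<exists>c. x = cscale c v"
proof -
  obtain f K c where f: "graded f" "f 0 = cscale c v" "x = (\<Sum>k\<le>K. f k)"
    using gen_graded[OF assms(1)] by blast
  have "(\<Sum>k\<le>K. f k) = f 0"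
    using f(1) hrho_wvec[OF assms(2)] unfolding f(3) by (rule graded_top)
  then show ?thesis using f by auto
qed

end

end

section \<open>Uniqueness of the irreducible representation with a given highest weight\<close>

lemma is_subrep_preimage:
  assumes R: "is_rep n R" and N: "is_subrep n Z N" and lin: "linear_on (space R) \<iota>"
    and equi: "\<And>X x. X \<in> orth_alg n \<Longrightarrow> x \<in> space R \<Longrightarrow> \<iota> (act R X x) = act Z X (\<iota> x)"
  shows "is_subrep n R {x \<in> space R. \<iota> x \<in> N}"
proof -
  interpret orth_rep n R by unfold_locales fact
  have add: "\<iota> (x + y) = \<iota> x + \<iota> y" if "x \<in> space R" "y \<in> space R" for x y
    using lin that by (simp add: linear_on_def)
  have scale: "\<iota> (cscale c x) = cscale c (\<iota> x)" if "x \<in> space R" for c x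
    using lin that by (simp add: linear_on_def)
  have V0: "0 \<in> space R" by (rule cfun.subspace_0[OF subspace])
  have zero: "\<iota> 0 = 0" using scale[OF V0, of 0] by simp
  show ?thesis
    unfolding is_subrep_def
  proof (intro conjI ballI cfun.subspaceI)
    fix X assume X: "X \<in> orth_alg n"
    show "act R X ` {x \<in> space R. \<iota> x \<in> N} \<subseteq> {x \<in> space R. \<iota> x \<in> N}"
      using is_subrepD(7)[OF N X] by (auto simp: equi[OF X] closed[OF X])
  qed (auto simp: V0 zero add scale is_subrepD(3,4,6)[OF N] cfun.subspace_add[OF subspace]
      cfun.subspace_scale[OF subspace])
qed

lemma is_subrep_image:
  assumes N: "is_subrep n Z N" and lin: "linear_on (space Z) \<pi>" and into: "\<pi> ` N \<subseteq> space R"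
    and equi: "\<And>X z. X \<in> orth_alg n \<Longrightarrow> z \<in> space Z \<Longrightarrow> \<pi> (act Z X z) = act R X (\<pi> z)"
  shows "is_subrep n R (\<pi> ` N)"
proof -
  have NV: "x \<in> space Z" if "x \<in> N" for x using is_subrepD(1)[OF N] that by blast
  have add: "\<pi> x + \<pi> y = \<pi> (x + y)" if "x \<in> N" "y \<in> N" for x y
    using lin NV that by (simp add: linear_on_def)
  have scale: "cscale c (\<pi> x) = \<pi> (cscale c x)" if "x \<in> N" for c x
    using lin NV that by (simp add: linear_on_def)
  have zero: "0 = \<pi> 0" using scale[OF is_subrepD(3)[OF N], of 0] by simp
  have act: "act R X (\<pi> x) = \<pi> (act Z X x)" if "X \<in> orth_alg n" "x \<in> N" for X x
    using equi NV that by simp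
  show ?thesis
    unfolding is_subrep_def
  proof (intro conjI ballI cfun.subspaceI into)
    show "0 \<in> \<pi> ` N" using is_subrepD(3)[OF N] zero by blast
    fix x y assume "x \<in> \<pi> ` N" "y \<in> \<pi> ` N"
    then obtain a b where "a \<in> N" "b \<in> N" "x = \<pi> a" "y = \<pi> b" by blast
    then show "x + y \<in> \<pi> ` N" using is_subrepD(4)[OF N] by (simp add: add)
  next
    fix c x assume "x \<in> \<pi> ` N"
    then obtain a where "a \<in> N" "x = \<pi> a" by blast
    then show "cscale c x \<in> \<pi> ` N" using is_subrepD(6)[OF N] by (simp add: scale)
  next
    fix X assume X: "X \<in> orth_alg n"
    show "act R X ` \<pi> ` N \<subseteq> \<pi> ` N"
      using is_subrepD(7)[OF N X] by (auto simp: act[OF X])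
  qed
qed

definition sum_rep :: "'i rep \<Rightarrow> 'j rep \<Rightarrow> ('i + 'j) rep" where
  "sum_rep R S = \<lparr>space = {case_sum x y | x y. x \<in> space R \<and> y \<in> space S},
     act = (\<lambda>X f. case_sum (act R X (f \<circ> Inl)) (act S X (f \<circ> Inr)))\<rparr>"

lemma case_sum_algebra:
  "case_sum x y + case_sum x' y' = case_sum (x + x') (y + y')"
  "case_sum x y - case_sum x' y' = case_sum (x - x') (y - y')"
  "cscale c (case_sum x y) = case_sum (cscale c x) (cscale c y)"
  "case_sum 0 0 = (0 :: 'i + 'j \<Rightarrow> complex)"
  by (auto simp: fun_eq_iff cscale_def split: sum.splits)

lemma case_sum_eq_iff: "case_sum x y = case_sum x' y' \<longleftrightarrow> x = x' \<and> y = y'"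
  by (metis case_sum_o_inj(1) case_sum_o_inj(2))

lemma act_sum_rep: "act (sum_rep R S) X (case_sum x y) = case_sum (act R X x) (act S X y)"
  by (simp add: sum_rep_def case_sum_o_inj)

lemma space_sum_rep: "case_sum x y \<in> space (sum_rep R S) \<longleftrightarrow> x \<in> space R \<and> y \<in> space S"
  by (auto simp: sum_rep_def case_sum_eq_iff)

lemma space_sum_repE:
  assumes "z \<in> space (sum_rep R S)"
  obtains x y where "z = case_sum x y" "x \<in> space R" "y \<in> space S"
  using assms by (auto simp: sum_rep_def)

lemma is_rep_sum_rep:
  assumes "is_rep n R" "is_rep n S"
  shows "is_rep n (sum_rep R S)"
proof -
  interpret R: orth_rep n R by unfold_locales fact
  interpret S: orth_rep n S by unfold_locales fact
  let ?Z = "sum_rep R S"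
  have "cfun.subspace (space ?Z)"
  proof (rule cfun.subspaceI)
    show "0 \<in> space ?Z"
      using cfun.subspace_0[OF R.subspace] cfun.subspace_0[OF S.subspace]
      by (simp add: space_sum_rep flip: case_sum_algebra(4))
  next
    fix x y assume "x \<in> space ?Z" "y \<in> space ?Z"
    then show "x + y \<in> space ?Z"
      by (elim space_sum_repE)
         (simp add: case_sum_algebra space_sum_rep cfun.subspace_add[OF R.subspace] cfun.subspace_add[OF S.subspace])
  next
    fix c x assume "x \<in> space ?Z"
    then show "cscale c x \<in> space ?Z"
      by (elim space_sum_repE)
         (simp add: case_sum_algebra space_sum_rep cfun.subspace_scale[OF R.subspace] cfun.subspace_scale[OF S.subspace])
  qed
  moreover have "act ?Z X ` space ?Z \<subseteq> space ?Z \<and> linear_on (space ?Z) (act ?Z X)" if X: "X \<in> orth_alg n" for X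
  proof
    show "act ?Z X ` space ?Z \<subseteq> space ?Z"
      using X by (auto elim!: space_sum_repE simp: act_sum_rep space_sum_rep R.closed S.closed)
    show "linear_on (space ?Z) (act ?Z X)"
      unfolding linear_on_def
    proof (intro conjI ballI allI)
      fix u v assume "u \<in> space ?Z" "v \<in> space ?Z"
      then show "act ?Z X (u + v) = act ?Z X u + act ?Z X v"
        using X by (elim space_sum_repE) (simp add: case_sum_algebra act_sum_rep R.act_add S.act_add)
    next
      fix c v assume "v \<in> space ?Z"
      then show "act ?Z X (cscale c v) = cscale c (act ?Z X v)"
        using X by (elim space_sum_repE) (simp add: case_sum_algebra act_sum_rep R.act_scale S.act_scale)
    qed
  qed
  moreover have "act ?Z (X + Y) v = act ?Z X v + act ?Z Y v \<and>
      act ?Z (lie_bracket X Y) v = act ?Z X (act ?Z Y v) - act ?Z Y (act ?Z X v)"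
    if "X \<in> orth_alg n" "Y \<in> orth_alg n" "v \<in> space ?Z" for X Y v
    using that by (elim space_sum_repE)
      (simp add: case_sum_algebra act_sum_rep R.mat_add S.mat_add R.act_bracket S.act_bracket)
  moreover have "act ?Z (c \<cdot>\<^sub>m X) v = cscale c (act ?Z X v)" if "X \<in> orth_alg n" "v \<in> space ?Z" for c X v
    using that by (elim space_sum_repE) (simp add: case_sum_algebra act_sum_rep R.mat_smult S.mat_smult)
  ultimately show ?thesis unfolding is_rep_def by blast
qed

text \<open>
  The subrepresentation of \<open>R \<oplus> S\<close> generated by the pair of highest weight vectors is the graph
  of an isomorphism.
\<close>

theorem irreducible_of_highest_weight_unique:
  assumes R: "irreducible_of_highest_weight n \<nu> R" and S: "irreducible_of_highest_weight n \<nu> S"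
  shows "rep_iso n R S"
proof -
  obtain v w where v: "highest_weight_vector n R \<nu> v" and w: "highest_weight_vector n S \<nu> w"
    using R S by (auto simp: irreducible_of_highest_weight_def)
  have irr: "irreducible_rep n R" "irreducible_rep n S"
    using R S by (auto simp: irreducible_of_highest_weight_def)
  interpret R: orth_rep n R using irr by unfold_locales (simp add: irreducible_rep_def)
  interpret S: orth_rep n S using irr by unfold_locales (simp add: irreducible_rep_def)
  let ?Z = "sum_rep R S" and ?z = "case_sum v w"
  interpret Z: orth_rep n ?Z
    by unfold_locales (rule is_rep_sum_rep[OF R.rep S.rep])
  have vV: "v \<in> space R" "w \<in> space S" "v \<noteq> 0" "w \<noteq> 0"
    using R.hwv_wvec[OF v] S.hwv_wvec[OF w] R.hwv_nonzero[OF v] S.hwv_nonzero[OF w]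
    by (auto simp: R.wvec_def S.wvec_def)
  have z: "highest_weight_vector n ?Z \<nu> ?z"
    unfolding highest_weight_vector_def weight_vector_def
  proof (intro conjI allI ballI impI)
    show "?z \<in> space ?Z" using vV by (simp add: space_sum_rep)
    show "?z \<noteq> 0" using vV by (simp add: case_sum_eq_iff flip: case_sum_algebra(4))
    fix i assume "i < n"
    then show "act ?Z (cartan_h n i) ?z = cscale (complex_of_real (\<nu> i)) ?z"
      using v w by (simp add: act_sum_rep case_sum_algebra highest_weight_vector_def weight_vector_def)
  next
    fix \<alpha> X assume "\<alpha> \<in> positive_roots n" "X \<in> root_space n \<alpha>"
    then have "act R X v = 0" "act S X w = 0"
      using v w unfolding highest_weight_vector_def by blast+
    then show "act ?Z X ?z = 0" by (simp add: act_sum_rep case_sum_algebra)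
  qed
  define N where "N = gen n ?Z ?z"
  have sub: "is_subrep n ?Z N" unfolding N_def by (rule Z.gen_is_subrep[OF z])
  note NV = is_subrepD(1)[OF sub] and N0 = is_subrepD(3)[OF sub] and Nadd = is_subrepD(4)[OF sub]
    and Ndiff = is_subrepD(5)[OF sub] and Nscale = is_subrepD(6)[OF sub] and Nact = is_subrepD(7)[OF sub]
  have zN: "?z \<in> N" unfolding N_def by (rule Z.v_in_gen)
  have inN: "x \<in> space R" "y \<in> space S" if "case_sum x y \<in> N" for x y
    using that NV space_sum_rep by blast+
  have top: "\<exists>c. z' = cscale c ?z" if "z' \<in> N" "Z.wvec \<nu> z'" for z'
    using Z.gen_top_weight[OF z] that unfolding N_def by blast
  \<comment> \<open>By irreducibility this kernel is zero or all of S. In the latter case it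
    contains w, so (0, w) lies in N with top weight \<nu> and is a multiple of (v, w), which is
    impossible as v and w are nonzero.\<close>
  have K1: "{y \<in> space S. case_sum 0 y \<in> N} = {0}"
  proof -
    have "is_subrep n S {y \<in> space S. case_sum 0 y \<in> N}"
      by (rule is_subrep_preimage[OF S.rep sub])
         (auto simp: linear_on_def case_sum_algebra act_sum_rep R.act_zero)
    moreover have "w \<notin> {y \<in> space S. case_sum 0 y \<in> N}"
    proof
      assume "w \<in> {y \<in> space S. case_sum 0 y \<in> N}"
      moreover have "Z.wvec \<nu> (case_sum 0 w)"
        using S.hwv_wvec[OF w] cfun.subspace_0[OF R.subspace]
        by (auto simp: Z.wvec_def S.wvec_def space_sum_rep act_sum_rep R.act_zero case_sum_algebra)
      ultimately obtain c where "case_sum 0 w = cscale c ?z" using top by blast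
      then have "cscale c v = 0" "w = cscale c w" by (simp_all add: case_sum_algebra case_sum_eq_iff)
      then show False using vV by simp
    qed
    ultimately show ?thesis
      using irr(2) vV unfolding irreducible_rep_def by blast
  qed
  have K2: "{x \<in> space R. case_sum x 0 \<in> N} = {0}"
  proof -
    have "is_subrep n R {x \<in> space R. case_sum x 0 \<in> N}"
      by (rule is_subrep_preimage[OF R.rep sub])
         (auto simp: linear_on_def case_sum_algebra act_sum_rep S.act_zero)
    moreover have "v \<notin> {x \<in> space R. case_sum x 0 \<in> N}"
    proof
      assume "v \<in> {x \<in> space R. case_sum x 0 \<in> N}"
      moreover have "Z.wvec \<nu> (case_sum v 0)"
        using R.hwv_wvec[OF v] cfun.subspace_0[OF S.subspace]
        by (auto simp: Z.wvec_def R.wvec_def space_sum_rep act_sum_rep S.act_zero case_sum_algebra)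
      ultimately obtain c where "case_sum v 0 = cscale c ?z" using top by blast
      then have "cscale c w = 0" "v = cscale c v" by (simp_all add: case_sum_algebra case_sum_eq_iff)
      then show False using vV by simp
    qed
    ultimately show ?thesis
      using irr(1) vV unfolding irreducible_rep_def by blast
  qed
  have comps: "z' \<circ> Inl \<in> space R" "z' \<circ> Inr \<in> space S" if "z' \<in> N" for z'
  proof -
    have "z' \<in> space ?Z" using NV that by blast
    then obtain x y where "z' = case_sum x y" "x \<in> space R" "y \<in> space S"
      by (rule space_sum_repE)
    then show "z' \<circ> Inl \<in> space R" "z' \<circ> Inr \<in> space S" by (simp_all add: case_sum_o_inj)
  qed
  \<comment> \<open>The image of N in R is a subrepresentation containing v, hence all of R.\<close>
  have P1: "\<exists>y. case_sum x y \<in> N" if x: "x \<in> space R" for x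
  proof -
    have "is_subrep n R ((\<lambda>z. z \<circ> Inl) ` N)"
    proof (rule is_subrep_image[OF sub])
      show "(\<lambda>z. z \<circ> Inl) ` N \<subseteq> space R" by (intro image_subsetI comps)
      show "act ?Z X z' \<circ> Inl = act R X (z' \<circ> Inl)" for X z'
        by (simp add: sum_rep_def case_sum_o_inj)
    qed (auto simp: linear_on_def fun_eq_iff cscale_def)
    moreover have "v \<in> (\<lambda>z. z \<circ> Inl) ` N" using zN by (intro image_eqI[of _ _ ?z]) auto
    ultimately have "(\<lambda>z. z \<circ> Inl) ` N = space R" using irr(1) vV unfolding irreducible_rep_def by blast
    then obtain z' where z': "z' \<in> N" "x = z' \<circ> Inl" using x by blast
    then have "z' = case_sum x (z' \<circ> Inr)" by (auto simp: fun_eq_iff split: sum.splits)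
    then show ?thesis using z'(1) by metis
  qed
  have P2: "\<exists>x. case_sum x y \<in> N" if y: "y \<in> space S" for y
  proof -
    have "is_subrep n S ((\<lambda>z. z \<circ> Inr) ` N)"
    proof (rule is_subrep_image[OF sub])
      show "(\<lambda>z. z \<circ> Inr) ` N \<subseteq> space S" by (intro image_subsetI comps)
      show "act ?Z X z' \<circ> Inr = act S X (z' \<circ> Inr)" for X z'
        by (simp add: sum_rep_def case_sum_o_inj)
    qed (auto simp: linear_on_def fun_eq_iff cscale_def)
    moreover have "w \<in> (\<lambda>z. z \<circ> Inr) ` N" using zN by (intro image_eqI[of _ _ ?z]) auto
    ultimately have "(\<lambda>z. z \<circ> Inr) ` N = space S" using irr(2) vV unfolding irreducible_rep_def by blast
    then obtain z' where z': "z' \<in> N" "y = z' \<circ> Inr" using y by blast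
    then have "z' = case_sum (z' \<circ> Inl) y" by (auto simp: fun_eq_iff split: sum.splits)
    then show ?thesis using z'(1) by metis
  qed
  have uniq: "y = y'" if "case_sum x y \<in> N" "case_sum x y' \<in> N" for x y y'
  proof -
    have "case_sum 0 (y - y') \<in> N"
      using Ndiff[OF that] by (simp add: case_sum_algebra)
    then have "y - y' \<in> {y \<in> space S. case_sum 0 y \<in> N}" using inN(2) by blast
    then show ?thesis by (simp only: K1 singleton_iff right_minus_eq)
  qed
  have uniq': "x = x'" if "case_sum x y \<in> N" "case_sum x' y \<in> N" for x x' y
  proof -
    have "case_sum (x - x') 0 \<in> N"
      using Ndiff[OF that] by (simp add: case_sum_algebra)
    then have "x - x' \<in> {x \<in> space R. case_sum x 0 \<in> N}" using inN(1) by blast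
    then show ?thesis by (simp only: K2 singleton_iff right_minus_eq)
  qed
  \<comment> \<open>N is the graph of \<phi>: \<open>P1\<close> and \<open>uniq\<close> make the
    relation total and single-valued, \<open>P2\<close> and \<open>uniq'\<close> make it
    bijective.\<close>
  define \<phi> where "\<phi> x = (SOME y. case_sum x y \<in> N)" for x
  have \<phi>: "case_sum x (\<phi> x) \<in> N" if "x \<in> space R" for x
    unfolding \<phi>_def using P1[OF that] by (rule someI_ex)
  have \<phi>_eq: "\<phi> x = y" if "case_sum x y \<in> N" for x y
    using uniq[OF \<phi>[OF inN(1)[OF that]] that] .
  have "linear_on (space R) \<phi>"
    unfolding linear_on_def
  proof (intro conjI ballI allI)
    fix x y assume "x \<in> space R" "y \<in> space R"
    from Nadd[OF \<phi>[OF this(1)] \<phi>[OF this(2)]] show "\<phi> (x + y) = \<phi> x + \<phi> y"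
      by (intro \<phi>_eq) (simp add: case_sum_algebra)
  next
    fix c x assume "x \<in> space R"
    from Nscale[OF \<phi>[OF this], of c] show "\<phi> (cscale c x) = cscale c (\<phi> x)"
      by (intro \<phi>_eq) (simp add: case_sum_algebra)
  qed
  moreover have "bij_betw \<phi> (space R) (space S)"
  proof (rule bij_betwI')
    fix x y assume "x \<in> space R" "y \<in> space R"
    then show "(\<phi> x = \<phi> y) = (x = y)" using \<phi> uniq' by metis
  next
    fix x assume "x \<in> space R"
    then show "\<phi> x \<in> space S" using \<phi> inN(2) by blast
  next
    fix y assume "y \<in> space S"
    then obtain x where "case_sum x y \<in> N" using P2[of y] by blast
    then show "\<exists>x\<in>space R. y = \<phi> x" using \<phi>_eq inN(1) by metis
  qed
  moreover have "\<phi> (act R X x) = act S X (\<phi> x)" if "X \<in> orth_alg n" "x \<in> space R" for X x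
    using Nact[OF that(1) \<phi>[OF that(2)]] by (intro \<phi>_eq) (simp add: act_sum_rep)
  ultimately show ?thesis unfolding rep_iso_def by blast
qed

text \<open>Used to move a summand of the tensor power into
  \<open>nat \<Rightarrow> complex\<close>, the space over which \<open>L_rep\<close>
  chooses.\<close>

lemma irreducible_of_highest_weight_transport:
  fixes \<theta> :: "('i \<Rightarrow> complex) \<Rightarrow> 'j \<Rightarrow> complex"
  assumes R: "irreducible_of_highest_weight n \<nu> R"
    and lin: "linear_on (space R) \<theta>" and inj: "inj_on \<theta> (space R)"
  shows "\<exists>R' :: 'j rep. irreducible_of_highest_weight n \<nu> R'"
proof -
  obtain v where v: "highest_weight_vector n R \<nu> v"
    using R by (auto simp: irreducible_of_highest_weight_def)
  have irr: "irreducible_rep n R"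
    using R by (auto simp: irreducible_of_highest_weight_def)
  interpret R: orth_rep n R using irr by unfold_locales (simp add: irreducible_rep_def)
  define R' :: "'j rep" where
    "R' = \<lparr>space = \<theta> ` space R, act = (\<lambda>X g. \<theta> (act R X (inv_into (space R) \<theta> g)))\<rparr>"
  have sp: "space R' = \<theta> ` space R" by (simp add: R'_def)
  have act: "act R' X (\<theta> x) = \<theta> (act R X x)" if "x \<in> space R" for X x
    using that inj by (simp add: R'_def)
  have add: "\<theta> (x + y) = \<theta> x + \<theta> y" if "x \<in> space R" "y \<in> space R" for x y
    using lin that by (simp add: linear_on_def)
  have scale: "\<theta> (cscale c x) = cscale c (\<theta> x)" if "x \<in> space R" for c x
    using lin that by (simp add: linear_on_def)
  have V0: "0 \<in> space R" by (rule cfun.subspace_0[OF R.subspace])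
  have zero: "\<theta> 0 = 0" using scale[OF V0, of 0] by simp
  have diff: "\<theta> (x - y) = \<theta> x - \<theta> y" if "x \<in> space R" "y \<in> space R" for x y
    using add[of "x - y" y] that cfun.subspace_diff[OF R.subspace that] by simp
  have iff0: "\<theta> x = 0 \<longleftrightarrow> x = 0" if "x \<in> space R" for x
    using inj_onD[OF inj, of x 0] that V0 zero by auto
  note cl = cfun.subspace_add[OF R.subspace] cfun.subspace_scale[OF R.subspace] R.closed
    cfun.subspace_diff[OF R.subspace]
  have "is_rep n R'"
    unfolding is_rep_def linear_on_def sp
  proof (intro conjI ballI allI cfun.subspaceI)
    show "0 \<in> \<theta> ` space R" using V0 zero by (metis imageI)
  next
    fix x y assume "x \<in> \<theta> ` space R" "y \<in> \<theta> ` space R"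
    then show "x + y \<in> \<theta> ` space R" using cl add by (force simp flip: add)
  next
    fix c x assume "x \<in> \<theta> ` space R"
    then show "cscale c x \<in> \<theta> ` space R" using cl by (force simp flip: scale)
  next
    fix X assume "X \<in> orth_alg n"
    then show "act R' X ` \<theta> ` space R \<subseteq> \<theta> ` space R" using cl by (auto simp: act)
  next
    fix X x y assume "X \<in> orth_alg n" "x \<in> \<theta> ` space R" "y \<in> \<theta> ` space R"
    then show "act R' X (x + y) = act R' X x + act R' X y"
      using cl by (auto simp: act R.act_add simp flip: add)
  next
    fix X c x assume "X \<in> orth_alg n" "x \<in> \<theta> ` space R"
    then show "act R' X (cscale c x) = cscale c (act R' X x)"
      using cl by (auto simp: act R.act_scale simp flip: scale)
  next
    fix X Y x assume "X \<in> orth_alg n" "Y \<in> orth_alg n" "x \<in> \<theta> ` space R"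
    then show "act R' (X + Y) x = act R' X x + act R' Y x"
      using cl by (auto simp: act R.mat_add simp flip: add)
  next
    fix X Y x assume "X \<in> orth_alg n" "Y \<in> orth_alg n" "x \<in> \<theta> ` space R"
    then show "act R' (lie_bracket X Y) x = act R' X (act R' Y x) - act R' Y (act R' X x)"
      using cl by (auto simp: act R.act_bracket simp flip: diff)
  next
    fix c X x assume "X \<in> orth_alg n" "x \<in> \<theta> ` space R"
    then show "act R' (c \<cdot>\<^sub>m X) x = cscale c (act R' X x)"
      using cl by (auto simp: act R.mat_smult simp flip: scale)
  qed
  moreover have "space R' \<noteq> {0}"
  proof -
    have "v \<in> space R" "v \<noteq> 0" using v by (auto simp: highest_weight_vector_def weight_vector_def)
    then have "\<theta> v \<in> space R'" "\<theta> v \<noteq> 0" using iff0 sp by auto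
    then show ?thesis by blast
  qed
  moreover have "W = {0} \<or> W = space R'" if W: "is_subrep n R' W" for W
  proof -
    let ?U = "{x \<in> space R. \<theta> x \<in> W}"
    have WV: "W \<subseteq> \<theta> ` space R" using is_subrepD(1)[OF W] unfolding sp .
    have "is_subrep n R ?U"
      by (rule is_subrep_preimage[OF R.rep W lin]) (simp add: act)
    then have U: "?U = {0} \<or> ?U = space R"
      using irr unfolding irreducible_rep_def by blast
    have WU: "W = \<theta> ` ?U" using WV by blast
    have "W = {0}" if "?U = {0}"
    proof -
      have "\<theta> ` ?U = {0}" unfolding that using zero by simp
      with WU show ?thesis by (rule trans)
    qed
    moreover have "W = space R'" if "?U = space R"
    proof -
      have "\<theta> ` ?U = space R'" unfolding that sp ..
      with WU show ?thesis by (rule trans)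
    qed
    ultimately show ?thesis using U by blast
  qed
  moreover have "highest_weight_vector n R' \<nu> (\<theta> v)"
    unfolding highest_weight_vector_def weight_vector_def
  proof (intro conjI allI ballI impI)
    have vV: "v \<in> space R" "v \<noteq> 0" using v by (auto simp: highest_weight_vector_def weight_vector_def)
    then show "\<theta> v \<in> space R'" "\<theta> v \<noteq> 0" using iff0 sp by auto
    show "act R' (cartan_h n i) (\<theta> v) = cscale (complex_of_real (\<nu> i)) (\<theta> v)" if "i < n" for i
      using v that vV by (simp add: act highest_weight_vector_def weight_vector_def scale)
    show "act R' X (\<theta> v) = 0" if "\<alpha> \<in> positive_roots n" "X \<in> root_space n \<alpha>" for \<alpha> X
    proof -
      have "act R X v = 0" using v that unfolding highest_weight_vector_def by blast
      then show ?thesis using vV zero by (simp add: act)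
    qed
  qed
  ultimately have "irreducible_of_highest_weight n \<nu> R'"
    unfolding irreducible_of_highest_weight_def irreducible_rep_def by blast
  then show ?thesis by blast
qed

section \<open>Unitary representations\<close>

text \<open>The coordinate vectors indexed by the finite set B are weight vectors and orthonormal
  for the standard Hermitian form, for which X and \<open>dagger n X\<close> are adjoint. The spinor
  representation and its tensor powers are instances. The assumption \<open>lattice\<close> supplies
  the integrality part of dominance.\<close>

locale unitary_rep = orth_rep n R for n :: nat and R :: "'i rep" +
  fixes B :: "'i set" and wt :: "'i \<Rightarrow> nat \<Rightarrow> real"
  assumes n2: "n \<ge> 2" and finB: "finite B"
    and space_eq: "space R = {f. \<forall>b. b \<notin> B \<longrightarrow> f b = 0}"
    and cartan: "\<And>i f. i < n \<Longrightarrow> f \<in> space R \<Longrightarrow>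
      act R (cartan_h n i) f = (\<lambda>b. complex_of_real (wt b i) * f b)"
    and wt_zero: "\<And>b i. b \<in> B \<Longrightarrow> i \<ge> n \<Longrightarrow> wt b i = 0"
    and lattice: "\<And>b. b \<in> B \<Longrightarrow> (\<forall>i<n. wt b i \<in> \<int>) \<or> (\<forall>i<n. wt b i - 1 / 2 \<in> \<int>)"
    and adjoint: "\<And>X f g. X \<in> orth_alg n \<Longrightarrow> f \<in> space R \<Longrightarrow> g \<in> space R \<Longrightarrow>
      (\<Sum>b\<in>B. act R X f b * cnj (g b)) = (\<Sum>b\<in>B. f b * cnj (act R (dagger n X) g b))"
begin

definition ip :: "('i \<Rightarrow> complex) \<Rightarrow> ('i \<Rightarrow> complex) \<Rightarrow> complex" where
  "ip f g = (\<Sum>b\<in>B. f b * cnj (g b))"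

definition unit_fun :: "'i \<Rightarrow> 'i \<Rightarrow> complex" where
  "unit_fun b = (\<lambda>x. if x = b then 1 else 0)"

lemma ip_add_left: "ip (f + g) h = ip f h + ip g h"
  by (simp add: ip_def distrib_right sum.distrib)

lemma ip_diff_left: "ip (f - g) h = ip f h - ip g h"
  by (simp add: ip_def left_diff_distrib sum_subtractf)

lemma ip_scale_left: "ip (cscale c f) h = c * ip f h"
  by (simp add: ip_def cscale_def sum_distrib_left mult.assoc)

lemma ip_zero_left: "ip 0 h = 0"
  by (simp add: ip_def)

lemma ip_commute: "ip g f = cnj (ip f g)"
  by (simp add: ip_def mult.commute)

lemma ip_zero_iff_commute: "ip g f = 0 \<longleftrightarrow> ip f g = 0"
  by (subst ip_commute) simp

lemma ip_add_right: "ip h (f + g) = ip h f + ip h g"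
  by (simp add: ip_def distrib_left sum.distrib)

lemma ip_scale_right: "ip h (cscale c f) = cnj c * ip h f"
  by (simp add: ip_def cscale_def sum_distrib_left mult_ac)

lemma ip_self: "ip f f = complex_of_real (\<Sum>b\<in>B. (cmod (f b))\<^sup>2)"
  by (simp add: ip_def complex_mult_cnj cmod_power2)

lemma ip_self_eq_0:
  assumes "f \<in> space R" "ip f f = 0"
  shows "f = 0"
proof
  fix b
  have "(\<Sum>b\<in>B. (cmod (f b))\<^sup>2) = 0"
    using assms(2) unfolding ip_self by (simp only: of_real_eq_0_iff)
  then have "\<forall>b\<in>B. f b = 0"
    using finB by (simp add: sum_nonneg_eq_0_iff)
  then show "f b = 0 b"
    using assms(1) by (cases "b \<in> B") (auto simp: space_eq)
qed

lemma ip_act: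
  "X \<in> orth_alg n \<Longrightarrow> f \<in> space R \<Longrightarrow> g \<in> space R \<Longrightarrow> ip (act R X f) g = ip f (act R (dagger n X) g)"
  by (simp add: ip_def adjoint)

lemma unit_fun_space: "b \<in> B \<Longrightarrow> unit_fun b \<in> space R"
  by (auto simp: space_eq unit_fun_def)

lemma ip_unit_fun: "b \<in> B \<Longrightarrow> ip f (unit_fun b) = f b"
proof -
  assume b: "b \<in> B"
  have "ip f (unit_fun b) = (\<Sum>x\<in>B. if x = b then f b else 0)"
    unfolding ip_def by (intro sum.cong refl) (simp add: unit_fun_def)
  then show ?thesis using b finB by simp
qed

lemma space_expand:
  assumes "f \<in> space R"
  shows "f = (\<Sum>b\<in>B. cscale (f b) (unit_fun b))"
proof
  fix x
  have "(\<Sum>b\<in>B. cscale (f b) (unit_fun b)) x = (\<Sum>b\<in>B. if b = x then f x else 0)"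
    unfolding sum_fun_apply by (intro sum.cong refl) (auto simp: unit_fun_def cscale_def)
  also have "\<dots> = f x"
    using assms finB by (auto simp: space_eq)
  finally show "f x = (\<Sum>b\<in>B. cscale (f b) (unit_fun b)) x" ..
qed

lemma linear_on_expand:
  fixes T :: "('i \<Rightarrow> complex) \<Rightarrow> 'j \<Rightarrow> complex"
  assumes T: "linear_on (space R) T" and f: "f \<in> space R"
  shows "T f = (\<Sum>b\<in>B. cscale (f b) (T (unit_fun b)))"
proof -
  have add: "T (u + v) = T u + T v" if "u \<in> space R" "v \<in> space R" for u v
    using T that by (simp add: linear_on_def)
  have scale: "T (cscale c u) = cscale c (T u)" if "u \<in> space R" for c u
    using T that by (simp add: linear_on_def)
  have zero: "T 0 = 0" using scale[OF cfun.subspace_0[OF subspace], of 0] by simp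
  have "T (\<Sum>b\<in>S. cscale (f b) (unit_fun b)) = (\<Sum>b\<in>S. cscale (f b) (T (unit_fun b)))"
    if "finite S" "S \<subseteq> B" for S
    using that
  proof (induction S rule: finite_induct)
    case empty
    have "T (\<Sum>b\<in>{}. cscale (f b) (unit_fun b)) = (\<Sum>b\<in>{}. cscale (f b) (T (unit_fun b)))"
      using zero by (simp only: sum.empty)
    then show ?case .
  next
    case (insert x S)
    have "T (\<Sum>b\<in>insert x S. cscale (f b) (unit_fun b)) =
        T (cscale (f x) (unit_fun x) + (\<Sum>b\<in>S. cscale (f b) (unit_fun b)))"
      using insert.hyps by (simp only: sum.insert not_False_eq_True)
    also have "\<dots> = T (cscale (f x) (unit_fun x)) + T (\<Sum>b\<in>S. cscale (f b) (unit_fun b))"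
      using insert.prems unit_fun_space
      by (intro add cfun.subspace_sum[OF subspace] cfun.subspace_scale[OF subspace]) auto
    also have "\<dots> = cscale (f x) (T (unit_fun x)) + (\<Sum>b\<in>S. cscale (f b) (T (unit_fun b)))"
      using insert.IH insert.prems unit_fun_space by (simp add: scale)
    also have "\<dots> = (\<Sum>b\<in>insert x S. cscale (f b) (T (unit_fun b)))"
      using insert.hyps by (simp only: sum.insert not_False_eq_True)
    finally show ?case .
  qed
  from this[OF finB subset_refl] show ?thesis
    using space_expand[OF f] by (simp only:)
qed

lemma space_span: "space R \<subseteq> cfun.span (unit_fun ` B)"
proof
  fix f assume "f \<in> space R"
  then have "f = (\<Sum>b\<in>B. cscale (f b) (unit_fun b))" by (rule space_expand)
  also have "\<dots> \<in> cfun.span (unit_fun ` B)"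
    by (intro cfun.span_sum cfun.span_scale cfun.span_base imageI)
  finally show "f \<in> cfun.span (unit_fun ` B)" .
qed

section \<open>Orthogonal projections onto subrepresentations\<close>

lemma finite_independent:
  assumes "cfun.independent S" "S \<subseteq> space R"
  shows "finite S \<and> card S \<le> card B"
proof -
  have "S \<subseteq> cfun.span (unit_fun ` B)"
    using assms(2) space_span by (rule subset_trans)
  then have "finite S \<and> card S \<le> card (unit_fun ` B)"
    using assms(1) finB by (intro cfun.independent_span_bound) auto
  then show ?thesis
    using card_image_le[OF finB, of unit_fun] by linarith
qed

lemma proj_span_exists:
  assumes "finite S" "S \<subseteq> space R" "f \<in> space R"
  shows "\<exists>u\<in>cfun.span S. \<forall>w\<in>cfun.span S. ip (f - u) w = 0"
  using assms
proof (induction S arbitrary: f rule: finite_induct)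
  case empty
  have "\<exists>u\<in>{0}. \<forall>w\<in>{0}. ip (f - u) w = 0"
    by (simp add: ip_zero_iff_commute[of _ 0] ip_zero_left)
  then show ?case unfolding cfun.span_empty .
next
  case (insert a S)
  have aV: "a \<in> space R" and SV: "S \<subseteq> space R" using insert.prems(1) by auto
  obtain a0 where a0: "a0 \<in> cfun.span S" "\<And>w. w \<in> cfun.span S \<Longrightarrow> ip (a - a0) w = 0"
    using insert.IH[OF SV aV] by blast
  obtain u0 where u0: "u0 \<in> cfun.span S" "\<And>w. w \<in> cfun.span S \<Longrightarrow> ip (f - u0) w = 0"
    using insert.IH[OF SV insert.prems(2)] by blast
  have spanV: "cfun.span S \<subseteq> space R" using SV subspace by (rule cfun.span_minimal)
  have "\<exists>u\<in>cfun.span (insert a S). \<forall>w\<in>cfun.span (insert a S). ip (f - u) w = 0"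
  proof (cases "a = a0")
    case True
    then have "cfun.span (insert a S) = cfun.span S"
      using a0(1) by (intro cfun.span_redundant) simp
    then show ?thesis using u0 by auto
  next
    case False
    \<comment> \<open>A Gram-Schmidt step: a is replaced by its component orthogonal to the span of
      S.\<close>
    define a1 where "a1 = a - a0"
    have a1V: "a1 \<in> space R"
      unfolding a1_def using aV a0(1) spanV by (intro cfun.subspace_diff[OF subspace]) auto
    have "a1 \<noteq> 0" using False by (simp add: a1_def)
    then have nz: "ip a1 a1 \<noteq> 0" using ip_self_eq_0[OF a1V] by blast
    define c where "c = ip (f - u0) a1 / ip a1 a1"
    define u where "u = u0 + cscale c a1"
    have span_mono: "cfun.span S \<subseteq> cfun.span (insert a S)" by (rule cfun.span_mono) blast
    have "a1 \<in> cfun.span (insert a S)"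
      unfolding a1_def by (rule cfun.span_diff[OF cfun.span_base[OF insertI1] subsetD[OF span_mono a0(1)]])
    then have uS: "u \<in> cfun.span (insert a S)"
      unfolding u_def using u0(1) span_mono by (intro cfun.span_add cfun.span_scale) auto
    have fu: "ip (f - u) w = ip (f - u0) w - c * ip a1 w" for w
      by (simp add: u_def ip_diff_left ip_add_left ip_scale_left)
    have "ip (f - u) w = 0" if "w \<in> cfun.span (insert a S)" for w
    proof -
      have "\<exists>k. w - cscale k a \<in> cfun.span (insert a S - {a})"
        by (rule cfun.span_breakdown[OF insertI1 that])
      then obtain k where k: "w - cscale k a \<in> cfun.span S"
        unfolding Diff_insert_absorb[OF insert.hyps(2)] by blast
      define s where "s = (w - cscale k a) + cscale k a0"
      have s: "s \<in> cfun.span S"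
        unfolding s_def using k a0(1) by (intro cfun.span_add cfun.span_scale)
      have "w = s + cscale k a1"
        by (simp add: s_def a1_def cfun.scale_right_diff_distrib)
      moreover have "ip (f - u) s = 0"
        unfolding fu using u0(2)[OF s] a0(2)[OF s] by (simp add: a1_def)
      moreover have "ip (f - u) a1 = 0"
        unfolding fu using nz by (simp add: c_def)
      ultimately show ?thesis by (simp add: ip_add_right ip_scale_right)
    qed
    then show ?thesis using uS by blast
  qed
  then show ?case .
qed

lemma proj_exists:
  assumes "cfun.subspace W" "W \<subseteq> space R" "f \<in> space R"
  shows "\<exists>u. u \<in> W \<and> (\<forall>w\<in>W. ip (f - u) w = 0)"
proof -
  obtain S where S: "S \<subseteq> W" "cfun.independent S" "W \<subseteq> cfun.span S"
    using cfun.maximal_independent_subset by blast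
  then have W: "cfun.span S = W"
    using cfun.span_minimal[OF S(1) assms(1)] by blast
  have "finite S" "S \<subseteq> space R"
    using finite_independent[of S] S assms(2) by auto
  then show ?thesis
    using proj_span_exists[of S f] assms(3) unfolding W by blast
qed

definition proj :: "('i \<Rightarrow> complex) set \<Rightarrow> ('i \<Rightarrow> complex) \<Rightarrow> 'i \<Rightarrow> complex" where
  "proj W f = (SOME u. u \<in> W \<and> (\<forall>w\<in>W. ip (f - u) w = 0))"

context
  fixes W assumes W: "is_subrep n R W"
begin

lemma proj_in: "f \<in> space R \<Longrightarrow> proj W f \<in> W"
  and proj_orth: "f \<in> space R \<Longrightarrow> w \<in> W \<Longrightarrow> ip (f - proj W f) w = 0"
  unfolding proj_def
  using someI_ex[OF proj_exists[OF is_subrepD(2,1)[OF W]]] by blast+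

lemma proj_eqI:
  assumes "f \<in> space R" "u \<in> W" "\<And>w. w \<in> W \<Longrightarrow> ip (f - u) w = 0"
  shows "proj W f = u"
proof -
  have d: "u - proj W f \<in> W"
    using is_subrepD(5)[OF W assms(2) proj_in[OF assms(1)]] .
  have "ip (u - proj W f) (u - proj W f) =
      ip (f - proj W f) (u - proj W f) - ip (f - u) (u - proj W f)"
    by (simp add: ip_diff_left)
  also have "\<dots> = 0" using assms(3)[OF d] proj_orth[OF assms(1) d] by simp
  finally have "u - proj W f = 0"
    using d is_subrepD(1)[OF W] by (intro ip_self_eq_0) auto
  then show ?thesis by simp
qed

lemma proj_ident: "f \<in> W \<Longrightarrow> proj W f = f"
  using is_subrepD(1)[OF W] by (intro proj_eqI) (auto simp: ip_zero_left)

lemma proj_zero_iff: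
  assumes "f \<in> space R"
  shows "proj W f = 0 \<longleftrightarrow> (\<forall>w\<in>W. ip f w = 0)"
proof
  assume "proj W f = 0"
  then show "\<forall>w\<in>W. ip f w = 0" using proj_orth[OF assms] by simp
next
  assume "\<forall>w\<in>W. ip f w = 0"
  then show "proj W f = 0"
    using is_subrepD(3)[OF W] assms by (intro proj_eqI) simp_all
qed

lemma proj_add:
  assumes "f \<in> space R" "g \<in> space R"
  shows "proj W (f + g) = proj W f + proj W g"
proof (rule proj_eqI)
  show "f + g \<in> space R" using assms by (rule cfun.subspace_add[OF subspace])
  show "proj W f + proj W g \<in> W"
    using assms by (intro is_subrepD(4)[OF W] proj_in)
  fix w assume "w \<in> W"
  then show "ip (f + g - (proj W f + proj W g)) w = 0"
    using proj_orth[OF assms(1)] proj_orth[OF assms(2)]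
    by (simp add: ip_diff_left ip_add_left)
qed

lemma proj_scale:
  assumes "f \<in> space R"
  shows "proj W (cscale c f) = cscale c (proj W f)"
proof (rule proj_eqI)
  show "cscale c f \<in> space R" using assms by (rule cfun.subspace_scale[OF subspace])
  show "cscale c (proj W f) \<in> W"
    using assms by (intro is_subrepD(6)[OF W] proj_in)
  fix w assume "w \<in> W"
  then show "ip (cscale c f - cscale c (proj W f)) w = 0"
    using proj_orth[OF assms] by (simp add: ip_diff_left ip_scale_left)
qed

text \<open>The adjoint of X is again given by an element of the algebra and so maps W to itself.
  Hence X preserves orthogonality to W, which characterises the projection.\<close>

lemma proj_act:
  assumes X: "X \<in> orth_alg n" and f: "f \<in> space R"
  shows "proj W (act R X f) = act R X (proj W f)"
proof (rule proj_eqI)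
  show "act R X f \<in> space R" using X f by (rule closed)
  show "act R X (proj W f) \<in> W"
    using X proj_in[OF f] by (rule is_subrepD(7)[OF W])
  fix w assume w: "w \<in> W"
  have pV: "proj W f \<in> space R" "w \<in> space R" using proj_in[OF f] w is_subrepD(1)[OF W] by auto
  have "ip (act R X f - act R X (proj W f)) w = ip (act R X (f - proj W f)) w"
    using act_diff[OF X f pV(1)] by simp
  also have "\<dots> = ip (f - proj W f) (act R (dagger n X) w)"
    using X pV f by (intro ip_act cfun.subspace_diff[OF subspace]) simp_all
  also have "\<dots> = 0"
    using orth_alg_dagger[OF X] w by (intro proj_orth[OF f] is_subrepD(7)[OF W])
  finally show "ip (act R X f - act R X (proj W f)) w = 0" .
qed

lemma proj_linear: "linear_on (space R) (proj W)"
  by (simp add: linear_on_def proj_add proj_scale)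

lemma proj_expand:
  assumes "f \<in> space R"
  shows "proj W f = (\<Sum>b\<in>B. cscale (f b) (proj W (unit_fun b)))"
  by (rule linear_on_expand[OF proj_linear assms])

lemma perp_is_subrep: "is_subrep n R {f \<in> space R. \<forall>w\<in>W. ip f w = 0}"
  unfolding is_subrep_def
proof (intro conjI ballI cfun.subspaceI)
  show "0 \<in> {f \<in> space R. \<forall>w\<in>W. ip f w = 0}"
    using cfun.subspace_0[OF subspace] by (simp add: ip_zero_left)
next
  fix x y assume "x \<in> {f \<in> space R. \<forall>w\<in>W. ip f w = 0}" "y \<in> {f \<in> space R. \<forall>w\<in>W. ip f w = 0}"
  then show "x + y \<in> {f \<in> space R. \<forall>w\<in>W. ip f w = 0}"
    using cfun.subspace_add[OF subspace] by (simp add: ip_add_left)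
next
  fix c x assume "x \<in> {f \<in> space R. \<forall>w\<in>W. ip f w = 0}"
  then show "cscale c x \<in> {f \<in> space R. \<forall>w\<in>W. ip f w = 0}"
    using cfun.subspace_scale[OF subspace] by (simp add: ip_scale_left)
next
  fix X assume X: "X \<in> orth_alg n"
  show "act R X ` {f \<in> space R. \<forall>w\<in>W. ip f w = 0} \<subseteq> {f \<in> space R. \<forall>w\<in>W. ip f w = 0}"
  proof (rule image_subsetI)
    fix f assume f: "f \<in> {f \<in> space R. \<forall>w\<in>W. ip f w = 0}"
    have "ip (act R X f) w = 0" if "w \<in> W" for w
    proof -
      have "w \<in> space R" using that is_subrepD(1)[OF W] by blast
      then have "ip (act R X f) w = ip f (act R (dagger n X) w)"
        using X f by (intro ip_act) simp_all
      then show ?thesis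
        using f is_subrepD(7)[OF W orth_alg_dagger[OF X] that] by simp
    qed
    then show "act R X f \<in> {f \<in> space R. \<forall>w\<in>W. ip f w = 0}"
      using closed[OF X] f by simp
  qed
qed auto

end

section \<open>Highest weight vectors and complete reducibility\<close>

lemma wvec_iff: "wvec \<nu> f \<longleftrightarrow> f \<in> space R \<and> (\<forall>b. f b \<noteq> 0 \<longrightarrow> (\<forall>k<n. wt b k = \<nu> k))"
proof (cases "f \<in> space R")
  case True
  have "act R (cartan_h n k) f = cscale (complex_of_real (\<nu> k)) f \<longleftrightarrow>
      (\<forall>b. f b \<noteq> 0 \<longrightarrow> wt b k = \<nu> k)" if "k < n" for k
    by (simp add: cartan[OF that True] cscale_def fun_eq_iff) blast
  then show ?thesis using True unfolding wvec_def by blast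
qed (simp add: wvec_def)

lemma wvec_unit_fun: "b \<in> B \<Longrightarrow> wvec (wt b) (unit_fun b)"
  using unit_fun_space by (auto simp: wvec_iff unit_fun_def)

lemma wvec_proj:
  assumes "is_subrep n R W" "wvec \<nu> f"
  shows "wvec \<nu> (proj W f)"
proof -
  have f: "f \<in> space R" using assms(2) by (simp add: wvec_def)
  have "act R (cartan_h n k) (proj W f) = cscale (complex_of_real (\<nu> k)) (proj W f)" if "k < n" for k
    using proj_act[OF assms(1) cartan_h_orth[OF that] f] proj_scale[OF assms(1) f] assms(2) that
    by (simp add: wvec_def)
  moreover have "proj W f \<in> space R"
    using proj_in[OF assms(1) f] is_subrepD(1)[OF assms(1)] by blast
  ultimately show ?thesis by (simp add: wvec_def)
qed

text \<open>Among the coordinate vectors with nonzero projection to W, take one of maximal height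
  and project it. A positive root vector moves it to coordinates of strictly larger height, all of
  whose projections vanish.\<close>

lemma hwv_exists:
  assumes W: "is_subrep n R W" and "W \<noteq> {0}"
  shows "\<exists>b\<in>B. \<exists>v\<in>W. highest_weight_vector n R (wt b) v"
proof -
  let ?C = "{b \<in> B. proj W (unit_fun b) \<noteq> 0}"
  obtain w where w: "w \<in> W" "w \<noteq> 0" using assms is_subrepD(3)[OF W] by blast
  have "?C \<noteq> {}"
  proof
    assume "?C = {}"
    then have "(\<Sum>b\<in>B. cscale (w b) (proj W (unit_fun b))) = 0"
      by (intro sum.neutral) auto
    then have "proj W w = 0"
      using proj_expand[OF W, of w] w is_subrepD(1)[OF W] by auto
    then show False using w proj_ident[OF W] by simp
  qed
  define h where "h b = wt_inner n (rho n) (wt b)" for b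
  have fin: "finite (h ` ?C)" "h ` ?C \<noteq> {}" using finB \<open>?C \<noteq> {}\<close> by auto
  have "Max (h ` ?C) \<in> h ` ?C" by (rule Max_in[OF fin])
  then obtain b where b: "Max (h ` ?C) = h b" "b \<in> ?C" by (rule imageE)
  have max: "h a \<le> h b" if "a \<in> ?C" for a
    unfolding b(1)[symmetric] using fin(1) that by (intro Max_ge imageI)
  define v where "v = proj W (unit_fun b)"
  have bB: "b \<in> B" and v0: "v \<noteq> 0" using b by (auto simp: v_def)
  have vec: "wvec (wt b) v"
    unfolding v_def by (rule wvec_proj[OF W wvec_unit_fun[OF bB]])
  have "act R X v = 0" if \<beta>: "\<beta> \<in> positive_roots n" and X: "X \<in> root_space n \<beta>" for \<beta> X
  proof -
    obtain \<alpha> where \<alpha>: "\<alpha> \<in> pos_index n" "\<beta> = root_of \<alpha>" using \<beta> by (rule positive_roots_cases)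
    have Xo: "X \<in> orth_alg n" using X by (simp add: root_space_def)
    define g where "g = act R X (unit_fun b)"
    have g: "wvec (wt b + \<beta>) g"
      unfolding g_def using X by (intro wvec_act[OF Xo _ wvec_unit_fun[OF bB]]) (simp add: root_space_def)
    have gV: "g \<in> space R" using g by (simp add: wvec_def)
    have "cscale (g a) (proj W (unit_fun a)) = 0" if a: "a \<in> B" for a
    proof (cases "g a = 0")
      case False
      then have "wt a k = (wt b + \<beta>) k" if "k < n" for k using g that by (auto simp: wvec_iff)
      then have "h a = wt_inner n (rho n) (wt b + \<beta>)"
        unfolding h_def wt_inner_def by (intro sum.cong) auto
      also have "\<dots> > h b"
        using wt_inner_rho_root_pos[OF \<alpha>(1)] unfolding h_def \<alpha>(2) wt_inner_add_right by fastforce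
      finally have "a \<notin> ?C" using max[of a] by auto
      then show ?thesis using a by simp
    qed simp
    then have "proj W g = 0"
      unfolding proj_expand[OF W gV] by (intro sum.neutral) blast
    then show ?thesis
      using proj_act[OF W Xo unit_fun_space[OF bB]] by (simp add: v_def g_def)
  qed
  then have "highest_weight_vector n R (wt b) v"
    using vec v0 unfolding highest_weight_vector_def weight_vector_def wvec_def by blast
  moreover have "v \<in> W" unfolding v_def by (rule proj_in[OF W unit_fun_space[OF bB]])
  ultimately show ?thesis using bB by blast
qed

text \<open>The adjoint of a lowering operator is a raising operator, which kills v'. So v' is
  orthogonal to everything generated by v, and the orthogonal complement, being a subrepresentation,
  then contains everything generated by v'.\<close>

lemma gen_orth:
  assumes v: "highest_weight_vector n R \<nu> v" and v': "highest_weight_vector n R \<nu>' v'"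
    and "ip v v' = 0" and x: "x \<in> gen n R v" and y: "y \<in> gen n R v'"
  shows "ip x y = 0"
proof -
  have vV: "v \<in> space R" "v' \<in> space R"
    using hwv_wvec[OF v] hwv_wvec[OF v'] by (simp_all add: wvec_def)
  have low: "ip w v' = 0" if "lowered n R v \<gamma> w" for \<gamma> w
    using that
  proof cases
    case base
    then show ?thesis using assms(3) by simp
  next
    case (step \<gamma>' w' \<alpha>)
    have "w' \<in> space R" using lowered_wvec[OF v step(3)] by (simp add: wvec_def)
    then have "ip w v' = ip w' (act R (raise n \<alpha>) v')"
      unfolding step(2) using step(4) vV dagger_lower[OF step(4)] by (subst ip_act) simp_all
    also have "\<dots> = 0"
      using hwv_raise[OF v' step(4)] by (simp add: ip_zero_iff_commute[of _ 0] ip_zero_left)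
    finally show ?thesis .
  qed
  have "cfun.subspace {w. ip w v' = 0}"
    by (rule cfun.subspaceI) (auto simp: ip_zero_left ip_add_left ip_scale_left)
  then have "gen n R v \<subseteq> {w. ip w v' = 0}"
    unfolding gen_def using low by (intro cfun.span_minimal) auto
  then have "v' \<in> {f \<in> space R. \<forall>w\<in>gen n R v. ip f w = 0}"
    using vV by (auto simp: ip_zero_iff_commute[of v'])
  then have "gen n R v' \<subseteq> {f \<in> space R. \<forall>w\<in>gen n R v. ip f w = 0}"
    by (rule gen_minimal[OF v' perp_is_subrep[OF gen_is_subrep[OF v]]])
  then have "ip y x = 0" using x y by blast
  then show ?thesis using ip_zero_iff_commute by blast
qed

text \<open>Requiring the weights to be of the form \<open>wt b\<close> keeps them in the weight
  lattice, so that \<open>hwv_dominant\<close> applies.\<close>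

definition hw_family :: "('i \<Rightarrow> complex) set \<Rightarrow> bool" where
  "hw_family Q \<longleftrightarrow> (\<forall>v\<in>Q. \<exists>b\<in>B. highest_weight_vector n R (wt b) v) \<and>
     (\<forall>v\<in>Q. \<forall>w\<in>Q. v \<noteq> w \<longrightarrow> ip v w = 0)"

lemma hw_family_finite:
  assumes "hw_family Q"
  shows "finite Q \<and> card Q \<le> card B"
proof (rule finite_independent)
  have hw: "v \<in> space R \<and> v \<noteq> 0" if "v \<in> Q" for v
  proof -
    obtain b where "highest_weight_vector n R (wt b) v"
      using assms \<open>v \<in> Q\<close> unfolding hw_family_def by blast
    then show ?thesis using hwv_wvec hwv_nonzero by (simp add: wvec_def)
  qed
  then show "Q \<subseteq> space R" by blast
  show "cfun.independent Q"
    unfolding cfun.dependent_def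
  proof
    assume "\<exists>a\<in>Q. a \<in> cfun.span (Q - {a})"
    then obtain a where a: "a \<in> Q" "a \<in> cfun.span (Q - {a})" by blast
    have "cfun.subspace {w. ip w a = 0}"
      by (rule cfun.subspaceI) (auto simp: ip_zero_left ip_add_left ip_scale_left)
    moreover have "Q - {a} \<subseteq> {w. ip w a = 0}"
      using assms a(1) unfolding hw_family_def by blast
    ultimately have "cfun.span (Q - {a}) \<subseteq> {w. ip w a = 0}"
      by (rule cfun.span_minimal[rotated])
    then have "ip a a = 0" using a(2) by blast
    then show False using ip_self_eq_0 hw[OF a(1)] by blast
  qed
qed

text \<open>Take an orthogonal family of maximal size. The orthogonal complement of all that it
  generates is a subrepresentation; were it nonzero, it would contain one more highest weight
  vector.\<close>

lemma maximal_hw_family: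
  obtains Q where "hw_family Q" "finite Q"
    "\<And>f. f \<in> space R \<Longrightarrow> f = (\<Sum>v\<in>Q. proj (gen n R v) f)"
proof -
  have "hw_family {}" by (simp add: hw_family_def)
  moreover have "\<forall>Q. hw_family Q \<longrightarrow> card Q < Suc (card B)"
    using hw_family_finite by (simp add: less_Suc_eq_le)
  ultimately obtain Q where Q: "hw_family Q" and max: "\<And>Q'. hw_family Q' \<Longrightarrow> card Q' \<le> card Q"
    using ex_has_greatest_nat[of hw_family "{}" card "Suc (card B)"] by blast
  have fin: "finite Q" using hw_family_finite[OF Q] by blast
  have hwQ: "\<exists>b\<in>B. highest_weight_vector n R (wt b) v" if "v \<in> Q" for v
    using Q that unfolding hw_family_def by blast
  have sub: "is_subrep n R (gen n R v)" if "v \<in> Q" for v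
    using hwQ[OF that] gen_is_subrep by blast
  let ?U = "{f \<in> space R. \<forall>v\<in>Q. \<forall>w\<in>gen n R v. ip f w = 0}"
  have U: "is_subrep n R ?U"
    unfolding is_subrep_def
  proof (intro conjI ballI cfun.subspaceI)
    fix X assume X: "X \<in> orth_alg n"
    show "act R X ` ?U \<subseteq> ?U"
    proof (rule image_subsetI)
      fix f assume f: "f \<in> ?U"
      have "act R X f \<in> {f \<in> space R. \<forall>w\<in>gen n R v. ip f w = 0}" if "v \<in> Q" for v
        using f that by (intro is_subrepD(7)[OF perp_is_subrep[OF sub[OF that]] X]) simp
      then show "act R X f \<in> ?U" using closed[OF X] f by simp
    qed
  qed (auto simp: ip_zero_left ip_add_left ip_scale_left cfun.subspace_0[OF subspace]
         cfun.subspace_add[OF subspace] cfun.subspace_scale[OF subspace])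
  have U0: "?U = {0}"
  proof (rule ccontr)
    assume "?U \<noteq> {0}"
    then obtain b v where bv: "b \<in> B" "v \<in> ?U" "highest_weight_vector n R (wt b) v"
      using hwv_exists[OF U] by blast
    have orth: "ip v w = 0" if "w \<in> Q" for w
      using bv(2) that v_in_gen[of w] by blast
    have "v \<notin> Q"
    proof
      assume "v \<in> Q"
      then have "ip v v = 0" by (rule orth)
      then show False using ip_self_eq_0 bv(2) hwv_nonzero[OF bv(3)] by blast
    qed
    have orth': "ip w v = 0" if "w \<in> Q" for w
      using orth[OF that] ip_zero_iff_commute by blast
    have "hw_family (insert v Q)"
      using Q bv(1,3) orth orth' unfolding hw_family_def by auto
    then have "card (insert v Q) \<le> card Q" by (rule max)
    then show False using \<open>v \<notin> Q\<close> fin by simp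
  qed
  have "f = (\<Sum>v\<in>Q. proj (gen n R v) f)" if f: "f \<in> space R" for f
  proof -
    have pV: "proj (gen n R v) f \<in> space R" if "v \<in> Q" for v
      using proj_in[OF sub[OF that] f] is_subrepD(1)[OF sub[OF that]] by blast
    have "ip (f - (\<Sum>v\<in>Q. proj (gen n R v) f)) w = 0" if v: "v \<in> Q" and w: "w \<in> gen n R v" for v w
    proof -
      have "ip (proj (gen n R v') f) w = 0" if "v' \<in> Q - {v}" for v'
      proof -
        have v'Q: "v' \<in> Q" "ip v' v = 0" using Q v that unfolding hw_family_def by auto
        obtain b b' where "highest_weight_vector n R (wt b) v" "highest_weight_vector n R (wt b') v'"
          using hwQ[OF v] hwQ[OF v'Q(1)] by blast
        then show ?thesis
          using gen_orth v'Q(2) proj_in[OF sub[OF v'Q(1)] f] w by blast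
      qed
      then have "ip (\<Sum>v'\<in>Q - {v}. proj (gen n R v') f) w = 0"
        unfolding ip_def sum_fun_apply sum_distrib_right
        by (subst sum.swap) (simp add: sum.neutral)
      moreover have "(\<Sum>v\<in>Q. proj (gen n R v) f) = proj (gen n R v) f + (\<Sum>v'\<in>Q - {v}. proj (gen n R v') f)"
        using fin v by (rule sum.remove)
      ultimately show ?thesis
        using proj_orth[OF sub[OF v] f w] by (simp add: ip_diff_left ip_add_left)
    qed
    moreover have "f - (\<Sum>v\<in>Q. proj (gen n R v) f) \<in> space R"
      using f pV by (intro cfun.subspace_diff[OF subspace] cfun.subspace_sum[OF subspace])
    ultimately have "f - (\<Sum>v\<in>Q. proj (gen n R v) f) \<in> ?U" by simp
    then show ?thesis unfolding U0 by simp
  qed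
  with Q fin show ?thesis by (rule that)
qed

text \<open>For a subrepresentation W of the generated one, the projection of v to W has weight
  \<nu> and hence equals c v. If c is nonzero, v lies in W. If c = 0, then v and all that it
  generates are orthogonal to W, so W is zero.\<close>

lemma hwv_irreducible:
  assumes v: "highest_weight_vector n R \<nu> v"
  shows "irreducible_of_highest_weight n \<nu> (subrep R (gen n R v))"
proof -
  let ?G = "gen n R v"
  have G: "is_subrep n R ?G" by (rule gen_is_subrep[OF v])
  have vV: "v \<in> space R" "wvec \<nu> v" "v \<noteq> 0"
    using hwv_wvec[OF v] hwv_nonzero[OF v] by (simp_all add: wvec_def)
  have "W = {0} \<or> W = ?G" if "is_subrep n (subrep R ?G) W" for W
  proof -
    have W: "is_subrep n R W" and WG: "W \<subseteq> ?G"
      using that is_subrepD(1)[OF G] by (auto simp: is_subrep_def)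
    have "proj W v \<in> ?G" using proj_in[OF W vV(1)] WG by blast
    then obtain c where c: "proj W v = cscale c v"
      using gen_top_weight[OF v _ wvec_proj[OF W vV(2)]] by blast
    show ?thesis
    proof (cases "c = 0")
      case True
      then have "v \<in> {f \<in> space R. \<forall>w\<in>W. ip f w = 0}"
        using c proj_zero_iff[OF W vV(1)] vV(1) by simp
      then have "?G \<subseteq> {f \<in> space R. \<forall>w\<in>W. ip f w = 0}"
        by (rule gen_minimal[OF v perp_is_subrep[OF W]])
      then have "w = 0" if "w \<in> W" for w
        using that WG by (intro ip_self_eq_0) auto
      then show ?thesis using is_subrepD(3)[OF W] by blast
    next
      case False
      then have "v = cscale (1 / c) (proj W v)" by (simp add: c)
      then have "v \<in> W" using is_subrepD(6)[OF W proj_in[OF W vV(1)], of "1 / c"] by simp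
      then show ?thesis using gen_minimal[OF v W] WG by blast
    qed
  qed
  moreover have "?G \<noteq> {0}" using v_in_gen[of v] vV(3) by blast
  moreover have "highest_weight_vector n (subrep R ?G) \<nu> v"
    using v v_in_gen[of v] unfolding highest_weight_vector_def weight_vector_def by simp
  ultimately show ?thesis
    unfolding irreducible_of_highest_weight_def irreducible_rep_def
    using is_rep_subrep[OF rep G] by (auto simp only: subrep_simps)
qed

text \<open>The identity |f_\<alpha> v|^2 = (\<nu>, \<alpha>) |v|^2 forces (\<nu>, \<alpha>) to be
  nonnegative for each positive root, and the simple roots give the dominance inequalities.\<close>

lemma hwv_dominant:
  assumes v: "highest_weight_vector n R (wt b) v" and b: "b \<in> B"
  shows "wt b \<in> dominant_weights n"
proof -
  let ?\<nu> = "wt b"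
  have vec: "wvec ?\<nu> v" "v \<noteq> 0" "v \<in> space R"
    using hwv_wvec[OF v] hwv_nonzero[OF v] by (simp_all add: wvec_def)
  have nonneg: "wt_inner n ?\<nu> (root_of \<alpha>) \<ge> 0" if \<alpha>: "\<alpha> \<in> pos_index n" for \<alpha>
  proof -
    have lV: "act R (lower n \<alpha>) v \<in> space R" using \<alpha> vec by (intro closed) simp_all
    have "dagger n (raise n \<alpha>) = lower n \<alpha>"
      using \<alpha> by (simp add: raise_def lower_def dagger_Fmat pos_index_idx)
    then have "ip (act R (lower n \<alpha>) v) (act R (lower n \<alpha>) v) =
        ip (act R (raise n \<alpha>) (act R (lower n \<alpha>) v)) v"
      using \<alpha> lV vec by (subst ip_act[of "raise n \<alpha>"]) simp_all
    also have "act R (raise n \<alpha>) (act R (lower n \<alpha>) v) =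
        cscale (complex_of_real (wt_inner n ?\<nu> (root_of \<alpha>))) v"
      using raise_lower_commute[OF vec(1) \<alpha>] hwv_raise[OF v \<alpha>] act_zero[OF lower_orth[OF \<alpha>]] by simp
    finally have eq: "ip (act R (lower n \<alpha>) v) (act R (lower n \<alpha>) v) =
        complex_of_real (wt_inner n ?\<nu> (root_of \<alpha>)) * ip v v"
      by (simp add: ip_scale_left)
    define p where "p = (\<Sum>b\<in>B. (cmod (v b))\<^sup>2)"
    define q where "q = (\<Sum>b\<in>B. (cmod (act R (lower n \<alpha>) v b))\<^sup>2)"
    have "complex_of_real q = complex_of_real (wt_inner n ?\<nu> (root_of \<alpha>) * p)"
      using eq unfolding ip_self p_def q_def by simp
    then have "q = wt_inner n ?\<nu> (root_of \<alpha>) * p" by (simp only: of_real_eq_iff)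
    moreover have "q \<ge> 0" "p \<ge> 0" by (simp_all add: p_def q_def sum_nonneg)
    moreover have "p \<noteq> 0"
    proof
      assume "p = 0"
      then have "ip v v = 0" unfolding ip_self p_def[symmetric] by simp
      then show False using ip_self_eq_0[OF vec(3)] vec(2) by blast
    qed
    ultimately show ?thesis by (metis less_eq_real_def mult_neg_pos not_le)
  qed
  have mem: "((i, j), s) \<in> pos_index n" if "i < j" "j < n" for i j s
    using that by (simp add: pos_index_def root_pairs_def)
  have "?\<nu> i \<ge> ?\<nu> (i + 1)" if "i + 1 < n - 1" for i
    using nonneg[OF mem[of i "i + 1" False]] wt_inner_root[of i "i + 1" n ?\<nu> False] that by simp
  moreover have "?\<nu> (n - 2) \<ge> \<bar>?\<nu> (n - 1)\<bar>"
  proof -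
    have lt: "n - 2 < n - 1" "n - 1 < n" using n2 by linarith+
    show ?thesis
      using nonneg[OF mem[OF lt, of False]] nonneg[OF mem[OF lt, of True]]
      unfolding wt_inner_root[OF lt] by simp
  qed
  ultimately show ?thesis
    using wt_zero[OF b] lattice[OF b] by (simp add: dominant_weights_def)
qed

end

section \<open>Multiplicities\<close>

lemma sum_Pow_remove:
  fixes f :: "'a set \<Rightarrow> 'b::comm_monoid_add"
  assumes "finite A" "a \<in> A"
  shows "(\<Sum>S\<in>Pow A. f S) = (\<Sum>S\<in>Pow (A - {a}). f S + f (insert a S))"
proof -
  have "Pow A = Pow (A - {a}) \<union> insert a ` Pow (A - {a})"
    using Pow_insert[of a "A - {a}"] assms(2) by (simp add: insert_absorb)
  moreover have "Pow (A - {a}) \<inter> insert a ` Pow (A - {a}) = {}" by blast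
  moreover have "inj_on (insert a) (Pow (A - {a}))"
    by (rule inj_onI) (blast dest: insert_ident[THEN iffD1, rotated 2])
  ultimately show ?thesis
    using assms(1) by (simp add: sum.union_disjoint sum.reindex sum.distrib)
qed

text \<open>Pair each S not containing \<alpha> with its union with {\<alpha>}. Their signs are
  opposite, so the recurrence turns the difference of two values of t into a single value of
  m.\<close>

lemma alternating_recursion:
  fixes m t :: "(nat \<Rightarrow> real) \<Rightarrow> complex"
  assumes \<alpha>: "\<alpha> \<in> pos_index n"
    and rec: "\<And>\<kappa>. t \<kappa> = t (\<kappa> + root_of \<alpha>) +
      of_real (wt_inner n (\<kappa> + root_of \<alpha>) (root_of \<alpha>)) * m (\<kappa> + root_of \<alpha>)"
  shows "(\<Sum>S\<in>Pow (pos_index n). (-1) ^ card S * t (\<kappa> + root_sum S)) =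
    - (\<Sum>S\<in>Pow (pos_index n). if \<alpha> \<in> S then
        (-1) ^ card S * (of_real (wt_inner n (\<kappa> + root_sum S) (root_of \<alpha>)) * m (\<kappa> + root_sum S)) else 0)"
  unfolding sum_Pow_remove[OF finite_pos_index \<alpha>] sum_negf[symmetric]
proof (intro sum.cong refl)
  fix S assume S: "S \<in> Pow (pos_index n - {\<alpha>})"
  then have "\<alpha> \<notin> S" "finite S" using finite_subset[OF _ finite_pos_index[of n]] by auto
  then have "root_sum (insert \<alpha> S) = root_sum S + root_of \<alpha>" "card (insert \<alpha> S) = Suc (card S)"
    by (simp_all add: root_sum_def add.commute)
  moreover have "\<kappa> + (root_sum S + root_of \<alpha>) = (\<kappa> + root_sum S) + root_of \<alpha>" by (simp only: add.assoc)
  ultimately show "(-1) ^ card S * t (\<kappa> + root_sum S) +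
      (-1) ^ card (insert \<alpha> S) * t (\<kappa> + root_sum (insert \<alpha> S)) =
    - ((if \<alpha> \<in> S then (-1) ^ card S * (of_real (wt_inner n (\<kappa> + root_sum S) (root_of \<alpha>)) * m (\<kappa> + root_sum S)) else 0) +
      (if \<alpha> \<in> insert \<alpha> S then (-1) ^ card (insert \<alpha> S) *
        (of_real (wt_inner n (\<kappa> + root_sum (insert \<alpha> S)) (root_of \<alpha>)) * m (\<kappa> + root_sum (insert \<alpha> S))) else 0))"
    using rec[of "\<kappa> + root_sum S"] \<open>\<alpha> \<notin> S\<close> by (simp only: if_False if_True insertI1 power_Suc) (simp add: algebra_simps)
qed

text \<open>
  An analogue of Freudenthal's formula: \<open>m\<close> plays the role of the weight multiplicities and
  \<open>t \<alpha>\<close> that of the traces of \<open>f_\<alpha> e_\<alpha>\<close> on the weight spaces.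
\<close>

lemma alternating_sum_casimir:
  fixes m :: "(nat \<Rightarrow> real) \<Rightarrow> complex"
  assumes rec: "\<And>\<alpha> \<kappa>. \<alpha> \<in> pos_index n \<Longrightarrow> t \<alpha> \<kappa> = t \<alpha> (\<kappa> + root_of \<alpha>) +
      of_real (wt_inner n (\<kappa> + root_of \<alpha>) (root_of \<alpha>)) * m (\<kappa> + root_of \<alpha>)"
    and cas: "\<And>\<kappa>. of_real (2 * wt_inner n \<nu> \<nu> + 4 * wt_inner n (rho n) \<nu>) * m \<kappa> =
      of_real (2 * wt_inner n \<kappa> \<kappa> + 4 * wt_inner n (rho n) \<kappa>) * m \<kappa> + 4 * (\<Sum>\<alpha>\<in>pos_index n. t \<alpha> \<kappa>)"
  shows "of_real (wt_inner n (\<nu> + rho n) (\<nu> + rho n) - wt_inner n (\<kappa> + rho n) (\<kappa> + rho n)) *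
    (\<Sum>S\<in>Pow (pos_index n). (-1) ^ card S * m (\<kappa> + root_sum S)) = 0"
proof -
  let ?P = "Pow (pos_index n)"
  let ?N = "\<lambda>x. wt_inner n x x"
  let ?D = "?N (\<nu> + rho n) - ?N (\<kappa> + rho n)"
  define x where "x S = \<kappa> + root_sum S" for S
  have N: "?N (a + rho n) = ?N a + 2 * wt_inner n (rho n) a + ?N (rho n)" for a
    by (simp add: wt_inner_add_left wt_inner_add_right wt_inner_commute[of n a "rho n"])
  \<comment> \<open>Half of the Casimir identity after completing squares: (\<nu>, \<nu>) + 2
    (\<rho>, \<nu>) = |\<nu> + \<rho>|^2 - |\<rho>|^2, and likewise for y. The same multiple of
    \<open>m y\<close> is then subtracted on both sides to bring in |\<kappa> + \<rho>|^2.\<close>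
  have cas': "of_real ?D * m y = of_real (?N (y + rho n) - ?N (\<kappa> + rho n)) * m y + 2 * (\<Sum>\<alpha>\<in>pos_index n. t \<alpha> y)" for y
  proof -
    have "2 * (of_real (?N (\<nu> + rho n) - ?N (rho n)) * m y) =
        2 * (of_real (?N (y + rho n) - ?N (rho n)) * m y + 2 * (\<Sum>\<alpha>\<in>pos_index n. t \<alpha> y))"
      using cas[of y] unfolding N by (simp add: algebra_simps)
    then have "of_real (?N (\<nu> + rho n) - ?N (rho n)) * m y =
        of_real (?N (y + rho n) - ?N (rho n)) * m y + 2 * (\<Sum>\<alpha>\<in>pos_index n. t \<alpha> y)"
      by (simp only: mult_cancel_left) simp
    then show ?thesis by (simp only: of_real_diff left_diff_distrib) (simp add: algebra_simps)
  qed
  have "of_real ?D * (\<Sum>S\<in>?P. (-1) ^ card S * m (x S)) =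
      (\<Sum>S\<in>?P. (-1) ^ card S * (of_real (?N (x S + rho n) - ?N (\<kappa> + rho n)) * m (x S))) +
      2 * (\<Sum>S\<in>?P. \<Sum>\<alpha>\<in>pos_index n. (-1) ^ card S * t \<alpha> (x S))"
    unfolding sum_distrib_left sum.distrib[symmetric]
  proof (intro sum.cong refl)
    fix S
    have "of_real ?D * ((-1) ^ card S * m (x S)) = (-1) ^ card S * (of_real ?D * m (x S))"
      by (simp only: mult.left_commute)
    also have "\<dots> = (-1) ^ card S * (of_real (?N (x S + rho n) - ?N (\<kappa> + rho n)) * m (x S)) +
        (\<Sum>\<alpha>\<in>pos_index n. 2 * ((-1) ^ card S * t \<alpha> (x S)))"
      unfolding cas' by (simp only: distrib_left sum_distrib_left mult.left_commute)
    finally show "of_real ?D * ((-1) ^ card S * m (x S)) =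
        (-1) ^ card S * (of_real (?N (x S + rho n) - ?N (\<kappa> + rho n)) * m (x S)) +
        (\<Sum>\<alpha>\<in>pos_index n. 2 * ((-1) ^ card S * t \<alpha> (x S)))" .
  qed
  also have "(\<Sum>S\<in>?P. \<Sum>\<alpha>\<in>pos_index n. (-1) ^ card S * t \<alpha> (x S)) =
      (\<Sum>\<alpha>\<in>pos_index n. \<Sum>S\<in>?P. (-1) ^ card S * t \<alpha> (x S))"
    by (rule sum.swap)
  also have "\<dots> = (\<Sum>\<alpha>\<in>pos_index n. - (\<Sum>S\<in>?P. if \<alpha> \<in> S then
        (-1) ^ card S * (of_real (wt_inner n (x S) (root_of \<alpha>)) * m (x S)) else 0))"
    unfolding x_def by (intro sum.cong refl alternating_recursion rec)
  also have "\<dots> = - (\<Sum>S\<in>?P. \<Sum>\<alpha>\<in>pos_index n. if \<alpha> \<in> S then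
        (-1) ^ card S * (of_real (wt_inner n (x S) (root_of \<alpha>)) * m (x S)) else 0)"
    unfolding sum_negf by (subst sum.swap) (rule refl)
  also have "\<dots> = - (\<Sum>S\<in>?P. (-1) ^ card S * (of_real (wt_inner n (x S) (root_sum S)) * m (x S)))"
  proof -
    have "(\<Sum>\<alpha>\<in>pos_index n. if \<alpha> \<in> S then
        (-1) ^ card S * (of_real (wt_inner n (x S) (root_of \<alpha>)) * m (x S)) else 0) =
        (-1) ^ card S * (of_real (wt_inner n (x S) (root_sum S)) * m (x S))" if "S \<in> ?P" for S
    proof -
      have "{\<alpha> \<in> pos_index n. \<alpha> \<in> S} = S" using that by blast
      then have "(\<Sum>\<alpha>\<in>pos_index n. if \<alpha> \<in> S then
          (-1) ^ card S * (of_real (wt_inner n (x S) (root_of \<alpha>)) * m (x S)) else 0) =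
          (\<Sum>\<alpha>\<in>S. (-1) ^ card S * (of_real (wt_inner n (x S) (root_of \<alpha>)) * m (x S)))"
        by (simp flip: sum.inter_filter)
      then show ?thesis
        by (simp add: root_sum_def wt_inner_sum_right sum_distrib_left sum_distrib_right)
    qed
    then show ?thesis by (intro arg_cong[where f = uminus] sum.cong refl)
  qed
  \<comment> \<open>With x = \<kappa> + \<sigma>, where \<sigma> is the sum of S, one has |x +
    \<rho>|^2 - |\<kappa> + \<rho>|^2 - 2 (x, \<sigma>) = |\<rho>|^2 - |\<rho> - \<sigma>|^2. As
    \<kappa> has dropped out of the coefficient, \<open>weyl_denom_norm_sum\<close> applies.\<close>
  also have "(\<Sum>S\<in>?P. (-1) ^ card S * (of_real (?N (x S + rho n) - ?N (\<kappa> + rho n)) * m (x S))) +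
      2 * - (\<Sum>S\<in>?P. (-1) ^ card S * (of_real (wt_inner n (x S) (root_sum S)) * m (x S))) =
      (\<Sum>S\<in>?P. (-1) ^ card S * of_real (?N (rho n) - ?N (rho n - root_sum S)) * m (\<kappa> + root_sum S))"
    unfolding mult_minus_right sum_distrib_left diff_conv_add_uminus[symmetric] sum_subtractf[symmetric]
  proof (intro sum.cong refl)
    fix S
    have "?N (x S + rho n) - ?N (\<kappa> + rho n) - 2 * wt_inner n (x S) (root_sum S) =
        ?N (rho n) - ?N (rho n - root_sum S)"
      unfolding x_def
      by (simp only: wt_inner_add_left wt_inner_add_right wt_inner_diff_left wt_inner_diff_right
          wt_inner_commute[of n "root_sum S" \<kappa>] wt_inner_commute[of n "rho n" "root_sum S"]
          wt_inner_commute[of n "rho n" \<kappa>]) (simp add: algebra_simps)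
    then have e: "?N (rho n) - ?N (rho n - root_sum S) =
        ?N (x S + rho n) - ?N (\<kappa> + rho n) - 2 * wt_inner n (x S) (root_sum S)" by (rule sym)
    show "(-1) ^ card S * (of_real (?N (x S + rho n) - ?N (\<kappa> + rho n)) * m (x S)) -
        2 * ((-1) ^ card S * (of_real (wt_inner n (x S) (root_sum S)) * m (x S))) =
        (-1) ^ card S * of_real (?N (rho n) - ?N (rho n - root_sum S)) * m (\<kappa> + root_sum S)"
      unfolding e x_def[symmetric] by (simp add: algebra_simps)
  qed
  also have "\<dots> = 0"
    by (rule weyl_denom_norm_sum)
  finally show ?thesis by (simp only: x_def)
qed


context orth_rep
begin

lemma casimir_add: "u \<in> space R \<Longrightarrow> v \<in> space R \<Longrightarrow> casimir (u + v) = casimir u + casimir v"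
  unfolding casimir_def sum.distrib[symmetric]
  by (intro sum.cong refl) (simp add: act_add A_closed)

lemma casimir_scale: "v \<in> space R \<Longrightarrow> casimir (cscale c v) = cscale c (casimir v)"
  unfolding casimir_def cfun.scale_sum_right
  by (intro sum.cong refl) (simp add: act_scale A_closed)

text \<open>The vectors on which the Casimir operator acts by this scalar form a subrepresentation,
  because it commutes with the action. It contains v, on which the raising terms of
  \<open>casimir_weight\<close> vanish.\<close>

lemma casimir_gen:
  assumes hw: "highest_weight_vector n R \<nu> v" and x: "x \<in> gen n R v"
  shows "casimir x = cscale (complex_of_real (2 * wt_inner n \<nu> \<nu> + 4 * wt_inner n (rho n) \<nu>)) x"
proof -
  let ?c = "complex_of_real (2 * wt_inner n \<nu> \<nu> + 4 * wt_inner n (rho n) \<nu>)"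
  let ?W = "{x \<in> space R. casimir x = cscale ?c x}"
  have "is_subrep n R ?W"
    unfolding is_subrep_def
  proof (intro conjI ballI cfun.subspaceI)
    show "0 \<in> ?W"
      using casimir_scale[OF cfun.subspace_0[OF subspace], of 0] cfun.subspace_0[OF subspace] by simp
  next
    fix x y assume "x \<in> ?W" "y \<in> ?W"
    then show "x + y \<in> ?W"
      using cfun.subspace_add[OF subspace] by (simp add: casimir_add cfun.scale_right_distrib)
  next
    fix c x assume "x \<in> ?W"
    then show "cscale c x \<in> ?W"
      using cfun.subspace_scale[OF subspace] by (simp add: casimir_scale mult.commute)
  next
    fix X assume X: "X \<in> orth_alg n"
    show "act R X ` ?W \<subseteq> ?W"
    proof (rule image_subsetI)
      fix x assume "x \<in> ?W"
      then show "act R X x \<in> ?W"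
        using closed[OF X] casimir_commute[OF X, of x] act_scale[OF X, of x ?c] by simp
    qed
  qed auto
  moreover have "v \<in> ?W"
  proof -
    have "(\<Sum>\<alpha>\<in>pos_index n. act R (lower n \<alpha>) (act R (raise n \<alpha>) v)) = 0"
      by (intro sum.neutral) (simp add: hwv_raise[OF hw] act_zero)
    then show ?thesis
      using casimir_weight[OF hwv_wvec[OF hw]] hwv_wvec[OF hw] by (simp add: wvec_def)
  qed
  ultimately have "gen n R v \<subseteq> ?W" by (rule gen_minimal[OF hw])
  then show ?thesis using x by blast
qed

end

text \<open>Turns equal multiplicities for each weight into a matching of the summands.\<close>

lemma fiberwise_bij:
  assumes "finite A" "finite B" "\<And>k. card {a \<in> A. f a = k} = card {b \<in> B. g b = k}"
  shows "\<exists>h. bij_betw h A B \<and> (\<forall>a\<in>A. g (h a) = f a)"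
proof -
  have "\<exists>h. bij_betw h {a \<in> A. f a = k} {b \<in> B. g b = k}" for k
    using assms by (intro finite_same_card_bij) auto
  then obtain H where H: "\<And>k. bij_betw (H k) {a \<in> A. f a = k} {b \<in> B. g b = k}" by metis
  have val: "H (f a) a \<in> B \<and> g (H (f a) a) = f a" if "a \<in> A" for a
    using bij_betwE[OF H[of "f a"]] that by blast
  have "bij_betw (\<lambda>a. H (f a) a) A B"
    unfolding bij_betw_def
  proof
    show "inj_on (\<lambda>a. H (f a) a) A"
    proof (rule inj_onI)
      fix a a' assume a: "a \<in> A" "a' \<in> A" "H (f a) a = H (f a') a'"
      then have "f a = f a'" using val by metis
      then show "a = a'"
        using a H[of "f a"] unfolding bij_betw_def inj_on_def by simp
    qed
    show "(\<lambda>a. H (f a) a) ` A = B"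
    proof
      show "(\<lambda>a. H (f a) a) ` A \<subseteq> B" using val by blast
      show "B \<subseteq> (\<lambda>a. H (f a) a) ` A"
      proof
        fix b assume "b \<in> B"
        then have "b \<in> H (g b) ` {a \<in> A. f a = g b}"
          using bij_betw_imp_surj_on[OF H[of "g b"]] by blast
        then obtain a where a: "b = H (g b) a" "a \<in> A" "f a = g b" by blast
        then have "b = (\<lambda>a. H (f a) a) a" by simp
        then show "b \<in> (\<lambda>a. H (f a) a) ` A" using a(2) by (rule image_eqI)
      qed
    qed
  qed
  then show ?thesis using val by blast
qed

section \<open>Weight multiplicities as traces of projections\<close>

context unitary_rep
begin

definition wspace :: "(nat \<Rightarrow> real) \<Rightarrow> 'i set" where
  "wspace \<kappa> = {b \<in> B. wt b = \<kappa>}"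

definition gproj :: "('i \<Rightarrow> complex) \<Rightarrow> 'i \<Rightarrow> 'i \<Rightarrow> complex" where
  "gproj v b = proj (gen n R v) (unit_fun b)"

text \<open>The trace of the projection onto \<open>gen n R v\<close>, taken over the coordinate
  vectors of weight \<kappa>. It equals the dimension of the weight space of \<kappa> in that
  subrepresentation.\<close>

definition wmult :: "('i \<Rightarrow> complex) \<Rightarrow> (nat \<Rightarrow> real) \<Rightarrow> complex" where
  "wmult v \<kappa> = (\<Sum>b\<in>wspace \<kappa>. gproj v b b)"

text \<open>The trace of f_\<alpha> e_\<alpha> on the weight space of \<kappa> in
  \<open>gen n R v\<close>. Projecting the coordinate vectors first restricts the trace to this
  subspace.\<close>

definition fe_trace :: "('i \<Rightarrow> complex) \<Rightarrow> (nat \<times> nat) \<times> bool \<Rightarrow> (nat \<Rightarrow> real) \<Rightarrow> complex" where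
  "fe_trace v \<alpha> \<kappa> = (\<Sum>b\<in>wspace \<kappa>. act R (lower n \<alpha>) (act R (raise n \<alpha>) (gproj v b)) b)"

lemma act_linear: "X \<in> orth_alg n \<Longrightarrow> linear_on (space R) (act R X)"
  by (simp add: linear_on_def act_add act_scale)

lemma raise_unit_fun_support:
  assumes \<alpha>: "\<alpha> \<in> pos_index n" and ab: "a \<in> B" "b \<in> B" and "act R (raise n \<alpha>) (unit_fun b) a \<noteq> 0"
  shows "wt a = wt b + root_of \<alpha>"
proof
  fix k
  have "wvec (wt b + root_of \<alpha>) (act R (raise n \<alpha>) (unit_fun b))"
    using \<alpha> by (intro wvec_act[OF raise_orth[OF \<alpha>] cartan_bracket_raise wvec_unit_fun[OF ab(2)]])
  then show "wt a k = (wt b + root_of \<alpha>) k"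
    using assms(4) wt_zero[OF ab(1)] wt_zero[OF ab(2)] root_of_zero[OF \<alpha>]
    by (cases "k < n") (auto simp: wvec_iff)
qed

context
  fixes b0 :: 'i and v :: "'i \<Rightarrow> complex"
  assumes b0: "b0 \<in> B" and hw: "highest_weight_vector n R (wt b0) v"
begin

lemma gproj_wvec: "b \<in> B \<Longrightarrow> wvec (wt b) (gproj v b)"
  unfolding gproj_def by (rule wvec_proj[OF gen_is_subrep[OF hw] wvec_unit_fun])

lemma gproj_in_gen: "b \<in> B \<Longrightarrow> gproj v b \<in> gen n R v"
  unfolding gproj_def by (rule proj_in[OF gen_is_subrep[OF hw] unit_fun_space])

text \<open>Cyclicity of the trace. Since the projection commutes with the action, both sides expand
  into the same double sum: entries of e_\<alpha> from weight \<kappa> to \<kappa> + \<alpha>, times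
  entries of the projected f_\<alpha> back.\<close>

lemma fe_trace_cyclic:
  assumes \<alpha>: "\<alpha> \<in> pos_index n"
  shows "fe_trace v \<alpha> \<kappa> =
    (\<Sum>a\<in>wspace (\<kappa> + root_of \<alpha>). act R (raise n \<alpha>) (act R (lower n \<alpha>) (gproj v a)) a)"
proof -
  let ?W = "gen n R v" and ?E = "act R (raise n \<alpha>)" and ?L = "act R (lower n \<alpha>)"
  let ?\<kappa> = "\<kappa> + root_of \<alpha>"
  have W: "is_subrep n R ?W" by (rule gen_is_subrep[OF hw])
  have E: "raise n \<alpha> \<in> orth_alg n" and L: "lower n \<alpha> \<in> orth_alg n" using \<alpha> by simp_all
  note unit = unit_fun_space
  have T: "linear_on (space R) (\<lambda>f. proj ?W (?L f))"
    unfolding linear_on_def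
    by (simp add: act_add[OF L] act_scale[OF L] proj_add[OF W] proj_scale[OF W] closed[OF L])
  have 1: "?L (?E (gproj v b)) b = (\<Sum>a\<in>wspace ?\<kappa>. ?E (unit_fun b) a * proj ?W (?L (unit_fun a)) b)"
    if b: "b \<in> wspace \<kappa>" for b
  proof -
    have bB: "b \<in> B" and wb: "wt b = \<kappa>" using b by (auto simp: wspace_def)
    have "?L (?E (gproj v b)) = proj ?W (?L (?E (unit_fun b)))"
      unfolding gproj_def using bB
      by (simp add: proj_act[OF W E] proj_act[OF W L] closed[OF E] unit)
    also have "\<dots> = (\<Sum>a\<in>B. cscale (?E (unit_fun b) a) (proj ?W (?L (unit_fun a))))"
      by (rule linear_on_expand[OF T closed[OF E unit[OF bB]]])
    finally have "?L (?E (gproj v b)) b = (\<Sum>a\<in>B. ?E (unit_fun b) a * proj ?W (?L (unit_fun a)) b)"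
      by (simp only: sum_fun_apply cscale_def)
    also have "\<dots> = (\<Sum>a\<in>wspace ?\<kappa>. ?E (unit_fun b) a * proj ?W (?L (unit_fun a)) b)"
    proof (intro sum.mono_neutral_right finB ballI)
      show "wspace ?\<kappa> \<subseteq> B" by (auto simp: wspace_def)
      fix a assume "a \<in> B - wspace ?\<kappa>"
      then have "?E (unit_fun b) a = 0"
        using raise_unit_fun_support[OF \<alpha> _ bB] wb unfolding wspace_def by blast
      then show "?E (unit_fun b) a * proj ?W (?L (unit_fun a)) b = 0" by simp
    qed
    finally show ?thesis .
  qed
  have 2: "?E (?L (gproj v a)) a = (\<Sum>b\<in>wspace \<kappa>. ?E (unit_fun b) a * proj ?W (?L (unit_fun a)) b)"
    if a: "a \<in> wspace ?\<kappa>" for a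
  proof -
    have aB: "a \<in> B" and wa: "wt a = ?\<kappa>" using a by (auto simp: wspace_def)
    have eq: "?L (gproj v a) = proj ?W (?L (unit_fun a))"
      unfolding gproj_def using aB by (simp add: proj_act[OF W L] unit)
    have "proj ?W (?L (unit_fun a)) \<in> space R"
      using proj_in[OF W closed[OF L unit[OF aB]]] is_subrepD(1)[OF W] by blast
    then have "?E (proj ?W (?L (unit_fun a))) =
        (\<Sum>b\<in>B. cscale (proj ?W (?L (unit_fun a)) b) (?E (unit_fun b)))"
      by (rule linear_on_expand[OF act_linear[OF E]])
    then have "?E (?L (gproj v a)) a = (\<Sum>b\<in>B. ?E (unit_fun b) a * proj ?W (?L (unit_fun a)) b)"
      by (simp only: eq sum_fun_apply cscale_def mult.commute)
    also have "\<dots> = (\<Sum>b\<in>wspace \<kappa>. ?E (unit_fun b) a * proj ?W (?L (unit_fun a)) b)"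
    proof (intro sum.mono_neutral_right finB ballI)
      show "wspace \<kappa> \<subseteq> B" by (auto simp: wspace_def)
      fix b assume b: "b \<in> B - wspace \<kappa>"
      have "?E (unit_fun b) a = 0"
      proof (rule ccontr)
        assume "?E (unit_fun b) a \<noteq> 0"
        then have "wt a = wt b + root_of \<alpha>" using raise_unit_fun_support[OF \<alpha> aB] b by blast
        then have "wt b = \<kappa>" using wa by (simp only: add_right_cancel)
        then show False using b by (simp add: wspace_def)
      qed
      then show "?E (unit_fun b) a * proj ?W (?L (unit_fun a)) b = 0" by simp
    qed
    finally show ?thesis .
  qed
  have "fe_trace v \<alpha> \<kappa> = (\<Sum>b\<in>wspace \<kappa>. \<Sum>a\<in>wspace ?\<kappa>. ?E (unit_fun b) a * proj ?W (?L (unit_fun a)) b)"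
    unfolding fe_trace_def by (intro sum.cong refl 1)
  also have "\<dots> = (\<Sum>a\<in>wspace ?\<kappa>. \<Sum>b\<in>wspace \<kappa>. ?E (unit_fun b) a * proj ?W (?L (unit_fun a)) b)"
    by (rule sum.swap)
  also have "\<dots> = (\<Sum>a\<in>wspace ?\<kappa>. ?E (?L (gproj v a)) a)"
    by (intro sum.cong refl 2[symmetric])
  finally show ?thesis .
qed

text \<open>Cyclicity moves the trace to weight \<kappa> + \<alpha> with the two factors reversed,
  and \<open>raise_lower_commute\<close> restores their order.\<close>

lemma fe_trace_rec:
  assumes \<alpha>: "\<alpha> \<in> pos_index n"
  shows "fe_trace v \<alpha> \<kappa> = fe_trace v \<alpha> (\<kappa> + root_of \<alpha>) +
    of_real (wt_inner n (\<kappa> + root_of \<alpha>) (root_of \<alpha>)) * wmult v (\<kappa> + root_of \<alpha>)"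
proof -
  let ?\<kappa> = "\<kappa> + root_of \<alpha>"
  have "act R (raise n \<alpha>) (act R (lower n \<alpha>) (gproj v a)) a =
      act R (lower n \<alpha>) (act R (raise n \<alpha>) (gproj v a)) a + of_real (wt_inner n ?\<kappa> (root_of \<alpha>)) * gproj v a a"
    if "a \<in> wspace ?\<kappa>" for a
  proof -
    have "wvec ?\<kappa> (gproj v a)" using gproj_wvec[of a] that by (auto simp only: wspace_def mem_Collect_eq)
    from raise_lower_commute[OF this \<alpha>] show ?thesis by (simp add: cscale_def)
  qed
  then show ?thesis
    unfolding fe_trace_cyclic[OF \<alpha>, of \<kappa>]
    by (simp add: fe_trace_def wmult_def sum.distrib sum_distrib_left)
qed

text \<open>Two evaluations of the trace of the Casimir operator on a weight space: by its scalar on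
  the whole subrepresentation, and by \<open>casimir_weight\<close>.\<close>

lemma wmult_casimir:
  "of_real (2 * wt_inner n (wt b0) (wt b0) + 4 * wt_inner n (rho n) (wt b0)) * wmult v \<kappa> =
    of_real (2 * wt_inner n \<kappa> \<kappa> + 4 * wt_inner n (rho n) \<kappa>) * wmult v \<kappa> +
    4 * (\<Sum>\<alpha>\<in>pos_index n. fe_trace v \<alpha> \<kappa>)"
proof -
  let ?c = "\<lambda>\<nu>. complex_of_real (2 * wt_inner n \<nu> \<nu> + 4 * wt_inner n (rho n) \<nu>)"
  have pt: "?c (wt b0) * gproj v b b = ?c \<kappa> * gproj v b b +
      4 * (\<Sum>\<alpha>\<in>pos_index n. act R (lower n \<alpha>) (act R (raise n \<alpha>) (gproj v b)) b)"
    if "b \<in> wspace \<kappa>" for b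
  proof -
    have b: "b \<in> B" "wt b = \<kappa>" using that by (auto simp: wspace_def)
    have "cscale (?c (wt b0)) (gproj v b) = cscale (?c \<kappa>) (gproj v b) +
        cscale 4 (\<Sum>\<alpha>\<in>pos_index n. act R (lower n \<alpha>) (act R (raise n \<alpha>) (gproj v b)))"
      using casimir_gen[OF hw gproj_in_gen[OF b(1)]] casimir_weight[OF gproj_wvec[OF b(1)]]
      unfolding b(2) by (simp only:)
    then have "cscale (?c (wt b0)) (gproj v b) b = (cscale (?c \<kappa>) (gproj v b) +
        cscale 4 (\<Sum>\<alpha>\<in>pos_index n. act R (lower n \<alpha>) (act R (raise n \<alpha>) (gproj v b)))) b"
      by (rule fun_cong)
    then show ?thesis by (simp only: plus_fun_apply cscale_def sum_fun_apply)
  qed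
  have "?c (wt b0) * wmult v \<kappa> = (\<Sum>b\<in>wspace \<kappa>. ?c (wt b0) * gproj v b b)"
    by (simp only: wmult_def sum_distrib_left)
  also have "\<dots> = (\<Sum>b\<in>wspace \<kappa>. ?c \<kappa> * gproj v b b +
      4 * (\<Sum>\<alpha>\<in>pos_index n. act R (lower n \<alpha>) (act R (raise n \<alpha>) (gproj v b)) b))"
    by (intro sum.cong refl pt)
  also have "\<dots> = ?c \<kappa> * wmult v \<kappa> +
      4 * (\<Sum>b\<in>wspace \<kappa>. \<Sum>\<alpha>\<in>pos_index n. act R (lower n \<alpha>) (act R (raise n \<alpha>) (gproj v b)) b)"
    by (simp only: wmult_def sum_distrib_left sum.distrib)
  also have "(\<Sum>b\<in>wspace \<kappa>. \<Sum>\<alpha>\<in>pos_index n. act R (lower n \<alpha>) (act R (raise n \<alpha>) (gproj v b)) b) =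
      (\<Sum>\<alpha>\<in>pos_index n. fe_trace v \<alpha> \<kappa>)"
    unfolding fe_trace_def by (rule sum.swap)
  finally show ?thesis .
qed

text \<open>A nonzero trace gives a vector of the subrepresentation with a nonzero coordinate at
  some b of weight \<kappa>. Then some lowering word has such a coordinate as well, and its weight
  must be that of b.\<close>

lemma wmult_nonzero:
  assumes "wmult v \<kappa> \<noteq> 0"
  shows "\<exists>\<gamma> w. lowered n R v \<gamma> w \<and> wt b0 = \<kappa> + \<gamma>"
proof -
  obtain b where b: "b \<in> B" "wt b = \<kappa>" "gproj v b b \<noteq> 0"
    using assms unfolding wmult_def wspace_def by (metis (mono_tags, lifting) mem_Collect_eq sum.neutral)
  have "\<exists>\<gamma> w. lowered n R v \<gamma> w \<and> w b \<noteq> 0"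
  proof (rule ccontr)
    assume "\<not> ?thesis"
    then have "{w. \<exists>\<gamma>. lowered n R v \<gamma> w} \<subseteq> {w. w b = 0}" by blast
    moreover have "cfun.subspace {w. w b = 0}"
      by (rule cfun.subspaceI) (auto simp: cscale_def)
    ultimately have "gen n R v \<subseteq> {w. w b = 0}"
      unfolding gen_def by (rule cfun.span_minimal)
    then show False using gproj_in_gen[OF b(1)] b(3) by blast
  qed
  then obtain \<gamma> w where w: "lowered n R v \<gamma> w" "w b \<noteq> 0" by blast
  have "wt b0 = \<kappa> + \<gamma>"
  proof
    fix k
    show "wt b0 k = (\<kappa> + \<gamma>) k"
    proof (cases "k < n")
      case True
      then have "wt b k = (wt b0 - \<gamma>) k"
        using lowered_wvec[OF hw w(1)] w(2) unfolding wvec_iff by blast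
      then show ?thesis using b(2) by (simp add: algebra_simps)
    next
      case False
      then show ?thesis
        using wt_zero[OF b0, of k] wt_zero[OF b(1), of k] lowered_zero[OF w(1), of k] b(2) by simp
    qed
  qed
  then show ?thesis using w(1) by blast
qed

text \<open>The top weight space is the line of v, so the diagonal entries of the projection there
  are |v b|^2 / |v|^2, which add up to 1.\<close>

lemma wmult_top: "wmult v (wt b0) = 1"
proof -
  have vec: "wvec (wt b0) v" "v \<in> space R" "v \<noteq> 0"
    using hwv_wvec[OF hw] hwv_nonzero[OF hw] by (simp_all add: wvec_def)
  have nz: "ip v v \<noteq> 0" using ip_self_eq_0 vec by blast
  have val: "gproj v b b = v b * cnj (v b) / ip v v" if b: "b \<in> wspace (wt b0)" for b
  proof -
    have bB: "b \<in> B" "wt b = wt b0" using b by (auto simp: wspace_def)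
    obtain c where c: "gproj v b = cscale c v"
      using gen_top_weight[OF hw gproj_in_gen[OF bB(1)]] gproj_wvec[OF bB(1)] bB(2) by metis
    have "ip (unit_fun b - gproj v b) v = 0"
      unfolding gproj_def by (rule proj_orth[OF gen_is_subrep[OF hw] unit_fun_space[OF bB(1)] v_in_gen])
    then have "ip (unit_fun b) v = c * ip v v"
      unfolding c by (simp add: ip_diff_left ip_scale_left)
    moreover have "ip (unit_fun b) v = cnj (v b)"
      using ip_commute[of "unit_fun b" v] ip_unit_fun[OF bB(1), of v] by simp
    ultimately have "c = cnj (v b) / ip v v" using nz by (simp add: field_simps)
    then show ?thesis by (simp add: c cscale_def)
  qed
  have "wmult v (wt b0) = (\<Sum>b\<in>wspace (wt b0). v b * cnj (v b) / ip v v)"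
    unfolding wmult_def by (intro sum.cong refl val)
  also have "\<dots> = (\<Sum>b\<in>B. v b * cnj (v b) / ip v v)"
  proof (intro sum.mono_neutral_left finB ballI)
    show "wspace (wt b0) \<subseteq> B" by (auto simp: wspace_def)
    fix b assume b: "b \<in> B - wspace (wt b0)"
    have "v b = 0"
    proof (rule ccontr)
      assume "v b \<noteq> 0"
      then have "wt b k = wt b0 k" if "k < n" for k
        using vec(1) that unfolding wvec_iff by blast
      moreover have "wt b k = wt b0 k" if "\<not> k < n" for k
        using wt_zero[OF b0, of k] wt_zero[of b k] b that by simp
      ultimately have "wt b = wt b0" by blast
      then show False using b by (simp add: wspace_def)
    qed
    then show "v b * cnj (v b) / ip v v = 0" by simp
  qed
  also have "\<dots> = (\<Sum>b\<in>B. v b * cnj (v b)) / ip v v" by (rule sum_divide_distrib[symmetric])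
  also have "\<dots> = ip v v / ip v v" by (simp only: ip_def)
  finally show ?thesis using nz by simp
qed

text \<open>Let \<nu> be the top weight and \<kappa> different from it. If the sum were nonzero,
  then |\<nu> + \<rho>| = |\<kappa> + \<rho>| by \<open>alternating_sum_casimir\<close>, and a
  nonzero term would give \<nu> = \<kappa> + \<eta> with \<eta> a sum of positive roots. As \<kappa>
  is dominant, |\<nu> + \<rho>|^2 is at least |\<kappa> + \<rho>|^2 + |\<eta>|^2, so \<eta> =
  0.\<close>

lemma wmult_alternating_sum:
  assumes \<kappa>: "\<kappa> \<in> dominant_weights n"
  shows "(\<Sum>S\<in>Pow (pos_index n). (-1) ^ card S * wmult v (\<kappa> + root_sum S)) = (if wt b0 = \<kappa> then 1 else 0)"
proof (cases "wt b0 = \<kappa>")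
  case True
  \<comment> \<open>A nonempty S would reach a weight of larger height than the top weight.\<close>
  have "wmult v (\<kappa> + root_sum S) = 0" if S: "S \<in> Pow (pos_index n) - {{}}" for S
  proof (rule ccontr)
    assume "wmult v (\<kappa> + root_sum S) \<noteq> 0"
    then obtain \<gamma> w where \<gamma>: "lowered n R v \<gamma> w" "wt b0 = \<kappa> + root_sum S + \<gamma>"
      using wmult_nonzero by blast
    have "wt_inner n (rho n) (wt b0) =
        wt_inner n (rho n) \<kappa> + wt_inner n (rho n) (root_sum S) + wt_inner n (rho n) \<gamma>"
      by (simp only: \<gamma>(2) wt_inner_add_right)
    then have "wt_inner n (rho n) (root_sum S) = 0"
      using lowered_height[OF \<gamma>(1)] wt_inner_rho_root_sum(1)[of S n] S True by auto
    then show False using wt_inner_rho_root_sum(2)[of S n] S by blast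
  qed
  then have "(\<Sum>S\<in>Pow (pos_index n). (-1) ^ card S * wmult v (\<kappa> + root_sum S)) =
      (\<Sum>S\<in>{{}}. (-1) ^ card S * wmult v (\<kappa> + root_sum S))"
    by (intro sum.mono_neutral_right) auto
  also have "\<dots> = wmult v (\<kappa> + 0)" by (simp add: root_sum_def)
  also have "\<kappa> + 0 = wt b0" using True by simp
  finally show ?thesis unfolding if_P[OF True] wmult_top .
next
  case False
  have "(\<Sum>S\<in>Pow (pos_index n). (-1) ^ card S * wmult v (\<kappa> + root_sum S)) = 0"
  proof (rule ccontr)
    assume nz: "(\<Sum>S\<in>Pow (pos_index n). (-1) ^ card S * wmult v (\<kappa> + root_sum S)) \<noteq> 0"
    have "\<exists>S\<in>Pow (pos_index n). (-1) ^ card S * wmult v (\<kappa> + root_sum S) \<noteq> 0"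
      using nz by (rule contrapos_np) (intro sum.neutral, blast)
    then obtain S where S: "S \<in> Pow (pos_index n)" and "(-1) ^ card S * wmult v (\<kappa> + root_sum S) \<noteq> 0"
      by blast
    then have "wmult v (\<kappa> + root_sum S) \<noteq> 0" by (simp only: mult_eq_0_iff simp_thms de_Morgan_disj)
    then obtain \<gamma> w where \<gamma>: "lowered n R v \<gamma> w" "wt b0 = \<kappa> + root_sum S + \<gamma>"
      using wmult_nonzero by blast
    define \<eta> where "\<eta> = root_sum S + \<gamma>"
    have \<nu>: "wt b0 = \<kappa> + \<eta>" using \<gamma>(2) by (simp only: \<eta>_def add.assoc)
    have "wt_inner n (wt b0 + rho n) (wt b0 + rho n) = wt_inner n (\<kappa> + rho n) (\<kappa> + rho n)"
      using alternating_sum_casimir[where m = "wmult v" and t = "fe_trace v" and \<nu> = "wt b0" and \<kappa> = \<kappa>,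
          OF fe_trace_rec wmult_casimir] nz
      by (simp only: mult_eq_0_iff of_real_eq_0_iff right_minus_eq simp_thms)
    moreover have "wt_inner n (wt b0 + rho n) (wt b0 + rho n) =
        wt_inner n (\<kappa> + rho n) (\<kappa> + rho n) + 2 * wt_inner n \<kappa> \<eta> + 2 * wt_inner n (rho n) \<eta> + wt_inner n \<eta> \<eta>"
      unfolding \<nu> wt_inner_add_left wt_inner_add_right
      by (simp add: wt_inner_commute[of n \<eta> \<kappa>] wt_inner_commute[of n \<eta> "rho n"])
    moreover have "wt_inner n \<kappa> (root_sum S) \<ge> 0"
      unfolding root_sum_def wt_inner_sum_right using S
      by (intro sum_nonneg wt_inner_dominant_root_nonneg[OF \<kappa> n2]) auto
    then have "wt_inner n \<kappa> \<eta> \<ge> 0"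
      unfolding \<eta>_def wt_inner_add_right using lowered_dominant[OF \<gamma>(1) \<kappa> n2] by linarith
    moreover have "wt_inner n (rho n) \<eta> \<ge> 0"
      unfolding \<eta>_def wt_inner_add_right
      using lowered_height[OF \<gamma>(1)] wt_inner_rho_root_sum(1)[of S n] S by auto
    moreover have "wt_inner n \<eta> \<eta> \<ge> 0" unfolding wt_inner_def by (intro sum_nonneg) simp
    ultimately have "wt_inner n \<eta> \<eta> = 0" by linarith
    then have z: "\<eta> i = 0" if "i < n" for i
      unfolding wt_inner_def using that by (subst (asm) sum_nonneg_eq_0_iff) auto
    have "\<eta> i = 0" if "\<not> i < n" for i
    proof -
      have "root_sum S i = 0"
        unfolding root_sum_def sum_fun_apply using that S root_of_zero
        by (intro sum.neutral) force
      then show ?thesis using lowered_zero[OF \<gamma>(1), of i] that by (simp add: \<eta>_def)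
    qed
    with z have "\<eta> = 0" by (auto simp: fun_eq_iff)
    then show False using False \<nu> by simp
  qed
  then show ?thesis unfolding if_not_P[OF False] .
qed

end

text \<open>The projections onto the summands add up to the identity, so taking traces weight by
  weight writes the character of R as the sum of the functions \<open>wmult v\<close>. By
  \<open>wmult_alternating_sum\<close> each summand then contributes 1 or 0.\<close>

lemma card_hw_family:
  assumes Q: "hw_family Q" "finite Q" and sum: "\<And>f. f \<in> space R \<Longrightarrow> f = (\<Sum>v\<in>Q. proj (gen n R v) f)"
    and \<omega>: "\<And>v. v \<in> Q \<Longrightarrow> \<exists>b\<in>B. \<omega> v = wt b \<and> highest_weight_vector n R (wt b) v"
    and \<kappa>: "\<kappa> \<in> dominant_weights n"
  shows "Poly_Mapping.lookup (weyl_denom n * (\<Sum>b\<in>B. xexp (wt b))) (\<kappa> + rho n) =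
    of_nat (card {v \<in> Q. \<omega> v = \<kappa>})"
proof -
  have char: "Poly_Mapping.lookup (\<Sum>b\<in>B. xexp (wt b)) \<mu> = (\<Sum>v\<in>Q. wmult v \<mu>)" for \<mu>
  proof -
    have "Poly_Mapping.lookup (\<Sum>b\<in>B. xexp (wt b)) \<mu> = (\<Sum>b\<in>B. if wt b = \<mu> then 1 else 0)"
      by (simp add: lookup_sum xexp_def lookup_single when_def)
    also have "\<dots> = (\<Sum>b\<in>wspace \<mu>. 1)"
      unfolding wspace_def using finB by (rule sum.inter_filter[symmetric])
    also have "\<dots> = (\<Sum>b\<in>wspace \<mu>. \<Sum>v\<in>Q. gproj v b b)"
    proof (intro sum.cong refl)
      fix b assume "b \<in> wspace \<mu>"
      then have b: "b \<in> B" by (simp add: wspace_def)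
      have "unit_fun b b = (\<Sum>v\<in>Q. proj (gen n R v) (unit_fun b)) b"
        using sum[OF unit_fun_space[OF b]] by (rule fun_cong)
      then show "1 = (\<Sum>v\<in>Q. gproj v b b)"
        by (simp add: sum_fun_apply gproj_def) (simp add: unit_fun_def)
    qed
    also have "\<dots> = (\<Sum>v\<in>Q. wmult v \<mu>)" unfolding wmult_def by (rule sum.swap)
    finally show ?thesis .
  qed
  have "Poly_Mapping.lookup (weyl_denom n * (\<Sum>b\<in>B. xexp (wt b))) (\<kappa> + rho n) =
      (\<Sum>S\<in>Pow (pos_index n). (-1) ^ card S * (\<Sum>v\<in>Q. wmult v (\<kappa> + root_sum S)))"
    unfolding lookup_weyl_denom_mult char ..
  also have "\<dots> = (\<Sum>S\<in>Pow (pos_index n). \<Sum>v\<in>Q. (-1) ^ card S * wmult v (\<kappa> + root_sum S))"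
    by (simp only: sum_distrib_left)
  also have "\<dots> = (\<Sum>v\<in>Q. \<Sum>S\<in>Pow (pos_index n). (-1) ^ card S * wmult v (\<kappa> + root_sum S))"
    by (rule sum.swap)
  also have "\<dots> = (\<Sum>v\<in>Q. if \<omega> v = \<kappa> then 1 else 0)"
  proof (intro sum.cong refl)
    fix v assume "v \<in> Q"
    then obtain b where "b \<in> B" "\<omega> v = wt b" "highest_weight_vector n R (wt b) v" using \<omega> by blast
    then show "(\<Sum>S\<in>Pow (pos_index n). (-1) ^ card S * wmult v (\<kappa> + root_sum S)) = (if \<omega> v = \<kappa> then 1 else 0)"
      using wmult_alternating_sum[OF _ _ \<kappa>] by (simp only:)
  qed
  also have "\<dots> = of_nat (card {v \<in> Q. \<omega> v = \<kappa>})"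
    using Q(2) by (simp flip: sum.inter_filter)
  finally show ?thesis .
qed

text \<open>Any finite index set with the right number of elements over each dominant weight can
  label the summands, because it can be matched with a maximal orthogonal family of highest weight
  vectors.\<close>

theorem decomposition:
  fixes en :: "'t \<Rightarrow> nat \<Rightarrow> real"
  assumes T: "finite T" "\<And>t. t \<in> T \<Longrightarrow> en t \<in> dominant_weights n"
    and count: "\<And>\<kappa>. \<kappa> \<in> dominant_weights n \<Longrightarrow>
      Poly_Mapping.lookup (weyl_denom n * (\<Sum>b\<in>B. xexp (wt b))) (\<kappa> + rho n) =
      of_nat (card {t \<in> T. en t = \<kappa>})"
  shows "(\<forall>t\<in>T. irreducible_of_highest_weight n (en t) (L_rep n (en t))) \<and>
    rep_iso n R (direct_sum T (\<lambda>t. L_rep n (en t)))"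
proof -
  obtain Q where Q: "hw_family Q" "finite Q"
    and sum: "\<And>f. f \<in> space R \<Longrightarrow> f = (\<Sum>v\<in>Q. proj (gen n R v) f)"
    using maximal_hw_family by blast
  have "\<forall>v\<in>Q. \<exists>\<nu>. \<exists>b\<in>B. \<nu> = wt b \<and> highest_weight_vector n R (wt b) v"
    using Q(1) unfolding hw_family_def by blast
  from bchoice[OF this] obtain \<omega> where
    \<omega>: "\<And>v. v \<in> Q \<Longrightarrow> \<exists>b\<in>B. \<omega> v = wt b \<and> highest_weight_vector n R (wt b) v" by blast
  have \<omega>hw: "highest_weight_vector n R (\<omega> v) v" and \<omega>dom: "\<omega> v \<in> dominant_weights n" if "v \<in> Q" for v
    using \<omega>[OF that] hwv_dominant by auto
  \<comment> \<open>Off the dominant weights both fibres are empty, for Q by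
    \<open>hwv_dominant\<close>.\<close>
  have "card {t \<in> T. en t = \<kappa>} = card {v \<in> Q. \<omega> v = \<kappa>}" for \<kappa>
  proof (cases "\<kappa> \<in> dominant_weights n")
    case True
    have "of_nat (card {t \<in> T. en t = \<kappa>}) = (of_nat (card {v \<in> Q. \<omega> v = \<kappa>}) :: complex)"
      using count[OF True] card_hw_family[OF Q sum \<omega> True] by (simp only:)
    then show ?thesis by (simp only: of_nat_eq_iff)
  next
    case False
    then have "{t \<in> T. en t = \<kappa>} = {}" "{v \<in> Q. \<omega> v = \<kappa>} = {}" using T(2) \<omega>dom by auto
    then show ?thesis by (simp only: card.empty)
  qed
  then obtain h where h: "bij_betw h T Q" "\<And>t. t \<in> T \<Longrightarrow> \<omega> (h t) = en t"
    using fiberwise_bij[OF T(1) Q(2), of en \<omega>] by blast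
  define G where "G t = gen n R (h t)" for t
  have hQ: "h t \<in> Q" if "t \<in> T" for t using h(1) that by (auto simp: bij_betw_def)
  have hw: "highest_weight_vector n R (en t) (h t)" if "t \<in> T" for t
    using \<omega>hw[OF hQ[OF that]] h(2)[OF that] by simp
  have G: "is_subrep n R (G t)" if "t \<in> T" for t
    unfolding G_def by (rule gen_is_subrep[OF hw[OF that]])
  have irr: "irreducible_of_highest_weight n (en t) (subrep R (G t))" if "t \<in> T" for t
    unfolding G_def by (rule hwv_irreducible[OF hw[OF that]])
  have L: "irreducible_of_highest_weight n (en t) (L_rep n (en t))" if t: "t \<in> T" for t
  proof -
    \<comment> \<open>\<open>L_rep\<close> is a choice among representations on
      \<open>nat \<Rightarrow> complex\<close>. Enumerating B copies the summand there and so
      provides a witness.\<close>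
    obtain e where e: "bij_betw e {0..<card B} B"
      using ex_bij_betw_nat_finite[OF finB] by blast
    define \<theta> :: "('i \<Rightarrow> complex) \<Rightarrow> nat \<Rightarrow> complex" where
      "\<theta> f = (\<lambda>k. if k < card B then f (e k) else 0)" for f
    have lin: "linear_on (space (subrep R (G t))) \<theta>"
      by (auto simp: linear_on_def \<theta>_def fun_eq_iff cscale_def)
    have "inj_on \<theta> (space (subrep R (G t)))"
    proof (rule inj_onI)
      fix f g assume "f \<in> space (subrep R (G t))" "g \<in> space (subrep R (G t))" and eq: "\<theta> f = \<theta> g"
      then have fg: "f \<in> space R" "g \<in> space R" using is_subrepD(1)[OF G[OF t]] by auto
      show "f = g"
      proof
        fix b
        show "f b = g b"
        proof (cases "b \<in> B")
          case True
          then have "b \<in> e ` {0..<card B}" using bij_betw_imp_surj_on[OF e] by blast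
          then obtain k where "k < card B" "b = e k" by auto
          then show ?thesis using fun_cong[OF eq, of k] by (simp add: \<theta>_def)
        next
          case False
          then show ?thesis using fg by (simp add: space_eq)
        qed
      qed
    qed
    then have "\<exists>L :: nat rep. irreducible_of_highest_weight n (en t) L"
      by (rule irreducible_of_highest_weight_transport[OF irr[OF t] lin])
    then show ?thesis unfolding L_rep_def by (rule someI_ex)
  qed
  let ?L = "\<lambda>t. L_rep n (en t)"
  have "\<forall>t\<in>T. \<exists>\<phi>. linear_on (G t) \<phi> \<and> bij_betw \<phi> (G t) (space (?L t)) \<and>
      (\<forall>X \<in> orth_alg n. \<forall>x \<in> G t. \<phi> (act R X x) = act (?L t) X (\<phi> x))"
    using irreducible_of_highest_weight_unique[OF irr L] unfolding rep_iso_def subrep_simps by blast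
  from bchoice[OF this] obtain \<phi> where \<phi>': "\<forall>t\<in>T. linear_on (G t) (\<phi> t) \<and> bij_betw (\<phi> t) (G t) (space (?L t)) \<and>
      (\<forall>X \<in> orth_alg n. \<forall>x \<in> G t. \<phi> t (act R X x) = act (?L t) X (\<phi> t x))" by blast
  have \<phi>: "linear_on (G t) (\<phi> t)" "bij_betw (\<phi> t) (G t) (space (?L t))"
      "\<And>X x. X \<in> orth_alg n \<Longrightarrow> x \<in> G t \<Longrightarrow> \<phi> t (act R X x) = act (?L t) X (\<phi> t x)" if "t \<in> T" for t
    using bspec[OF \<phi>' that] by blast+
  have pin: "proj (G t) f \<in> G t" if "t \<in> T" "f \<in> space R" for t f
    using proj_in[OF G[OF that(1)] that(2)] .
  \<comment> \<open>A vector is split by the projections onto the summands, and each component is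
    carried to its copy of L.\<close>
  define \<Phi> :: "('i \<Rightarrow> complex) \<Rightarrow> 't \<times> nat \<Rightarrow> complex" where
    "\<Phi> w = (\<lambda>(t, i). if t \<in> T then \<phi> t (proj (G t) w) i else 0)" for w
  have \<Phi>: "(\<lambda>i. \<Phi> w (t, i)) = \<phi> t (proj (G t) w)" if "t \<in> T" for w t
    using that by (simp add: \<Phi>_def)
  have lin: "linear_on (space R) \<Phi>"
    unfolding linear_on_def
  proof (intro conjI ballI allI ext)
    fix u w and ti :: "'t \<times> nat" assume uw: "u \<in> space R" "w \<in> space R"
    obtain t i where ti: "ti = (t, i)" by force
    show "\<Phi> (u + w) ti = (\<Phi> u + \<Phi> w) ti"
    proof (cases "t \<in> T")
      case True
      have "\<phi> t (proj (G t) (u + w)) = \<phi> t (proj (G t) u) + \<phi> t (proj (G t) w)"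
        using \<phi>(1)[OF True] pin[OF True] uw by (simp add: proj_add[OF G[OF True]] linear_on_def)
      then show ?thesis using True ti by (simp add: \<Phi>_def)
    qed (simp add: \<Phi>_def ti)
  next
    fix c w and ti :: "'t \<times> nat" assume w: "w \<in> space R"
    obtain t i where ti: "ti = (t, i)" by force
    show "\<Phi> (cscale c w) ti = cscale c (\<Phi> w) ti"
    proof (cases "t \<in> T")
      case True
      have "\<phi> t (proj (G t) (cscale c w)) = cscale c (\<phi> t (proj (G t) w))"
        using \<phi>(1)[OF True] pin[OF True] w by (simp add: proj_scale[OF G[OF True]] linear_on_def)
      then show ?thesis using True ti by (simp add: \<Phi>_def cscale_def)
    qed (simp add: \<Phi>_def ti cscale_def)
  qed
  let ?D = "direct_sum T ?L"
  have bij: "bij_betw \<Phi> (space R) (space ?D)"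
  proof (rule bij_betwI')
    fix u w assume uw: "u \<in> space R" "w \<in> space R"
    show "(\<Phi> u = \<Phi> w) = (u = w)"
    proof
      assume eq: "\<Phi> u = \<Phi> w"
      have p: "proj (G t) u = proj (G t) w" if t: "t \<in> T" for t
      proof -
        have "\<phi> t (proj (G t) u) = \<phi> t (proj (G t) w)" using \<Phi>[OF t] eq by metis
        then show ?thesis
          using \<phi>(2)[OF t] pin[OF t uw(1)] pin[OF t uw(2)] by (simp add: bij_betw_def inj_on_def)
      qed
      have "proj (gen n R v) u = proj (gen n R v) w" if "v \<in> Q" for v
      proof -
        have "v \<in> h ` T" using h(1) that by (simp add: bij_betw_def)
        then show ?thesis using p unfolding G_def by blast
      qed
      then have "(\<Sum>v\<in>Q. proj (gen n R v) u) = (\<Sum>v\<in>Q. proj (gen n R v) w)"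
        by (intro sum.cong refl)
      then show "u = w" using sum[OF uw(1)] sum[OF uw(2)] by (simp only:)
    qed simp
  next
    fix w assume w: "w \<in> space R"
    have "{t. \<exists>i. \<Phi> w (t, i) \<noteq> 0} \<subseteq> T" by (auto simp: \<Phi>_def)
    then have "finite {t. \<exists>i. \<Phi> w (t, i) \<noteq> 0}" using T(1) finite_subset by blast
    moreover have "(\<lambda>i. \<Phi> w (t, i)) \<in> space (?L t)" if "t \<in> T" for t
      unfolding \<Phi>[OF that] using \<phi>(2)[OF that] pin[OF that w] by (rule bij_betw_apply)
    moreover have "\<Phi> w (t, i) = 0" if "t \<notin> T" for t i using that by (simp add: \<Phi>_def)
    ultimately show "\<Phi> w \<in> space ?D" by (simp add: direct_sum_def)
  next
    fix f assume "f \<in> space ?D"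
    then have f: "\<And>t. t \<in> T \<Longrightarrow> (\<lambda>i. f (t, i)) \<in> space (?L t)" "\<And>t i. t \<notin> T \<Longrightarrow> f (t, i) = 0"
      by (auto simp: direct_sum_def)
    define g where "g t = inv_into (G t) (\<phi> t) (\<lambda>i. f (t, i))" for t
    have g: "g t \<in> G t" "\<phi> t (g t) = (\<lambda>i. f (t, i))" if "t \<in> T" for t
    proof -
      have mem: "(\<lambda>i. f (t, i)) \<in> \<phi> t ` G t"
        using f(1)[OF that] bij_betw_imp_surj_on[OF \<phi>(2)[OF that]] by simp
      show "g t \<in> G t" unfolding g_def by (rule inv_into_into[OF mem])
      show "\<phi> t (g t) = (\<lambda>i. f (t, i))" unfolding g_def by (rule f_inv_into_f[OF mem])
    qed
    have gV: "g t \<in> space R" if "t \<in> T" for t using g(1)[OF that] is_subrepD(1)[OF G[OF that]] by blast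
    define w where "w = (\<Sum>t\<in>T. g t)"
    have w: "w \<in> space R" unfolding w_def by (intro cfun.subspace_sum[OF subspace] gV)
    \<comment> \<open>The other summands are orthogonal to G t, so the projection recovers g t from
      the sum.\<close>
    have "proj (G t) w = g t" if t: "t \<in> T" for t
    proof (rule proj_eqI[OF G[OF t] w g(1)[OF t]])
      fix x assume x: "x \<in> G t"
      have "w = g t + (\<Sum>t'\<in>T - {t}. g t')"
        unfolding w_def using T(1) t by (rule sum.remove)
      then have "w - g t = (\<Sum>t'\<in>T - {t}. g t')" by simp
      moreover have "ip (g t') x = 0" if t': "t' \<in> T - {t}" for t'
      proof -
        have t'T: "t' \<in> T" using t' by blast
        have "h t' \<noteq> h t" using h(1) t t' by (auto simp: bij_betw_def inj_on_def)
        then have "ip (h t') (h t) = 0"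
          using Q(1) hQ[OF t] hQ[OF t'T] unfolding hw_family_def by blast
        then show ?thesis
          using gen_orth[OF hw[OF t'T] hw[OF t]] g(1)[OF t'T] x unfolding G_def by blast
      qed
      then have "ip (\<Sum>t'\<in>T - {t}. g t') x = 0"
        unfolding ip_def sum_fun_apply sum_distrib_right
        by (subst sum.swap) (simp add: sum.neutral)
      ultimately show "ip (w - g t) x = 0" by simp
    qed
    then have "\<Phi> w (t, i) = f (t, i)" for t i
      using g(2)[of t] f(2)[of t i] by (cases "t \<in> T") (simp_all add: \<Phi>_def)
    then have "f = \<Phi> w" by (intro ext) (metis surj_pair)
    then show "\<exists>w\<in>space R. f = \<Phi> w" using w by blast
  qed
  have equi: "\<Phi> (act R X w) = act ?D X (\<Phi> w)" if X: "X \<in> orth_alg n" and w: "w \<in> space R" for X w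
  proof
    fix ti :: "'t \<times> nat"
    obtain t i where ti: "ti = (t, i)" by force
    show "\<Phi> (act R X w) ti = act ?D X (\<Phi> w) ti"
    proof (cases "t \<in> T")
      case True
      have "\<phi> t (proj (G t) (act R X w)) = act (?L t) X (\<phi> t (proj (G t) w))"
        using proj_act[OF G[OF True] X w] \<phi>(3)[OF True X pin[OF True w]] by simp
      then show ?thesis
        using True \<Phi>[OF True, of w] by (simp add: ti direct_sum_def) (simp add: \<Phi>_def)
    qed (simp add: ti direct_sum_def \<Phi>_def)
  qed
  have "rep_iso n R ?D"
    unfolding rep_iso_def using lin bij equi by blast
  then show ?thesis using L by blast
qed

end

section \<open>Tensor powers\<close>

context unitary_rep
begin

definition coef :: "complex mat \<Rightarrow> 'i \<Rightarrow> 'i \<Rightarrow> complex" where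
  "coef X b c = act R X (unit_fun c) b"

text \<open>Words in B label the coordinate vectors of the tensor power.\<close>

definition words :: "nat \<Rightarrow> 'i list set" where
  "words N = {bs. length bs = N \<and> set bs \<subseteq> B}"

definition word_wt :: "'i list \<Rightarrow> nat \<Rightarrow> real" where
  "word_wt bs = (\<Sum>k<length bs. wt (bs ! k))"

lemma finite_words: "finite (words N)"
  using finite_lists_length_eq[OF finB, of N] by (simp add: words_def conj_commute)

lemma words_nth: "bs \<in> words N \<Longrightarrow> k < N \<Longrightarrow> bs ! k \<in> B"
  by (auto simp: words_def)

lemma words_length: "bs \<in> words N \<Longrightarrow> length bs = N"
  by (simp add: words_def)

lemma not_in_words:
  assumes "length bs = N" "bs \<notin> words N"
  obtains k where "k < N" "bs ! k \<notin> B"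
proof -
  obtain x where "x \<in> set bs" "x \<notin> B" using assms by (auto simp: words_def)
  then show ?thesis using that assms(1) by (auto simp: in_set_conv_nth)
qed

lemma words_update: "bs \<in> words N \<Longrightarrow> c \<in> B \<Longrightarrow> bs[k := c] \<in> words N"
  using set_update_subset_insert[of bs k c] by (auto simp: words_def)

lemma act_coef:
  assumes "X \<in> orth_alg n" "f \<in> space R"
  shows "act R X f b = (\<Sum>c\<in>B. coef X b c * f c)"
proof -
  have "act R X f b = (\<Sum>c\<in>B. cscale (f c) (act R X (unit_fun c))) b"
    using linear_on_expand[OF act_linear[OF assms(1)] assms(2)] by simp
  then show ?thesis
    by (simp only: sum_fun_apply cscale_def coef_def mult.commute)
qed

lemma coef_add:
  "X \<in> orth_alg n \<Longrightarrow> Y \<in> orth_alg n \<Longrightarrow> c \<in> B \<Longrightarrow> coef (X + Y) b c = coef X b c + coef Y b c"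
  by (simp add: coef_def mat_add unit_fun_space)

lemma coef_smult: "X \<in> orth_alg n \<Longrightarrow> c \<in> B \<Longrightarrow> coef (a \<cdot>\<^sub>m X) b c = a * coef X b c"
  by (simp add: coef_def mat_smult unit_fun_space cscale_def)

lemma coef_bracket:
  assumes X: "X \<in> orth_alg n" and Y: "Y \<in> orth_alg n" and c: "c \<in> B"
  shows "coef (lie_bracket X Y) b c =
    (\<Sum>d\<in>B. coef X b d * coef Y d c) - (\<Sum>d\<in>B. coef Y b d * coef X d c)"
  using act_bracket[OF X Y unit_fun_space[OF c]]
    act_coef[OF X closed[OF Y unit_fun_space[OF c]], of b]
    act_coef[OF Y closed[OF X unit_fun_space[OF c]], of b]
  by (simp add: coef_def)

lemma coef_cartan:
  assumes "i < n" "c \<in> B"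
  shows "coef (cartan_h n i) b c = (if b = c then complex_of_real (wt b i) else 0)"
  using cartan[OF assms(1) unit_fun_space[OF assms(2)]] by (simp add: coef_def unit_fun_def)

lemma coef_dagger:
  assumes X: "X \<in> orth_alg n" and bc: "b \<in> B" "c \<in> B"
  shows "cnj (coef (dagger n X) c b) = coef X b c"
proof -
  have "ip (act R X (unit_fun c)) (unit_fun b) = ip (unit_fun c) (act R (dagger n X) (unit_fun b))"
    using X bc by (intro ip_act unit_fun_space)
  moreover have "ip (unit_fun c) (act R (dagger n X) (unit_fun b)) =
      cnj (ip (act R (dagger n X) (unit_fun b)) (unit_fun c))" by (rule ip_commute)
  ultimately show ?thesis using bc by (simp add: ip_unit_fun coef_def)
qed

text \<open>Pure tensors of coordinate vectors are the indicator functions of words, and these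
  already span all functions supported on words.\<close>

lemma space_tensor_power: "space (tensor_power N R) = {F. \<forall>bs. bs \<notin> words N \<longrightarrow> F bs = 0}"
proof -
  let ?S = "{pure_tensor vs | vs. length vs = N \<and> set vs \<subseteq> space R}"
  let ?T = "{F :: 'i list \<Rightarrow> complex. \<forall>bs. bs \<notin> words N \<longrightarrow> F bs = 0}"
  have "cfun.span ?S \<subseteq> ?T"
  proof (rule cfun.span_minimal)
    show "cfun.subspace ?T" by (rule cfun.subspaceI) (auto simp: cscale_def)
    show "?S \<subseteq> ?T"
    proof (clarsimp)
      fix vs :: "('i \<Rightarrow> complex) list" and bs
      assume vs: "N = length vs" "set vs \<subseteq> space R" and bs: "bs \<notin> words (length vs)"
      show "pure_tensor vs bs = 0"
      proof (cases "length bs = length vs")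
        case True
        then obtain k where k: "k < length vs" "bs ! k \<notin> B"
          using bs by (rule not_in_words)
        moreover have "vs ! k \<in> space R" using vs(2) k(1) by auto
        ultimately have "(vs ! k) (bs ! k) = 0" by (simp add: space_eq)
        then show ?thesis using k(1) by (auto simp: pure_tensor_def)
      qed (simp add: pure_tensor_def)
    qed
  qed
  moreover have "?T \<subseteq> cfun.span ?S"
  proof
    fix F assume F: "F \<in> ?T"
    have pure: "pure_tensor (map unit_fun bs) = (\<lambda>x. if x = bs then 1 else 0)" for bs :: "'i list"
    proof
      fix x
      show "pure_tensor (map unit_fun bs) x = (if x = bs then 1 else 0)"
      proof (cases "length x = length bs \<and> x \<noteq> bs")
        case True
        then obtain k where "k < length bs" "x ! k \<noteq> bs ! k" by (auto simp: list_eq_iff_nth_eq)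
        then have "(\<Prod>k<length bs. (map unit_fun bs ! k) (x ! k)) = 0"
          by (intro prod_zero) (auto simp: unit_fun_def)
        then show ?thesis using True by (simp add: pure_tensor_def)
      qed (auto simp: pure_tensor_def unit_fun_def)
    qed
    have "F = (\<Sum>bs\<in>words N. cscale (F bs) (pure_tensor (map unit_fun bs)))"
    proof
      fix x
      have "(\<Sum>bs\<in>words N. cscale (F bs) (pure_tensor (map unit_fun bs))) x =
          (\<Sum>bs\<in>words N. if bs = x then F x else 0)"
        unfolding sum_fun_apply pure by (intro sum.cong refl) (auto simp: cscale_def)
      also have "\<dots> = F x" using F finite_words[of N] by auto
      finally show "F x = (\<Sum>bs\<in>words N. cscale (F bs) (pure_tensor (map unit_fun bs))) x" ..
    qed
    also have "\<dots> \<in> cfun.span ?S"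
    proof (intro cfun.span_sum cfun.span_scale cfun.span_base)
      fix bs assume "bs \<in> words N"
      then have "length (map unit_fun bs) = N \<and> set (map unit_fun bs) \<subseteq> space R"
        using unit_fun_space by (auto simp: words_def)
      then show "pure_tensor (map unit_fun bs) \<in> ?S" by blast
    qed
    finally show "F \<in> cfun.span ?S" .
  qed
  ultimately show ?thesis by (simp add: tensor_power_def)
qed

lemma act_tensor_power:
  assumes X: "X \<in> orth_alg n" and F: "F \<in> space (tensor_power N R)"
  shows "act (tensor_power N R) X F =
    (\<lambda>bs. if bs \<in> words N then \<Sum>k<N. \<Sum>c\<in>B. coef X (bs ! k) c * F (bs[k := c]) else 0)"
proof
  fix bs
  have F0: "F xs = 0" if "xs \<notin> words N" for xs using F that by (simp add: space_tensor_power)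
  have slice: "(\<lambda>i. F (bs[k := i])) \<in> space R" if "length bs = N" "k < N" for k
    unfolding space_eq
  proof (intro CollectI allI impI F0)
    fix b assume "b \<notin> B"
    then show "bs[k := b] \<notin> words N" using set_update_memI[of k bs b] that by (auto simp: words_def)
  qed
  show "act (tensor_power N R) X F bs =
    (if bs \<in> words N then \<Sum>k<N. \<Sum>c\<in>B. coef X (bs ! k) c * F (bs[k := c]) else 0)"
  proof (cases "bs \<in> words N")
    case True
    then have "length bs = N" by (simp add: words_def)
    then show ?thesis
      using True slice by (simp add: tensor_power_def act_coef[OF X])
  next
    case False
    show ?thesis
    proof (cases "length bs = N")
      case True
      then obtain l where l: "l < N" "bs ! l \<notin> B"
        using False by (rule not_in_words)
      \<comment> \<open>If slot k holds the letter outside B, the slice is mapped to a function that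
        vanishes at that letter. Otherwise the bad letter remains in every argument and the slice is
        zero.\<close>
      have "act R X (\<lambda>i. F (bs[k := i])) (bs ! k) = 0" if k: "k < N" for k
      proof (cases "k = l")
        case True
        have "act R X (\<lambda>i. F (bs[k := i])) \<in> space R"
          using slice[OF \<open>length bs = N\<close> k] by (rule closed[OF X])
        then show ?thesis using l True by (simp add: space_eq)
      next
        case False
        have "bs[k := i] \<notin> words N" for i
          using words_nth[of "bs[k := i]" N l] l False by auto
        then have "(\<lambda>i. F (bs[k := i])) = 0" using F0 by (auto simp: fun_eq_iff)
        then show ?thesis using act_zero[OF X] by simp
      qed
      then show ?thesis using False True by (simp add: tensor_power_def)
    qed (use False in \<open>simp add: tensor_power_def\<close>)
  qed
qed

lemma is_rep_tensor_power: "is_rep n (tensor_power N R)"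
proof -
  let ?T = "tensor_power N R"
  have sub: "cfun.subspace (space ?T)"
    unfolding space_tensor_power by (rule cfun.subspaceI) (auto simp: cscale_def)
  note act = act_tensor_power
  have cl: "act ?T X F \<in> space ?T" if "X \<in> orth_alg n" "F \<in> space ?T" for X F
    unfolding act[OF that] by (simp add: space_tensor_power)
  have add: "act ?T X (F + G) = act ?T X F + act ?T X G"
    if X: "X \<in> orth_alg n" and "F \<in> space ?T" "G \<in> space ?T" for X F G
    unfolding act[OF X that(2)] act[OF X that(3)] act[OF X cfun.subspace_add[OF sub that(2,3)]]
    by (rule ext) (simp add: distrib_left sum.distrib)
  have scale: "act ?T X (cscale a F) = cscale a (act ?T X F)"
    if X: "X \<in> orth_alg n" and F: "F \<in> space ?T" for X F a
    unfolding act[OF X F] act[OF X cfun.subspace_scale[OF sub F]]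
    by (rule ext) (simp add: cscale_def sum_distrib_left mult.left_commute)
  have madd: "act ?T (X + Y) F = act ?T X F + act ?T Y F"
    if X: "X \<in> orth_alg n" and Y: "Y \<in> orth_alg n" and F: "F \<in> space ?T" for X Y F
    unfolding act[OF X F] act[OF Y F] act[OF orth_alg_add[OF X Y] F]
    by (rule ext) (simp add: coef_add[OF X Y] distrib_right sum.distrib)
  have msmult: "act ?T (a \<cdot>\<^sub>m X) F = cscale a (act ?T X F)"
    if X: "X \<in> orth_alg n" and F: "F \<in> space ?T" for X F a
    unfolding act[OF X F] act[OF orth_alg_smult[OF X] F]
    by (rule ext) (simp add: coef_smult[OF X] cscale_def sum_distrib_left mult.assoc)
  have brack: "act ?T (lie_bracket X Y) F = act ?T X (act ?T Y F) - act ?T Y (act ?T X F)"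
    if X: "X \<in> orth_alg n" and Y: "Y \<in> orth_alg n" and F: "F \<in> space ?T" for X Y F
  proof
    fix bs
    show "act ?T (lie_bracket X Y) F bs = (act ?T X (act ?T Y F) - act ?T Y (act ?T X F)) bs"
    proof (cases "bs \<in> words N")
      case bs: True
      then have len: "length bs = N" by (simp add: words_def)
      \<comment> \<open>The term with X in slot k and Y in slot l. Terms with distinct slots cancel
        in the commutator; equal slots give the matrix products whose difference is the
        bracket.\<close>
      define U where "U X Y k l = (\<Sum>c\<in>B. \<Sum>d\<in>B.
          coef X (bs ! k) c * (coef Y (bs[k := c] ! l) d * F (bs[k := c, l := d])))" for X Y k l
      have comp: "act ?T X (act ?T Y F) bs = (\<Sum>k<N. \<Sum>l<N. U X Y k l)"
        if X: "X \<in> orth_alg n" and Y: "Y \<in> orth_alg n" for X Y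
      proof -
        have "act ?T X (act ?T Y F) bs = (\<Sum>k<N. \<Sum>c\<in>B. coef X (bs ! k) c *
            (\<Sum>l<N. \<Sum>d\<in>B. coef Y (bs[k := c] ! l) d * F (bs[k := c, l := d])))"
          unfolding act[OF X cl[OF Y F]] using bs
          by (simp add: act[OF Y F] words_update)
        also have "\<dots> = (\<Sum>k<N. \<Sum>c\<in>B. \<Sum>l<N. \<Sum>d\<in>B. coef X (bs ! k) c *
            (coef Y (bs[k := c] ! l) d * F (bs[k := c, l := d])))"
          by (simp only: sum_distrib_left)
        also have "\<dots> = (\<Sum>k<N. \<Sum>l<N. U X Y k l)"
          unfolding U_def by (rule sum.cong[OF refl], rule sum.swap)
        finally show ?thesis .
      qed
      have off: "U X Y k l = U Y X l k" if "k < N" "l < N" "k \<noteq> l" for k l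
      proof -
        have "U X Y k l = (\<Sum>c\<in>B. \<Sum>d\<in>B. coef Y (bs ! l) d * (coef X (bs[l := d] ! k) c * F (bs[l := d, k := c])))"
          unfolding U_def using that
          by (intro sum.cong refl) (simp add: list_update_swap[of k l] mult.left_commute)
        also have "\<dots> = U Y X l k" unfolding U_def by (rule sum.swap)
        finally show ?thesis .
      qed
      have diag: "U X Y k k = (\<Sum>d\<in>B. (\<Sum>c\<in>B. coef X (bs ! k) c * coef Y c d) * F (bs[k := d]))"
        if "k < N" for X Y k
      proof -
        have "U X Y k k = (\<Sum>c\<in>B. \<Sum>d\<in>B. coef X (bs ! k) c * coef Y c d * F (bs[k := d]))"
          unfolding U_def using that len by (intro sum.cong refl) (simp add: mult.assoc)
        also have "\<dots> = (\<Sum>d\<in>B. \<Sum>c\<in>B. coef X (bs ! k) c * coef Y c d * F (bs[k := d]))"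
          by (rule sum.swap)
        finally show ?thesis by (simp only: sum_distrib_right)
      qed
      have "(act ?T X (act ?T Y F) - act ?T Y (act ?T X F)) bs =
          (\<Sum>k<N. \<Sum>l<N. U X Y k l) - (\<Sum>k<N. \<Sum>l<N. U Y X k l)"
        using comp[OF X Y] comp[OF Y X] by simp
      also have "(\<Sum>k<N. \<Sum>l<N. U Y X k l) = (\<Sum>k<N. \<Sum>l<N. U Y X l k)" by (rule sum.swap)
      also have "(\<Sum>k<N. \<Sum>l<N. U X Y k l) - (\<Sum>k<N. \<Sum>l<N. U Y X l k) =
          (\<Sum>k<N. \<Sum>l<N. if l = k then U X Y k k - U Y X k k else 0)"
        unfolding sum_subtractf[symmetric] using off by (intro sum.cong refl) auto
      also have "\<dots> = (\<Sum>k<N. U X Y k k - U Y X k k)" by simp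
      also have "\<dots> = (\<Sum>k<N. \<Sum>c\<in>B. coef (lie_bracket X Y) (bs ! k) c * F (bs[k := c]))"
        by (intro sum.cong refl)
           (simp add: diag coef_bracket[OF X Y] left_diff_distrib sum_subtractf)
      also have "\<dots> = act ?T (lie_bracket X Y) F bs"
        unfolding act[OF orth_alg_bracket[OF X Y] F] using bs by simp
      finally show ?thesis ..
    next
      case False
      then show ?thesis
        by (simp add: act[OF orth_alg_bracket[OF X Y] F] act[OF X cl[OF Y F]] act[OF Y cl[OF X F]])
    qed
  qed
  show ?thesis
    unfolding is_rep_def linear_on_def
    by (intro conjI ballI allI sub image_subsetI cl add scale madd msmult brack)
qed

lemma unitary_tensor_power: "unitary_rep n (tensor_power N R) (words N) word_wt"
proof -
  let ?T = "tensor_power N R"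
  interpret T: orth_rep n ?T by unfold_locales (rule is_rep_tensor_power)
  have coord: "word_wt bs i = (\<Sum>k<N. wt (bs ! k) i)" if "bs \<in> words N" for bs i
    using that by (simp add: word_wt_def sum_fun_apply words_def)
  show ?thesis
  proof (unfold_locales, goal_cases)
    case 1 show ?case by (rule n2)
  next
    case 2 show ?case by (rule finite_words)
  next
    case 3 show ?case by (rule space_tensor_power)
  next
    case (4 i F)
    show ?case
    proof
      fix bs
      show "act ?T (cartan_h n i) F bs = complex_of_real (word_wt bs i) * F bs"
      proof (cases "bs \<in> words N")
        case True
        have "act ?T (cartan_h n i) F bs =
            (\<Sum>k<N. \<Sum>c\<in>B. if c = bs ! k then complex_of_real (wt (bs ! k) i) * F bs else 0)"
          unfolding act_tensor_power[OF cartan_h_orth[OF 4(1)] 4(2)] if_P[OF True]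
          by (intro sum.cong refl) (auto simp: coef_cartan[OF 4(1)])
        also have "\<dots> = (\<Sum>k<N. complex_of_real (wt (bs ! k) i) * F bs)"
          using finB words_nth[OF True] by (intro sum.cong refl) simp
        finally show ?thesis by (simp add: coord[OF True] sum_distrib_right)
      next
        case False
        then show ?thesis
          using 4(2) unfolding act_tensor_power[OF cartan_h_orth[OF 4(1)] 4(2)]
          by (simp add: space_tensor_power)
      qed
    qed
  next
    case (5 bs i)
    then show ?case using wt_zero words_nth[OF 5(1)] by (simp add: coord[OF 5(1)])
  next
    case (6 bs)
    have "(\<forall>i<n. (\<Sum>k<m. wt (bs ! k) i) \<in> \<int>) \<or> (\<forall>i<n. (\<Sum>k<m. wt (bs ! k) i) - 1 / 2 \<in> \<int>)" if "m \<le> N" for m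
      using that
    proof (induction m)
      case (Suc m)
      \<comment> \<open>Two half-integral weights have an integral sum, so the class is followed
        along the prefixes of the word, starting from the integral empty prefix.\<close>
      have half: "a + b \<in> \<int>" if "a - 1 / 2 \<in> \<int>" "b - 1 / 2 \<in> \<int>" for a b :: real
        using Ints_add[OF Ints_add[OF that] Ints_1] by simp
      have l: "(\<forall>i<n. wt (bs ! m) i \<in> \<int>) \<or> (\<forall>i<n. wt (bs ! m) i - 1 / 2 \<in> \<int>)"
        using Suc.prems by (intro lattice words_nth[OF 6]) simp
      have "(\<forall>i<n. (\<Sum>k<m. wt (bs ! k) i) \<in> \<int>) \<or> (\<forall>i<n. (\<Sum>k<m. wt (bs ! k) i) - 1 / 2 \<in> \<int>)"
        using Suc by simp
      then show ?case
        using l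
        by (elim disjE) (auto intro: Ints_add half simp: add_diff_eq[symmetric] diff_add_eq[symmetric])
    qed simp
    then show ?case using coord[OF 6] by simp
  next
    case (7 X F G)
    have D: "dagger n X \<in> orth_alg n" by (rule orth_alg_dagger[OF 7(1)])
    have "(\<Sum>bs\<in>words N. act ?T X F bs * cnj (G bs)) =
        (\<Sum>bs\<in>words N. \<Sum>k<N. \<Sum>c\<in>B. coef X (bs ! k) c * F (bs[k := c]) * cnj (G bs))"
      unfolding act_tensor_power[OF 7(1,2)] by (intro sum.cong refl) (simp add: sum_distrib_right)
    also have "\<dots> = (\<Sum>k<N. \<Sum>bs\<in>words N. \<Sum>c\<in>B. coef X (bs ! k) c * F (bs[k := c]) * cnj (G bs))"
      by (rule sum.swap)
    also have "\<dots> = (\<Sum>k<N. \<Sum>bs\<in>words N. \<Sum>c\<in>B. coef X c (bs ! k) * F bs * cnj (G (bs[k := c])))"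
    proof (rule sum.cong[OF refl])
      fix k assume k: "k \<in> {..<N}"
      \<comment> \<open>Exchanging the letter with the k-th letter of the word is an involution on
        pairs of a word and a letter. It transposes the matrix of X in slot k.\<close>
      let ?s = "\<lambda>p. ((fst p)[k := snd p], fst p ! k)"
      have "(\<Sum>p\<in>words N \<times> B. coef X (fst p ! k) (snd p) * F ((fst p)[k := snd p]) * cnj (G (fst p))) =
          (\<Sum>p\<in>words N \<times> B. coef X (snd p) (fst p ! k) * F (fst p) * cnj (G ((fst p)[k := snd p])))"
        using k by (intro sum.reindex_bij_witness[where i = ?s and j = ?s])
          (auto simp: words_length words_nth words_update)
      then show "(\<Sum>bs\<in>words N. \<Sum>c\<in>B. coef X (bs ! k) c * F (bs[k := c]) * cnj (G bs)) =
          (\<Sum>bs\<in>words N. \<Sum>c\<in>B. coef X c (bs ! k) * F bs * cnj (G (bs[k := c])))"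
        by (simp add: sum.cartesian_product case_prod_beta')
    qed
    also have "\<dots> = (\<Sum>bs\<in>words N. \<Sum>k<N. \<Sum>c\<in>B. coef X c (bs ! k) * F bs * cnj (G (bs[k := c])))"
      by (rule sum.swap)
    also have "\<dots> = (\<Sum>bs\<in>words N. F bs * cnj (act ?T (dagger n X) G bs))"
    proof (intro sum.cong refl)
      fix bs assume bs: "bs \<in> words N"
      have "cnj (act ?T (dagger n X) G bs) = (\<Sum>k<N. \<Sum>c\<in>B. coef X c (bs ! k) * cnj (G (bs[k := c])))"
        unfolding act_tensor_power[OF D 7(3)] using bs words_nth[OF bs]
        by (simp add: coef_dagger[OF 7(1)])
      then show "(\<Sum>k<N. \<Sum>c\<in>B. coef X c (bs ! k) * F bs * cnj (G (bs[k := c]))) =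
          F bs * cnj (act ?T (dagger n X) G bs)"
        by (simp add: sum_distrib_left mult_ac)
    qed
    finally show ?case .
  qed
qed

lemma char_words: "(\<Sum>bs\<in>words N. xexp (word_wt bs)) = (\<Sum>b\<in>B. xexp (wt b)) ^ N"
proof (induction N)
  case 0
  have "words 0 = {[]}" by (auto simp: words_def)
  moreover have "xexp (word_wt []) = 1"
    by (simp only: word_wt_def list.size lessThan_0 sum.empty xexp_zero)
  ultimately show ?case by simp
next
  case (Suc N)
  have img: "words (Suc N) = (\<lambda>(b, bs). b # bs) ` (B \<times> words N)"
    by (auto simp: words_def length_Suc_conv image_iff)
  have inj: "inj_on (\<lambda>(b, bs). b # bs) (B \<times> words N)" by (auto simp: inj_on_def)
  have wt: "xexp (word_wt (b # bs)) = xexp (wt b) * xexp (word_wt bs)" for b bs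
    unfolding word_wt_def xexp_add[symmetric] by (simp add: sum.lessThan_Suc_shift del: sum.lessThan_Suc)
  have "(\<Sum>bs\<in>words (Suc N). xexp (word_wt bs)) = (\<Sum>p\<in>B \<times> words N. xexp (wt (fst p)) * xexp (word_wt (snd p)))"
    unfolding img sum.reindex[OF inj] by (intro sum.cong refl) (auto simp: wt)
  also have "\<dots> = (\<Sum>b\<in>B. xexp (wt b)) * (\<Sum>bs\<in>words N. xexp (word_wt bs))"
    by (simp add: sum_product sum.cartesian_product case_prod_beta')
  finally show ?case using Suc.IH by simp
qed

end

section \<open>The spinor representation\<close>

text \<open>The generators of the Clifford algebra of the symmetric form, as operators on the
  exterior algebra. With them the three parts of \<open>spinor_act\<close> become one quadratic
  expression.\<close>

definition gam :: "nat \<Rightarrow> nat \<Rightarrow> (nat set \<Rightarrow> complex) \<Rightarrow> nat set \<Rightarrow> complex" where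
  "gam n a = (if a < n then ext_mult a else ext_contract (a - n))"

lemma ext_add: "ext_mult i (f + g) = ext_mult i f + ext_mult i g"
    "ext_contract i (f + g) = ext_contract i f + ext_contract i g"
  by (auto simp: ext_mult_def ext_contract_def fun_eq_iff distrib_left)

lemma ext_scale: "ext_mult i (cscale c f) = cscale c (ext_mult i f)"
    "ext_contract i (cscale c f) = cscale c (ext_contract i f)"
  by (auto simp: ext_mult_def ext_contract_def fun_eq_iff cscale_def)

lemma gam_add: "gam n a (f + g) = gam n a f + gam n a g"
  by (simp only: gam_def ext_add split: if_split) simp

lemma gam_scale: "gam n a (cscale c f) = cscale c (gam n a f)"
  by (simp only: gam_def ext_scale split: if_split) simp

lemma gam_zero: "gam n a 0 = 0"
  using gam_scale[of n a 0 0] by simp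

lemma gam_sum: "gam n a (\<Sum>x\<in>A. f x) = (\<Sum>x\<in>A. gam n a (f x))"
proof (cases "finite A")
  case True
  then have "gam n a (sum f A) = (\<Sum>x\<in>A. gam n a (f x))"
  proof (induction A rule: finite_induct)
    case (insert x A)
    then have "gam n a (sum f (insert x A)) = (\<Sum>x\<in>insert x A. gam n a (f x))"
      by (simp only: sum.insert not_False_eq_True gam_add)
    then show ?case .
  qed (use gam_zero in \<open>simp only: sum.empty\<close>)
  then show ?thesis .
next
  case False
  then show ?thesis using gam_zero by (simp only: sum.infinite not_False_eq_True)
qed

lemma gam_diff: "gam n a (f - g) = gam n a f - gam n a g"
  using gam_add[of n a "f - g" g] by simp

lemma ext_sign_square: "ext_sign i I * (ext_sign i I * x) = x"
  by (simp add: ext_sign_def flip: mult.assoc power_mult_distrib)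

lemma ext_mult_contract:
  "ext_mult i (ext_contract j f) + ext_contract j (ext_mult i f) = (if i = j then f else 0)"
proof (cases i j rule: linorder_cases)
  case equal
  then show ?thesis
    by (auto simp: fun_eq_iff ext_mult_def ext_contract_def ext_sign_remove ext_sign_insert
        insert_absorb ext_sign_square)
next
  case less
  then show ?thesis
    by (auto simp: fun_eq_iff ext_mult_def ext_contract_def ext_sign_remove ext_sign_insert
        insert_Diff_if)
next
  case greater
  then show ?thesis
    by (auto simp: fun_eq_iff ext_mult_def ext_contract_def ext_sign_remove ext_sign_insert
        insert_Diff_if)
qed

text \<open>The Clifford relation for the form that pairs a with \<open>bar n a\<close>.\<close>

lemma gam_anticommute:
  assumes "a < 2 * n" "b < 2 * n"
  shows "gam n a (gam n b f) = cscale (if b = bar n a then 1 else 0) f - gam n b (gam n a f)"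
proof -
  have zero: "cscale 0 f = 0" by simp
  consider "a < n" "b < n" | "a < n" "\<not> b < n" | "\<not> a < n" "b < n" | "\<not> a < n" "\<not> b < n" by blast
  then show ?thesis
  proof cases
    case 1
    then show ?thesis using ext_mult_anticomm[of a b f] by (simp add: gam_def bar_def)
  next
    case 2
    then have "b = bar n a \<longleftrightarrow> a = b - n" by (auto simp: bar_def)
    then show ?thesis
      using 2 ext_mult_contract[of a "b - n" f] by (simp add: gam_def eq_diff_eq)
  next
    case 3
    then have "b = bar n a \<longleftrightarrow> b = a - n" by (auto simp: bar_def)
    then show ?thesis
      using 3 ext_mult_contract[of b "a - n" f] by (simp add: gam_def eq_diff_eq add.commute)
  next
    case 4
    then have "b \<noteq> bar n a" using assms by (auto simp: bar_def)
    then show ?thesis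
      using 4 ext_contract_anticomm[of "a - n" "b - n" f] by (simp add: gam_def)
  qed
qed

lemma sum_root_pairs: "(\<Sum>(i, j)\<in>root_pairs n. f i j) = (\<Sum>j<n. \<Sum>i<j. f i j)"
proof -
  have "(\<Sum>j<n. \<Sum>i<j. f i j) = (\<Sum>p\<in>(SIGMA j:{..<n}. {..<j}). f (snd p) (fst p))"
    by (simp add: sum.Sigma case_prod_beta')
  also have "\<dots> = (\<Sum>p\<in>root_pairs n. f (fst p) (snd p))"
    by (intro sum.reindex_bij_witness[where i = prod.swap and j = prod.swap]) (auto simp: root_pairs_def)
  finally show ?thesis by (simp add: case_prod_beta')
qed

text \<open>By skewness of X, products of two multiplications or of two contractions occur twice,
  while the entry at (i + n, j + n), the negative of that at (j, i), supplies the second half of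
  each commutator. The factor 1/2 suits both.\<close>

lemma spinor_act_gam:
  assumes X: "X \<in> orth_alg n"
  shows "spinor_act n X f I = (\<Sum>a<2 * n. \<Sum>b<2 * n. X $$ (a, bar n b) * gam n a (gam n b f) I) / 2"
proof -
  have e: "X $$ (i + n, j + n) = - X $$ (j, i)" "X $$ (j, i + n) = - X $$ (i, j + n)"
    "X $$ (j + n, i) = - X $$ (i + n, j)" if "i < n" "j < n" for i j
    using orth_alg_bar[OF X, of i j] orth_alg_bar[OF X, of "j + n" i] orth_alg_bar[OF X, of j "i + n"] that
    by (auto simp: bar_def)
  have skew: "(\<Sum>i<n. \<Sum>j<n. h i j) = 2 * (\<Sum>j<n. \<Sum>i<j. h i j)"
    if "\<And>i j. i < n \<Longrightarrow> j < n \<Longrightarrow> i \<noteq> j \<Longrightarrow> h j i = h i j" "\<And>i. i < n \<Longrightarrow> h i i = 0"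
    for h :: "nat \<Rightarrow> nat \<Rightarrow> complex"
  proof -
    have "(\<Sum>i<n. \<Sum>j<n. h i j) = (\<Sum>i<n. h i i) + (\<Sum>(i, j)\<in>root_pairs n. h i j + h j i)"
      by (rule sum_square_split)
    also have "(\<Sum>i<n. h i i) = 0" using that(2) by (intro sum.neutral) simp
    also have "(\<Sum>(i, j)\<in>root_pairs n. h i j + h j i) = (\<Sum>(i, j)\<in>root_pairs n. 2 * h i j)"
      using that(1) by (intro sum.cong refl) (auto simp: root_pairs_def)
    also have "\<dots> = 2 * (\<Sum>j<n. \<Sum>i<j. h i j)"
      unfolding sum_root_pairs sum_distrib_left ..
    finally show ?thesis by simp
  qed
  let ?M = ext_mult and ?D = ext_contract
  have "(\<Sum>a<2 * n. \<Sum>b<2 * n. X $$ (a, bar n b) * gam n a (gam n b f) I) =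
      (\<Sum>i<n. \<Sum>j<n. X $$ (i, j + n) * ?M i (?M j f) I) + (\<Sum>i<n. \<Sum>j<n. X $$ (i, j) * ?M i (?D j f) I) +
      ((\<Sum>i<n. \<Sum>j<n. X $$ (i + n, j + n) * ?D i (?M j f) I) + (\<Sum>i<n. \<Sum>j<n. X $$ (i + n, j) * ?D i (?D j f) I))"
    unfolding sum_double sum.distrib[symmetric] by (intro sum.cong refl) (simp add: gam_def bar_def)
  also have "(\<Sum>i<n. \<Sum>j<n. X $$ (i, j + n) * ?M i (?M j f) I) =
      2 * (\<Sum>j<n. \<Sum>i<j. X $$ (i, j + n) * ?M i (?M j f) I)"
  proof (rule skew)
    fix i j assume "i < n" "j < n"
    then show "X $$ (j, i + n) * ?M j (?M i f) I = X $$ (i, j + n) * ?M i (?M j f) I"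
      using ext_mult_anticomm[of j i f] e(2)[of i j] by simp
  next
    fix i assume "i < n"
    then have "X $$ (i, i + n) = 0" using e(2)[of i i] by (simp add: equal_neg_zero)
    then show "X $$ (i, i + n) * ?M i (?M i f) I = 0" by simp
  qed
  also have "(\<Sum>i<n. \<Sum>j<n. X $$ (i + n, j) * ?D i (?D j f) I) =
      2 * (\<Sum>j<n. \<Sum>i<j. X $$ (i + n, j) * ?D i (?D j f) I)"
  proof (rule skew)
    fix i j assume "i < n" "j < n"
    then show "X $$ (j + n, i) * ?D j (?D i f) I = X $$ (i + n, j) * ?D i (?D j f) I"
      using ext_contract_anticomm[of j i f] e(3)[of i j] by simp
  next
    fix i assume "i < n"
    then have "X $$ (i + n, i) = 0" using e(3)[of i i] by (simp add: equal_neg_zero)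
    then show "X $$ (i + n, i) * ?D i (?D i f) I = 0" by simp
  qed
  also have "(\<Sum>i<n. \<Sum>j<n. X $$ (i + n, j + n) * ?D i (?M j f) I) = (\<Sum>i<n. \<Sum>j<n. - (X $$ (i, j) * ?D j (?M i f) I))"
    by (subst sum.swap) (intro sum.cong refl, simp add: e(1))
  finally show ?thesis
    unfolding spinor_act_def
    by (simp add: sum_fun_apply cscale_def sum_negf sum_subtractf right_diff_distrib sum_divide_distrib[symmetric]
        add_divide_distrib diff_divide_distrib)
qed

text \<open>Moving \<open>gam n c\<close> through the quadratic expression leaves two linear
  correction terms. They are equal by skewness of X, which absorbs the factor 1/2. So
  \<open>gam n c\<close> transforms under X like the c-th basis vector of the vector
  representation.\<close>

lemma spinor_act_gam_commute:
  assumes X: "X \<in> orth_alg n" and c: "c < 2 * n"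
  shows "spinor_act n X (gam n c f) = gam n c (spinor_act n X f) + (\<Sum>a<2 * n. cscale (X $$ (a, c)) (gam n a f))"
proof
  fix I
  define \<delta> :: "nat \<Rightarrow> nat \<Rightarrow> complex" where "\<delta> a b = (if a = bar n b then 1 else 0)" for a b
  have triple: "gam n a (gam n b (gam n c f)) I =
      gam n c (gam n a (gam n b f)) I + \<delta> b c * gam n a f I - \<delta> a c * gam n b f I"
    if ab: "a < 2 * n" "b < 2 * n" for a b
  proof -
    have dd: "(if c = bar n b then 1 else 0) = \<delta> b c" "(if c = bar n a then 1 else 0) = \<delta> a c"
      using ab c bar_bar unfolding \<delta>_def by metis+
    have "gam n a (gam n b (gam n c f)) = gam n a (cscale (\<delta> b c) f - gam n c (gam n b f))"
      using gam_anticommute[OF ab(2) c, of f] unfolding dd by simp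
    also have "\<dots> = cscale (\<delta> b c) (gam n a f) - (cscale (\<delta> a c) (gam n b f) - gam n c (gam n a (gam n b f)))"
      unfolding gam_diff gam_scale using gam_anticommute[OF ab(1) c, of "gam n b f"] unfolding dd by simp
    finally show ?thesis by (simp add: cscale_def)
  qed
  have spin: "spinor_act n X f = cscale (1 / 2) (\<Sum>a<2 * n. \<Sum>b<2 * n. cscale (X $$ (a, bar n b)) (gam n a (gam n b f)))" for f
    by (rule ext) (simp add: spinor_act_gam[OF X] cscale_def sum_fun_apply)
  have gs: "gam n c (spinor_act n X f) I =
      (\<Sum>a<2 * n. \<Sum>b<2 * n. X $$ (a, bar n b) * gam n c (gam n a (gam n b f)) I) / 2"
    unfolding spin gam_scale gam_sum by (simp add: cscale_def sum_fun_apply)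
  have d1: "(\<Sum>b<2 * n. X $$ (a, bar n b) * (\<delta> b c * gam n a f I)) = X $$ (a, c) * gam n a f I" for a
  proof -
    have "(\<Sum>b<2 * n. X $$ (a, bar n b) * (\<delta> b c * gam n a f I)) =
        (\<Sum>b<2 * n. if b = bar n c then X $$ (a, c) * gam n a f I else 0)"
      using c by (intro sum.cong refl) (auto simp: \<delta>_def)
    then show ?thesis using c by simp
  qed
  have d2: "(\<Sum>a<2 * n. X $$ (a, bar n b) * (\<delta> a c * gam n b f I)) = - (X $$ (b, c) * gam n b f I)" if "b < 2 * n" for b
  proof -
    have "(\<Sum>a<2 * n. X $$ (a, bar n b) * (\<delta> a c * gam n b f I)) =
        (\<Sum>a<2 * n. if a = bar n c then X $$ (bar n c, bar n b) * gam n b f I else 0)"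
      by (intro sum.cong refl) (auto simp: \<delta>_def)
    then show ?thesis using c orth_alg_bar[OF X c that] by simp
  qed
  have "2 * spinor_act n X (gam n c f) I =
      (\<Sum>a<2 * n. \<Sum>b<2 * n. X $$ (a, bar n b) * gam n c (gam n a (gam n b f)) I +
        X $$ (a, bar n b) * (\<delta> b c * gam n a f I) - X $$ (a, bar n b) * (\<delta> a c * gam n b f I))"
    unfolding spinor_act_gam[OF X] by (simp add: triple algebra_simps)
  also have "\<dots> = 2 * gam n c (spinor_act n X f) I +
      (\<Sum>a<2 * n. \<Sum>b<2 * n. X $$ (a, bar n b) * (\<delta> b c * gam n a f I)) -
      (\<Sum>b<2 * n. \<Sum>a<2 * n. X $$ (a, bar n b) * (\<delta> a c * gam n b f I))"
    unfolding sum_subtractf sum.distrib gs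
    by (subst (4) sum.swap) simp
  also have "(\<Sum>a<2 * n. \<Sum>b<2 * n. X $$ (a, bar n b) * (\<delta> b c * gam n a f I)) =
      (\<Sum>a<2 * n. X $$ (a, c) * gam n a f I)"
    unfolding d1 ..
  also have "(\<Sum>b<2 * n. \<Sum>a<2 * n. X $$ (a, bar n b) * (\<delta> a c * gam n b f I)) =
      - (\<Sum>b<2 * n. X $$ (b, c) * gam n b f I)"
    unfolding sum_negf[symmetric] by (intro sum.cong refl) (simp only: d2 lessThan_iff)
  finally have "2 * spinor_act n X (gam n c f) I =
      2 * (gam n c (spinor_act n X f) I + (\<Sum>a<2 * n. X $$ (a, c) * gam n a f I))"
    by (simp add: algebra_simps)
  then have "spinor_act n X (gam n c f) I = gam n c (spinor_act n X f) I + (\<Sum>a<2 * n. X $$ (a, c) * gam n a f I)"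
    by (simp only: mult_cancel_left) simp
  then show "spinor_act n X (gam n c f) I =
      (gam n c (spinor_act n X f) + (\<Sum>a<2 * n. cscale (X $$ (a, c)) (gam n a f))) I"
    by (simp add: sum_fun_apply cscale_def)
qed

lemma spinor_act_sum:
  assumes X: "X \<in> orth_alg n"
  shows "spinor_act n X (\<Sum>x\<in>A. cscale (c x) (f x)) = (\<Sum>x\<in>A. cscale (c x) (spinor_act n X (f x)))"
proof
  fix I
  have "spinor_act n X (\<Sum>x\<in>A. cscale (c x) (f x)) I =
      (\<Sum>a<2 * n. \<Sum>b<2 * n. \<Sum>x\<in>A. X $$ (a, bar n b) * (c x * gam n a (gam n b (f x)) I)) / 2"
    unfolding spinor_act_gam[OF X] gam_sum gam_scale
    by (simp add: sum_fun_apply cscale_def sum_distrib_left)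
  also have "\<dots> = (\<Sum>x\<in>A. \<Sum>a<2 * n. \<Sum>b<2 * n. X $$ (a, bar n b) * (c x * gam n a (gam n b (f x)) I)) / 2"
    by (subst sum.swap[of _ A], subst sum.swap[of _ A]) (rule refl)
  also have "\<dots> = (\<Sum>x\<in>A. cscale (c x) (spinor_act n X (f x))) I"
    unfolding sum_fun_apply cscale_def spinor_act_gam[OF X] sum_divide_distrib
    by (intro sum.cong refl) (simp add: sum_distrib_left mult.left_commute sum_divide_distrib)
  finally show "spinor_act n X (\<Sum>x\<in>A. cscale (c x) (f x)) I = (\<Sum>x\<in>A. cscale (c x) (spinor_act n X (f x))) I" .
qed


text \<open>Y is written as a quadratic expression and X is moved through both factors of each term.
  The extra terms form again a quadratic expression, whose coefficients are the entries of the
  bracket.\<close>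

lemma spinor_act_bracket:
  assumes X: "X \<in> orth_alg n" and Y: "Y \<in> orth_alg n"
  shows "spinor_act n (lie_bracket X Y) f = spinor_act n X (spinor_act n Y f) - spinor_act n Y (spinor_act n X f)"
proof
  fix I
  let ?g = "\<lambda>a b. gam n a (gam n b f) I"
  have spin: "spinor_act n Y f = (\<Sum>p\<in>{..<2 * n} \<times> {..<2 * n}.
      cscale (Y $$ (fst p, bar n (snd p)) / 2) (gam n (fst p) (gam n (snd p) f)))" for f
    by (rule ext) (simp add: spinor_act_gam[OF Y] cscale_def sum_fun_apply sum_divide_distrib
        sum.cartesian_product case_prod_beta')
  have two: "spinor_act n X (gam n a (gam n b f)) I = gam n a (gam n b (spinor_act n X f)) I +
      ((\<Sum>c<2 * n. X $$ (c, b) * ?g a c) + (\<Sum>c<2 * n. X $$ (c, a) * ?g c b))"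
    if "a < 2 * n" "b < 2 * n" for a b
    using that by (simp add: spinor_act_gam_commute[OF X] gam_add gam_sum gam_scale)
      (simp add: sum_fun_apply cscale_def)
  have "spinor_act n X (spinor_act n Y f) I =
      (\<Sum>a<2 * n. \<Sum>b<2 * n. Y $$ (a, bar n b) / 2 * spinor_act n X (gam n a (gam n b f)) I)"
    unfolding spin[of f] spinor_act_sum[OF X]
    by (simp add: sum_fun_apply cscale_def sum.cartesian_product case_prod_beta')
  also have "\<dots> = (\<Sum>a<2 * n. \<Sum>b<2 * n. Y $$ (a, bar n b) / 2 * gam n a (gam n b (spinor_act n X f)) I +
      ((\<Sum>c<2 * n. Y $$ (a, bar n b) * X $$ (c, b) * ?g a c) + (\<Sum>c<2 * n. X $$ (c, a) * Y $$ (a, bar n b) * ?g c b)) / 2)"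
    by (intro sum.cong refl) (simp add: two distrib_left sum_distrib_left add_divide_distrib sum_divide_distrib mult_ac)
  also have "\<dots> = spinor_act n Y (spinor_act n X f) I +
      ((\<Sum>a<2 * n. \<Sum>b<2 * n. \<Sum>c<2 * n. Y $$ (a, bar n b) * X $$ (c, b) * ?g a c) +
       (\<Sum>a<2 * n. \<Sum>b<2 * n. \<Sum>c<2 * n. X $$ (c, a) * Y $$ (a, bar n b) * ?g c b)) / 2"
    unfolding spinor_act_gam[OF Y, of "spinor_act n X f"]
    by (simp add: sum.distrib sum_divide_distrib add_divide_distrib)
  also have "(\<Sum>a<2 * n. \<Sum>b<2 * n. \<Sum>c<2 * n. Y $$ (a, bar n b) * X $$ (c, b) * ?g a c) =
      (\<Sum>a<2 * n. \<Sum>c<2 * n. - (\<Sum>b<2 * n. Y $$ (a, b) * X $$ (b, bar n c)) * ?g a c)"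
  proof (rule sum.cong[OF refl])
    fix a assume "a \<in> {..<2 * n}"
    have "(\<Sum>b<2 * n. Y $$ (a, b) * X $$ (b, bar n c)) = - (\<Sum>b<2 * n. Y $$ (a, bar n b) * X $$ (c, b))"
      if "c < 2 * n" for c
    proof -
      have "(\<Sum>b<2 * n. Y $$ (a, b) * X $$ (b, bar n c)) = (\<Sum>b<2 * n. Y $$ (a, bar n b) * X $$ (bar n b, bar n c))"
        by (rule sum_bar[symmetric])
      also have "\<dots> = (\<Sum>b<2 * n. - (Y $$ (a, bar n b) * X $$ (c, b)))"
        using that by (intro sum.cong refl) (simp add: orth_alg_bar[OF X])
      finally show ?thesis by (simp add: sum_negf)
    qed
    then have "(\<Sum>c<2 * n. - (\<Sum>b<2 * n. Y $$ (a, b) * X $$ (b, bar n c)) * ?g a c) =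
        (\<Sum>c<2 * n. \<Sum>b<2 * n. Y $$ (a, bar n b) * X $$ (c, b) * ?g a c)"
      by (intro sum.cong refl) (simp add: sum_distrib_right)
    also have "\<dots> = (\<Sum>b<2 * n. \<Sum>c<2 * n. Y $$ (a, bar n b) * X $$ (c, b) * ?g a c)" by (rule sum.swap)
    finally show "(\<Sum>b<2 * n. \<Sum>c<2 * n. Y $$ (a, bar n b) * X $$ (c, b) * ?g a c) =
        (\<Sum>c<2 * n. - (\<Sum>b<2 * n. Y $$ (a, b) * X $$ (b, bar n c)) * ?g a c)" ..
  qed
  also have "(\<Sum>a<2 * n. \<Sum>b<2 * n. \<Sum>c<2 * n. X $$ (c, a) * Y $$ (a, bar n b) * ?g c b) =
      (\<Sum>c<2 * n. \<Sum>b<2 * n. \<Sum>a<2 * n. X $$ (c, a) * Y $$ (a, bar n b) * ?g c b)"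
    by (rule sum_triple_reverse)
  also have "\<dots> = (\<Sum>c<2 * n. \<Sum>b<2 * n. (\<Sum>a<2 * n. X $$ (c, a) * Y $$ (a, bar n b)) * ?g c b)"
    by (simp only: sum_distrib_right)
  also have "(\<Sum>a<2 * n. \<Sum>c<2 * n. - (\<Sum>b<2 * n. Y $$ (a, b) * X $$ (b, bar n c)) * ?g a c) + \<dots> =
      (\<Sum>c<2 * n. \<Sum>b<2 * n. lie_bracket X Y $$ (c, bar n b) * ?g c b)"
    unfolding sum.distrib[symmetric]
    by (intro sum.cong refl)
       (simp add: lie_bracket_index[OF orth_alg_carrier[OF X] orth_alg_carrier[OF Y]] left_diff_distrib)
  finally have "spinor_act n X (spinor_act n Y f) I =
      spinor_act n Y (spinor_act n X f) I + spinor_act n (lie_bracket X Y) f I"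
    unfolding spinor_act_gam[OF orth_alg_bracket[OF X Y]] .
  then show "spinor_act n (lie_bracket X Y) f I =
      (spinor_act n X (spinor_act n Y f) - spinor_act n Y (spinor_act n X f)) I" by simp
qed

lemma gam_closed:
  assumes "a < 2 * n" "f \<in> ext_space n"
  shows "gam n a f \<in> ext_space n"
proof (cases "a < n")
  case True
  have "f (I - {a}) = 0" if "\<not> I \<subseteq> {..<n}" for I
  proof -
    have "\<not> I - {a} \<subseteq> {..<n}" using that True by auto
    then show ?thesis using assms(2) by (simp add: ext_space_def)
  qed
  then show ?thesis using True by (auto simp: gam_def ext_mult_def ext_space_def)
next
  case False
  have "f (insert (a - n) I) = 0" if "\<not> I \<subseteq> {..<n}" for I
    using that assms(2) by (auto simp: ext_space_def)
  then show ?thesis using False by (auto simp: gam_def ext_contract_def ext_space_def)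
qed

lemma spinor_act_closed:
  assumes X: "X \<in> orth_alg n" and f: "f \<in> ext_space n"
  shows "spinor_act n X f \<in> ext_space n"
proof -
  have "gam n a (gam n b f) I = 0" if "a < 2 * n" "b < 2 * n" "\<not> I \<subseteq> {..<n}" for a b I
    using gam_closed[OF that(1) gam_closed[OF that(2) f]] that(3) by (simp add: ext_space_def)
  then show ?thesis
    unfolding ext_space_def by (auto simp: spinor_act_gam[OF X])
qed

lemma is_rep_spinor: "is_rep n (spinor_rep n)"
proof -
  have sub: "cfun.subspace (ext_space n)"
    by (rule cfun.subspaceI) (auto simp: ext_space_def cscale_def)
  have add: "spinor_act n X (f + g) = spinor_act n X f + spinor_act n X g" if X: "X \<in> orth_alg n" for X f g
    by (rule ext) (simp add: spinor_act_gam[OF X] gam_add distrib_left sum.distrib add_divide_distrib)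
  have scale: "spinor_act n X (cscale c f) = cscale c (spinor_act n X f)" if X: "X \<in> orth_alg n" for X c f
    using spinor_act_sum[OF X, of "\<lambda>_. c" "\<lambda>_. f" "{()}"] by simp
  have madd: "spinor_act n (X + Y) f = spinor_act n X f + spinor_act n Y f"
    if X: "X \<in> orth_alg n" and Y: "Y \<in> orth_alg n" for X Y f
  proof
    fix I
    have "(\<Sum>a<2 * n. \<Sum>b<2 * n. (X + Y) $$ (a, bar n b) * gam n a (gam n b f) I) =
        (\<Sum>a<2 * n. \<Sum>b<2 * n. X $$ (a, bar n b) * gam n a (gam n b f) I + Y $$ (a, bar n b) * gam n a (gam n b f) I)"
      using carrier_matD[OF orth_alg_carrier[OF Y]]
      by (intro sum.cong refl) (simp add: distrib_right)
    then show "spinor_act n (X + Y) f I = (spinor_act n X f + spinor_act n Y f) I"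
      by (simp add: spinor_act_gam X Y orth_alg_add sum.distrib add_divide_distrib)
  qed
  have msmult: "spinor_act n (c \<cdot>\<^sub>m X) f = cscale c (spinor_act n X f)" if X: "X \<in> orth_alg n" for X c f
  proof
    fix I
    have "(\<Sum>a<2 * n. \<Sum>b<2 * n. (c \<cdot>\<^sub>m X) $$ (a, bar n b) * gam n a (gam n b f) I) =
        (\<Sum>a<2 * n. \<Sum>b<2 * n. c * (X $$ (a, bar n b) * gam n a (gam n b f) I))"
      using carrier_matD[OF orth_alg_carrier[OF X]]
      by (intro sum.cong refl) simp
    then show "spinor_act n (c \<cdot>\<^sub>m X) f I = cscale c (spinor_act n X f) I"
      by (simp add: spinor_act_gam X orth_alg_smult cscale_def sum_distrib_left)
  qed
  show ?thesis
    unfolding is_rep_def linear_on_def spinor_rep_def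
    by (simp add: sub image_subset_iff spinor_act_closed add scale madd msmult spinor_act_bracket)
qed

section \<open>The Hermitian form on the exterior algebra\<close>

lemma cnj_ext_sign: "cnj (ext_sign i I) = ext_sign i I"
  by (simp add: ext_sign_def)

text \<open>Removing i matches the sets that contain i with those that do not. The sign is the same
  on both sides because it counts only elements below i.\<close>

lemma ip_ext_mult:
  assumes "i < n"
  shows "(\<Sum>I\<in>Pow {..<n}. ext_mult i f I * cnj (g I)) = (\<Sum>I\<in>Pow {..<n}. f I * cnj (ext_contract i g I))"
proof -
  have "(\<Sum>I\<in>Pow {..<n}. ext_mult i f I * cnj (g I)) =
      (\<Sum>I\<in>{I \<in> Pow {..<n}. i \<in> I}. ext_sign i I * f (I - {i}) * cnj (g I))"
    by (subst sum.inter_filter) (auto simp: ext_mult_def intro!: sum.cong)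
  also have "\<dots> = (\<Sum>J\<in>{J \<in> Pow {..<n}. i \<notin> J}. f J * cnj (ext_sign i J * g (insert i J)))"
    using assms
    by (intro sum.reindex_bij_witness[where i = "insert i" and j = "\<lambda>I. I - {i}"])
       (auto simp: ext_sign_insert ext_sign_remove cnj_ext_sign insert_absorb)
  also have "\<dots> = (\<Sum>I\<in>Pow {..<n}. f I * cnj (ext_contract i g I))"
    by (subst sum.inter_filter) (auto simp: ext_contract_def intro!: sum.cong)
  finally show ?thesis .
qed

lemma ip_gam:
  assumes "a < 2 * n"
  shows "(\<Sum>I\<in>Pow {..<n}. gam n a f I * cnj (g I)) = (\<Sum>I\<in>Pow {..<n}. f I * cnj (gam n (bar n a) g I))"
proof (cases "a < n")
  case True
  then show ?thesis using ip_ext_mult[OF True] by (simp add: gam_def bar_def)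
next
  case False
  then have "a - n < n" using assms by simp
  have "cnj (\<Sum>I\<in>Pow {..<n}. ext_mult (a - n) g I * cnj (f I)) = cnj (\<Sum>I\<in>Pow {..<n}. g I * cnj (ext_contract (a - n) f I))"
    using ip_ext_mult[OF \<open>a - n < n\<close>, of g f] by simp
  then show ?thesis
    using False \<open>a - n < n\<close> by (simp add: gam_def bar_def mult.commute)
qed

text \<open>Taking adjoints reverses each product of two Clifford generators and bars their indices.
  Substituting barred indices in the double sum then yields the quadratic expression of
  \<open>dagger n X\<close>.\<close>

lemma spinor_adjoint:
  assumes X: "X \<in> orth_alg n"
  shows "(\<Sum>I\<in>Pow {..<n}. spinor_act n X f I * cnj (g I)) =
    (\<Sum>I\<in>Pow {..<n}. f I * cnj (spinor_act n (dagger n X) g I))"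
proof -
  let ?P = "Pow {..<n}"
  let ?h = "\<lambda>a b. \<Sum>I\<in>?P. f I * cnj (gam n a (gam n b g) I)"
  have "(\<Sum>I\<in>?P. spinor_act n X f I * cnj (g I)) =
      (\<Sum>I\<in>?P. \<Sum>a<2 * n. \<Sum>b<2 * n. X $$ (a, bar n b) / 2 * (gam n a (gam n b f) I * cnj (g I)))"
    unfolding spinor_act_gam[OF X] by (simp add: sum_distrib_right sum_divide_distrib mult.assoc)
  also have "\<dots> = (\<Sum>a<2 * n. \<Sum>b<2 * n. X $$ (a, bar n b) / 2 * (\<Sum>I\<in>?P. gam n a (gam n b f) I * cnj (g I)))"
    by (subst sum.swap, rule sum.cong[OF refl], subst sum.swap) (simp only: sum_distrib_left)
  also have "\<dots> = (\<Sum>a<2 * n. \<Sum>b<2 * n. X $$ (a, bar n b) / 2 * ?h (bar n b) (bar n a))"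
    by (intro sum.cong refl) (simp add: ip_gam)
  also have "\<dots> = (\<Sum>a<2 * n. \<Sum>b<2 * n. X $$ (a, b) / 2 * ?h b (bar n a))"
  proof (rule sum.cong[OF refl])
    fix a
    have "(\<Sum>b<2 * n. X $$ (a, bar n b) / 2 * ?h (bar n b) (bar n a)) = (\<Sum>b<2 * n. X $$ (a, b) / 2 * ?h b (bar n a))"
      by (rule sum_bar)
    then show "(\<Sum>b<2 * n. X $$ (a, bar n b) / 2 * ?h (bar n b) (bar n a)) = (\<Sum>b<2 * n. X $$ (a, b) / 2 * ?h b (bar n a))" .
  qed
  also have "\<dots> = (\<Sum>a<2 * n. \<Sum>b<2 * n. X $$ (bar n a, b) / 2 * ?h b a)"
  proof -
    have "(\<Sum>a<2 * n. \<Sum>b<2 * n. X $$ (bar n a, b) / 2 * ?h b a) =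
        (\<Sum>a<2 * n. \<Sum>b<2 * n. X $$ (bar n (bar n a), b) / 2 * ?h b (bar n a))"
      by (rule sum_bar[symmetric])
    then show ?thesis by simp
  qed
  also have "\<dots> = (\<Sum>b<2 * n. \<Sum>a<2 * n. X $$ (bar n a, b) / 2 * ?h b a)" by (rule sum.swap)
  also have "\<dots> = (\<Sum>b<2 * n. \<Sum>a<2 * n. \<Sum>I\<in>?P. f I * cnj (dagger n X $$ (b, bar n a) / 2 * gam n b (gam n a g) I))"
  proof (intro sum.cong refl)
    fix a b assume "a \<in> {..<2 * n}" "b \<in> {..<2 * n}"
    then have "dagger n X $$ (b, bar n a) = cnj (X $$ (bar n a, b))" by (simp add: dagger_def)
    then show "X $$ (bar n a, b) / 2 * ?h b a =
        (\<Sum>I\<in>?P. f I * cnj (dagger n X $$ (b, bar n a) / 2 * gam n b (gam n a g) I))"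
      by (simp add: sum_distrib_left mult.left_commute)
  qed
  also have "\<dots> = (\<Sum>I\<in>?P. \<Sum>b<2 * n. \<Sum>a<2 * n. f I * cnj (dagger n X $$ (b, bar n a) / 2 * gam n b (gam n a g) I))"
    by (subst sum.swap[of _ ?P], subst sum.swap[of _ ?P]) (rule refl)
  also have "\<dots> = (\<Sum>I\<in>?P. f I * cnj (spinor_act n (dagger n X) g I))"
    unfolding spinor_act_gam[OF orth_alg_dagger[OF X]]
    by (intro sum.cong refl) (simp add: sum_distrib_left sum_divide_distrib)
  finally show ?thesis .
qed

lemma unitary_spinor:
  assumes "n \<ge> 2"
  shows "unitary_rep n (spinor_rep n) (Pow {..<n}) (set_wt n)"
proof -
  interpret orth_rep n "spinor_rep n" by unfold_locales (rule is_rep_spinor)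
  show ?thesis
  proof (unfold_locales, goal_cases)
    case 1 show ?case by (rule assms)
  next
    case 2 show ?case by simp
  next
    case 3 show ?case by (auto simp: spinor_rep_def ext_space_def)
  next
    case (4 i f)
    then show ?case by (auto simp: spinor_rep_def spinor_act_cartan set_wt_def)
  next
    case (5 b i)
    then show ?case by (simp add: set_wt_def)
  next
    case (6 b)
    have "set_wt n b i - 1 / 2 \<in> \<int>" if "i < n" for i
    proof -
      have "set_wt n b i - 1 / 2 = 0 \<or> set_wt n b i - 1 / 2 = - 1" using that by (auto simp: set_wt_def)
      then show ?thesis by (elim disjE) (simp_all only: Ints_0 Ints_1 Ints_minus)
    qed
    then show ?case by blast
  next
    case (7 X f g)
    then show ?case using spinor_adjoint by (simp add: spinor_rep_def)
  qed
qed

text \<open>Since \<open>L_rep\<close> is a Hilbert choice, the first conjunct records that every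
  summand really is an irreducible module of the stated highest weight; the second is the
  decomposition.\<close>

theorem corollary3p2:
  fixes n N :: nat
  assumes "n \<ge> 2" and "N \<ge> 1"
  shows "(\<forall>\<mu>s \<in> spinor_paths n N.
            irreducible_of_highest_weight n (\<Sum>i<N. \<mu>s ! i) (L_rep n (\<Sum>i<N. \<mu>s ! i))) \<and>
         rep_iso n (tensor_power N (spinor_rep n))
           (direct_sum (spinor_paths n N) (\<lambda>\<mu>s. L_rep n (\<Sum>i<N. \<mu>s ! i)))"
proof -
  interpret S: unitary_rep n "spinor_rep n" "Pow {..<n}" "set_wt n"
    by (rule unitary_spinor[OF assms(1)])
  interpret T: unitary_rep n "tensor_power N (spinor_rep n)" "S.words N" S.word_wt
    by (rule S.unitary_tensor_power)
  have paths: "spinor_paths n N = dominant_paths n N"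
    by (rule spinor_paths_eq_dominant_paths[OF assms])
  have "(\<Sum>I\<in>Pow {..<n}. xexp (set_wt n I)) = spin_char n"
    unfolding spin_char_def by (rule sum.reindex_bij_betw[OF bij_betw_set_wt])
  then have char: "(\<Sum>bs\<in>S.words N. xexp (S.word_wt bs)) = spin_char n ^ N"
    unfolding S.char_words by (simp only:)
  show ?thesis
  proof (rule T.decomposition)
    show "finite (spinor_paths n N)" unfolding paths by (rule finite_dominant_paths)
    show "(\<Sum>i<N. \<mu>s ! i) \<in> dominant_weights n" if "\<mu>s \<in> spinor_paths n N" for \<mu>s
      using that unfolding paths dominant_paths_def by blast
    show "Poly_Mapping.lookup (weyl_denom n * (\<Sum>bs\<in>S.words N. xexp (S.word_wt bs))) (\<kappa> + rho n) =
        of_nat (card {\<mu>s \<in> spinor_paths n N. (\<Sum>i<N. \<mu>s ! i) = \<kappa>})"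
      if "\<kappa> \<in> dominant_weights n" for \<kappa>
      unfolding char paths by (rule card_dominant_paths[OF assms(1) that])
  qed
qed

end
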